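(* Let $W$ be a finite Coxeter group all of whose irreducible components are of type $A$, $B$ or $D$, and let $T$ be its set of reflections. Let $g \in W$ be an arbitrary element, and let $\underline{t}=(t_1,\dots,t_m)$ and $\underline{r}=(r_1,\dots,r_{m'})$ be two reflection factorizations of $g$. Then $\underline{t}$ and $\underline{r}$ belong to the same Hurwitz orbit if and only if they generate the same subgroup of $W$, i.e. $\langle t_1,\dots,t_m\rangle=\langle r_1,\dots,r_{m'}\rangle=:H$, and they have the same multiset of $H$-conjugacy classes, i.e. the multiset of $H$-conjugacy classes of the entries $t_1,\dots,t_m$ equals the multiset of $H$-conjugacy classes of the entries $r_1,\dots,r_{m'}$.
   Context: A Coxeter group $W$ comes with its distinguished generating set $S$ of simple reflections; the set of reflections is $T=\{gsg^{-1} : g\in W,\ s\in S\}$. A reflection factorization of $g\in W$ is a tuple $(t_1,\dots,t_m)\in T^m$ with $g=t_1\cdots t_m$. The braid group $\mathcal{B}_m$ on $m$ strands, with standard generators $\sigma_1,\dots,\sigma_{m-1}$, acts on $T^m$ by the Hurwitz action $$\sigma_i\cdot(t_1,\dots,t_m)=(t_1,\dots,t_{i-1},\ t_{i+1},\ t_{i+1}^{-1}t_it_{i+1},\ t_{i+2},\dots,t_m),$$ $$\sigma_i^{-1}\cdot(t_1,\dots,t_m)=(t_1,\dots,t_{i-1},\ t_it_{i+1}t_i^{-1},\ t_i,\ t_{i+2},\dots,t_m).$$ This action preserves the product of the tuple. Hurwitz orbits are the orbits of this action (so two tuples in the same orbit have the same length). *)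

theory Defs
  imports "HOL-Algebra.Generated_Groups" "HOL-Library.Multiset"
begin

section \<open>Coxeter systems\<close>

definition group_prod :: "('a, 'b) monoid_scheme \<Rightarrow> 'a list \<Rightarrow> 'a" where
  "group_prod G xs = foldr (\<otimes>\<^bsub>G\<^esub>) xs \<one>\<^bsub>G\<^esub>"

text \<open>The value \<open>0\<close> of a Coxeter matrix encodes \<open>\<infinity>\<close>, that is, the absence of a relation.\<close>

definition coxeter_matrix :: "'a set \<Rightarrow> ('a \<Rightarrow> 'a \<Rightarrow> nat) \<Rightarrow> bool" where
  "coxeter_matrix S M \<longleftrightarrow>
     (\<forall>s\<in>S. M s s = 1) \<and>
     (\<forall>s\<in>S. \<forall>t\<in>S. s \<noteq> t \<longrightarrow> M s t = M t s \<and> M s t \<noteq> 1)"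

text \<open>The congruence on words over \<open>S\<close> generated by the relators \<open>(s t)^(M s t)\<close>.
  Since \<open>M s s = 1\<close> makes every generator its own inverse, the quotient of the free monoid by
  this congruence is the group presented by the generators \<open>S\<close> and these relators.
  For \<open>M s t = 0\<close> the relator is the empty word and imposes nothing.\<close>

inductive coxeter_equiv :: "'a set \<Rightarrow> ('a \<Rightarrow> 'a \<Rightarrow> nat) \<Rightarrow> 'a list \<Rightarrow> 'a list \<Rightarrow> bool"
  for S M where
  relator: "\<lbrakk>s \<in> S; t \<in> S\<rbrakk> \<Longrightarrow> coxeter_equiv S M (concat (replicate (M s t) [s, t])) []"
| refl: "u \<in> lists S \<Longrightarrow> coxeter_equiv S M u u"
| sym: "coxeter_equiv S M u v \<Longrightarrow> coxeter_equiv S M v u"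
| trans: "\<lbrakk>coxeter_equiv S M u v; coxeter_equiv S M v w\<rbrakk> \<Longrightarrow> coxeter_equiv S M u w"
| append: "\<lbrakk>coxeter_equiv S M u v; coxeter_equiv S M u' v'\<rbrakk>
             \<Longrightarrow> coxeter_equiv S M (u @ u') (v @ v')"

text \<open>\<open>W\<close> is presented by the generators \<open>S\<close> subject to \<open>(s t)^(M s t) = 1\<close>.\<close>

definition coxeter_system ::
  "('a, 'b) monoid_scheme \<Rightarrow> 'a set \<Rightarrow> ('a \<Rightarrow> 'a \<Rightarrow> nat) \<Rightarrow> bool" where
  "coxeter_system W S M \<longleftrightarrow>
     group W \<and> S \<subseteq> carrier W \<and> coxeter_matrix S M \<and>
     generate W S = carrier W \<and>
     (\<forall>u\<in>lists S. \<forall>v\<in>lists S. group_prod W u = group_prod W v \<longleftrightarrow> coxeter_equiv S M u v)"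

definition coxeter_edges :: "'a set \<Rightarrow> ('a \<Rightarrow> 'a \<Rightarrow> nat) \<Rightarrow> ('a \<times> 'a) set" where
  "coxeter_edges S M = {(s, t). s \<in> S \<and> t \<in> S \<and> s \<noteq> t \<and> M s t \<noteq> 2}"

text \<open>The irreducible components of \<open>(W, S)\<close>, each represented by its set of simple reflections:
  the vertex sets of the connected components of the Coxeter graph.\<close>

definition irreducible_components :: "'a set \<Rightarrow> ('a \<Rightarrow> 'a \<Rightarrow> nat) \<Rightarrow> 'a set set" where
  "irreducible_components S M = S // (coxeter_edges S M)\<^sup>*"

text \<open>The Coxeter matrices of types \<open>A\<^sub>n\<close>, \<open>B\<^sub>n\<close>, \<open>D\<^sub>n\<close> on the index set \<open>{..<n}\<close>.
  Type \<open>A\<close> is the path \<open>0 - 1 - 2 - \<dots>\<close>; in type \<open>B\<close> the edge \<open>0 - 1\<close> is labelled \<open>4\<close>;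
  in type \<open>D\<close> the vertex \<open>0\<close> is attached to \<open>2\<close> instead of \<open>1\<close>.\<close>

definition matrix_A :: "nat \<Rightarrow> nat \<Rightarrow> nat" where
  "matrix_A i j = (if i = j then 1 else if j = Suc i \<or> i = Suc j then 3 else 2)"

definition matrix_B :: "nat \<Rightarrow> nat \<Rightarrow> nat" where
  "matrix_B i j = (if {i, j} = {0, 1} then 4 else matrix_A i j)"

definition matrix_D :: "nat \<Rightarrow> nat \<Rightarrow> nat" where
  "matrix_D i j =
     (if {i, j} = {0, 1} then 2 else if {i, j} = {0, 2} then 3 else matrix_A i j)"

definition matrix_iso ::
  "('a \<Rightarrow> 'a \<Rightarrow> nat) \<Rightarrow> 'a set \<Rightarrow> (nat \<Rightarrow> nat \<Rightarrow> nat) \<Rightarrow> nat \<Rightarrow> bool" where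
  "matrix_iso M C N n \<longleftrightarrow>
     (\<exists>f. bij_betw f {..<n} C \<and> (\<forall>i<n. \<forall>j<n. M (f i) (f j) = N i j))"

definition type_A :: "('a \<Rightarrow> 'a \<Rightarrow> nat) \<Rightarrow> 'a set \<Rightarrow> bool" where
  "type_A M C \<longleftrightarrow> (\<exists>n\<ge>1. matrix_iso M C matrix_A n)"

definition type_B :: "('a \<Rightarrow> 'a \<Rightarrow> nat) \<Rightarrow> 'a set \<Rightarrow> bool" where
  "type_B M C \<longleftrightarrow> (\<exists>n\<ge>2. matrix_iso M C matrix_B n)"

definition type_D :: "('a \<Rightarrow> 'a \<Rightarrow> nat) \<Rightarrow> 'a set \<Rightarrow> bool" where
  "type_D M C \<longleftrightarrow> (\<exists>n\<ge>4. matrix_iso M C matrix_D n)"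

section \<open>Reflection factorizations and the Hurwitz action\<close>

definition reflections :: "('a, 'b) monoid_scheme \<Rightarrow> 'a set \<Rightarrow> 'a set" where
  "reflections W S = {g \<otimes>\<^bsub>W\<^esub> s \<otimes>\<^bsub>W\<^esub> inv\<^bsub>W\<^esub> g | g s. g \<in> carrier W \<and> s \<in> S}"

definition reflection_factorization ::
  "('a, 'b) monoid_scheme \<Rightarrow> 'a set \<Rightarrow> 'a \<Rightarrow> 'a list \<Rightarrow> bool" where
  "reflection_factorization W S g ts \<longleftrightarrow> ts \<in> lists (reflections W S) \<and> group_prod W ts = g"

text \<open>Positions are counted from \<open>0\<close>: \<open>Sigma i\<close> and \<open>Sigma_inv i\<close> stand for
  \<open>\<sigma>\<^sub>i\<^sub>+\<^sub>1\<close> and its inverse.\<close>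

datatype braid_letter = Sigma nat | Sigma_inv nat

definition braid_letters :: "nat \<Rightarrow> braid_letter set" where
  "braid_letters m = {Sigma i | i. Suc i < m} \<union> {Sigma_inv i | i. Suc i < m}"

fun hurwitz_letter :: "('a, 'b) monoid_scheme \<Rightarrow> braid_letter \<Rightarrow> 'a list \<Rightarrow> 'a list" where
  "hurwitz_letter G (Sigma i) ts =
     ts[i := ts ! Suc i,
        Suc i := inv\<^bsub>G\<^esub> (ts ! Suc i) \<otimes>\<^bsub>G\<^esub> ts ! i \<otimes>\<^bsub>G\<^esub> ts ! Suc i]"
| "hurwitz_letter G (Sigma_inv i) ts =
     ts[i := ts ! i \<otimes>\<^bsub>G\<^esub> ts ! Suc i \<otimes>\<^bsub>G\<^esub> inv\<^bsub>G\<^esub> (ts ! i),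
        Suc i := ts ! i]"

text \<open>Braids on \<open>m = length ts\<close> strands are represented by words in the standard generators and
  their inverses. The braid relations act trivially on tuples of group elements, so the orbit
  under the braid group consists of the images of the tuple under all such words.\<close>

definition hurwitz_action ::
  "('a, 'b) monoid_scheme \<Rightarrow> braid_letter list \<Rightarrow> 'a list \<Rightarrow> 'a list" where
  "hurwitz_action G w ts = foldr (hurwitz_letter G) w ts"

definition hurwitz_orbit :: "('a, 'b) monoid_scheme \<Rightarrow> 'a list \<Rightarrow> 'a list set" where
  "hurwitz_orbit G ts = {hurwitz_action G w ts | w. w \<in> lists (braid_letters (length ts))}"

definition conj_class :: "('a, 'b) monoid_scheme \<Rightarrow> 'a set \<Rightarrow> 'a \<Rightarrow> 'a set" where
  "conj_class G H x = {h \<otimes>\<^bsub>G\<^esub> x \<otimes>\<^bsub>G\<^esub> inv\<^bsub>G\<^esub> h | h. h \<in> H}"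

end

theory Submission
  imports Defs
begin

text \<open>The generated subgroup and the multiset of classes do not change when \<open>(a, b)\<close> is replaced by
  \<open>(b, b\<inverse>ab)\<close>, so the content is the converse.

  The groups of types \<open>A\<close>, \<open>B\<close>, \<open>D\<close> and their products act faithfully by signed permutations, and
  their reflections act by the maps \<open>R p q\<close> exchanging \<open>p\<close> with \<open>q\<close> and \<open>-p\<close> with \<open>-q\<close>
  (\<open>coxeter_representation\<close>). Faithfulness is Tits' argument: a word whose length grows on appending \<open>s\<close>
  maps the root of \<open>s\<close> to a positive root (\<open>ascent_positive\<close>). All conditions of the theorem only involve
  the group generated by the factors, so it suffices to treat lists of reflections in the group of all
  signed permutations. Such a list is a signed graph: \<open>R p q\<close> is an edge between the
  underlying vertices of \<open>p\<close> and \<open>q\<close>, and it is a half-edge if \<open>q = -p\<close>.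

  Edges in different connected components commute, so one component may be considered at a time. There
  the data to be compared are the product, the length, the number of half-edges, and the orbit
  relation of the generated group on signed points, which records whether the graph is balanced, that is,
  whether the group is of type \<open>A\<close> up to a change of signs. The proof is by induction on the number of vertices.

  Fix a vertex \<open>v\<close> and choose, in the given Hurwitz orbit, a list with as few entries moving \<open>v\<close>
  as possible. These entries can be collected at the end. Two adjacent ones with different targets could be
  replaced by two entries of which only one moves \<open>v\<close>, hence all of them join \<open>v\<close> to one vertex \<open>a\<close>
  (only half-edges at \<open>v\<close> would leave \<open>v\<close> disconnected from the other vertices).
  A pair of equal adjacent entries \<open>x, x\<close> commutes past everything and may be conjugated by
  every other entry, so with three or more entries at \<open>v\<close> such a pair could be turned towards a
  third vertex, if there is one, contradicting minimality. What is left at \<open>v\<close> is one edge, a double edge, or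
  the two edges from \<open>v\<close> to \<open>a\<close> and \<open>-a\<close> (\<open>split_at_vertex\<close>). The value \<open>g v\<close> of the product tells
  which: it is neither \<open>v\<close> nor \<open>-v\<close>, or \<open>v\<close>, or \<open>-v\<close>. A single edge is read off from \<open>g\<close>. A double edge can be
  turned to any prescribed admissible neighbour. The third case is awkward, because the
  remaining entries could generate a smaller type; it is avoided by choosing
  \<open>v\<close> with \<open>g v \<noteq> -v\<close>, unless \<open>g\<close> is \<open>-1\<close> on the component. If it is, the remaining entries still
  reverse a point, which fixes their orbit relation, and since \<open>g\<close> is central the whole list may be conjugated by
  its entries, which moves \<open>a\<close> to the desired place. In all cases the entries away from \<open>v\<close> are
  compared by induction.

  The exception is type \<open>D\<^sub>2\<close>, two commuting edges on two vertices: these are not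
  conjugate, and their multiplicities have to be compared separately. They become conjugate as soon as a third
  vertex is attached, and then all but one or two copies of one of them can be converted to the other (\<open>D2_normalise\<close>).\<close>

section \<open>Signed permutations and their reflections\<close>

text \<open>The signed unit vectors \<open>e\<^sub>v\<close> and \<open>-e\<^sub>v\<close> for a vertex \<open>v\<close>.\<close>

datatype 'v point = Pt (vert: 'v) (sgn: bool)

definition neg :: "'v point \<Rightarrow> 'v point" where
  "neg p = Pt (vert p) (\<not> sgn p)"

text \<open>The reflection in the root \<open>e\<^sub>p - e\<^sub>q\<close>; for \<open>q = neg p\<close> it is the sign change at the vertex of \<open>p\<close>, so all reflections of type \<open>B\<close>
  have this one form.\<close>

definition R :: "'v point \<Rightarrow> 'v point \<Rightarrow> 'v point \<Rightarrow> 'v point" where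
  "R p q z = (if z = p then q else if z = q then p
              else if z = neg p then neg q else if z = neg q then neg p else z)"

lemma neg_neg [simp]: "neg (neg p) = p" by (simp add: neg_def)
lemma vert_neg [simp]: "vert (neg p) = vert p" by (simp add: neg_def)
lemma neg_neq [simp]: "neg p \<noteq> p" "p \<noteq> neg p" by (auto simp: neg_def point.expand dest: arg_cong[where f=sgn])
lemma neg_inj [simp]: "neg p = neg q \<longleftrightarrow> p = q" by (metis neg_neg)
lemma vert_eq_iff: "vert p = vert q \<longleftrightarrow> p = q \<or> p = neg q"
  by (cases p; cases q) (auto simp: neg_def)
lemma neg_eq_swap: "neg p = q \<longleftrightarrow> p = neg q" by (metis neg_neg)

definition refls :: "'v set \<Rightarrow> ('v point \<Rightarrow> 'v point) set" where
  "refls V = {R p q | p q. p \<noteq> q \<and> vert p \<in> V \<and> vert q \<in> V}"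

abbreviation Refl :: "('v point \<Rightarrow> 'v point) set" where
  "Refl \<equiv> refls UNIV"

text \<open>For an involution \<open>y\<close> this is conjugation by \<open>y\<close>.\<close>

definition conj_by :: "('p \<Rightarrow> 'p) \<Rightarrow> ('p \<Rightarrow> 'p) \<Rightarrow> 'p \<Rightarrow> 'p" where
  "conj_by y x = y \<circ> x \<circ> y"

lemma conj_apply: "conj_by y x z = y (x (y z))" by (simp add: conj_by_def)

lemma R_R [simp]: "R p q (R p q z) = z"
  by (auto simp: R_def neg_eq_swap)
lemma R_neg [simp]: "R p q (neg z) = neg (R p q z)"
  by (auto simp: R_def neg_eq_swap)
lemma R_sym: "R p q = R q p"
  by (auto simp: R_def fun_eq_iff)
lemma R_negs: "R (neg p) (neg q) = R p q"
  by (auto simp: R_def fun_eq_iff)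
lemma R_left [simp]: "R p q p = q" by (simp add: R_def)
lemma R_right [simp]: "R p q q = p" by (simp add: R_def)
lemma R_fix: "vert z \<noteq> vert p \<Longrightarrow> vert z \<noteq> vert q \<Longrightarrow> R p q z = z"
  by (auto simp: R_def)

lemma refls_mono: "V \<subseteq> V' \<Longrightarrow> refls V \<subseteq> refls V'"
  by (auto simp: refls_def)
lemma refls_Refl: "x \<in> refls V \<Longrightarrow> x \<in> Refl"
  by (auto simp: refls_def)
lemma refl_invol [simp]: "x \<in> Refl \<Longrightarrow> x (x z) = z"
  by (auto simp: refls_def)
lemma refl_neg: "x \<in> Refl \<Longrightarrow> x (neg z) = neg (x z)"
  by (auto simp: refls_def)
lemma refl_inj: "x \<in> Refl \<Longrightarrow> x z = x z' \<longleftrightarrow> z = z'"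
  by (metis refl_invol)
lemma refl_comp: "x \<in> Refl \<Longrightarrow> x \<circ> x = id" by auto

lemma conj_conj [simp]: "y \<in> Refl \<Longrightarrow> conj_by y (conj_by y x) = x"
  by (auto simp: conj_by_def)

text \<open>Conjugation transports the two points of a reflection; every computation with reflections
  below reduces to this.\<close>

lemma signed_R:
  assumes "inj w" "\<And>z. w (neg z) = neg (w z)"
  shows "w \<circ> R p q = R (w p) (w q) \<circ> w"
  using assms by (auto simp: R_def fun_eq_iff inj_eq simp flip: assms(2))

lemma conj_R: assumes "y \<in> Refl" shows "conj_by y (R p q) = R (y p) (y q)"
proof -
  have "y \<circ> R p q = R (y p) (y q) \<circ> y"
    using assms by (intro signed_R) (auto simp: refl_neg inj_def refl_inj)
  then show ?thesis using assms by (simp add: conj_by_def comp_assoc refl_comp)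
qed

lemma refl_eq_R:
  assumes "x \<in> Refl" "x z \<noteq> z" shows "x = R z (x z)"
proof -
  obtain p q where x: "x = R p q" "p \<noteq> q" using assms by (auto simp: refls_def)
  have "z = p \<or> z = q \<or> z = neg p \<or> z = neg q" using assms x by (auto simp: R_def split: if_splits)
  then show ?thesis using x R_sym R_negs by (metis R_neg R_left R_right)
qed

lemma R_in_refls: "p \<noteq> q \<Longrightarrow> vert p \<in> V \<Longrightarrow> vert q \<in> V \<Longrightarrow> R p q \<in> refls V"
  by (auto simp: refls_def)

lemma refls_fix: "x \<in> refls V \<Longrightarrow> vert z \<notin> V \<Longrightarrow> x z = z"
  by (auto simp: refls_def intro!: R_fix)

lemma refls_into: "x \<in> refls V \<Longrightarrow> vert z \<in> V \<Longrightarrow> vert (x z) \<in> V"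
  by (auto simp: refls_def R_def)

lemma refls_remove:
  assumes "x \<in> refls V" "x z = z" shows "x \<in> refls (V - {vert z})"
proof -
  obtain p q where x: "x = R p q" "p \<noteq> q" "vert p \<in> V" "vert q \<in> V"
    using assms by (auto simp: refls_def)
  have "z \<noteq> p" "z \<noteq> q" using assms(2) x(2) unfolding x(1) by force+
  moreover have "z \<noteq> neg p" "z \<noteq> neg q"
    using assms(2) x(2) unfolding x(1) by (metis R_left R_right R_neg neg_inj)+
  ultimately have "vert p \<noteq> vert z" "vert q \<noteq> vert z" by (auto simp: vert_eq_iff)
  then show ?thesis using x by (auto simp: refls_def)
qed

lemma refls_moved: assumes "x \<in> refls V" "x z \<noteq> z" shows "vert z \<in> V"
  using assms refls_fix by metis

lemma conj_refls:
  assumes "x \<in> refls V" "y \<in> refls V" shows "conj_by y x \<in> refls V"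
proof -
  obtain p q where x: "x = R p q" "p \<noteq> q" "vert p \<in> V" "vert q \<in> V"
    using assms by (auto simp: refls_def)
  have "y \<in> Refl" using assms refls_Refl by blast
  then show ?thesis using x assms
    by (simp add: conj_R) (intro R_in_refls, auto simp: refl_inj refls_into)
qed

lemma conj_refls_iff:
  assumes "y \<in> refls V" shows "conj_by y x \<in> refls V \<longleftrightarrow> x \<in> refls V"
  using assms conj_refls conj_conj refls_Refl by metis

text \<open>For a reflection: being the sign change of a single vertex.\<close>

definition half :: "('v point \<Rightarrow> 'v point) \<Rightarrow> bool" where
  "half x \<longleftrightarrow> (\<exists>p. x p = neg p)"

lemma half_conj: assumes "y \<in> Refl" shows "half (conj_by y x) \<longleftrightarrow> half x"
proof -
  have *: "half x \<Longrightarrow> half (conj_by y x)" for x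
    unfolding half_def conj_apply using assms by (metis refl_invol refl_neg)
  show ?thesis using *[of x] *[of "conj_by y x"] assms by auto
qed

lemma half_R: "p \<noteq> q \<Longrightarrow> half (R p q) \<longleftrightarrow> q = neg p"
  unfolding half_def R_def by (auto split: if_splits simp: neg_eq_swap)

section \<open>Hurwitz equivalence of lists of reflections\<close>

text \<open>The letters of the braid group are only used on reflections, where \<open>b\<inverse> = b\<close>; closing the moves
  under symmetry supplies the inverse letters.\<close>

inductive hurwitz_equiv :: "('v point \<Rightarrow> 'v point) list \<Rightarrow> ('v point \<Rightarrow> 'v point) list \<Rightarrow> bool" where
  step: "a \<in> Refl \<Longrightarrow> b \<in> Refl \<Longrightarrow> hurwitz_equiv (xs @ [a, b] @ ys) (xs @ [b, conj_by b a] @ ys)"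
| refl: "hurwitz_equiv t t"
| sym: "hurwitz_equiv t s \<Longrightarrow> hurwitz_equiv s t"
| trans: "hurwitz_equiv t s \<Longrightarrow> hurwitz_equiv s u \<Longrightarrow> hurwitz_equiv t u"

declare hurwitz_equiv.trans [trans]

definition composite :: "('p \<Rightarrow> 'p) list \<Rightarrow> 'p \<Rightarrow> 'p" where
  "composite t = foldr (\<circ>) t id"

lemma composite_Nil [simp]: "composite [] = id" by (simp add: composite_def)
lemma composite_Cons [simp]: "composite (x # t) = x \<circ> composite t" by (simp add: composite_def)
lemma composite_append [simp]: "composite (s @ t) = composite s \<circ> composite t"
  by (induction s) (auto simp: comp_assoc)

text \<open>The orbit relation on points of the group generated by the entries (when these are involutions).\<close>

definition orb :: "('p \<Rightarrow> 'p) list \<Rightarrow> ('p \<times> 'p) set" where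
  "orb t = {(p, x p) | p x. x \<in> set t}\<^sup>*"

lemma orb_refl [simp]: "(p, p) \<in> orb t" by (simp add: orb_def)
lemma orb_step: "x \<in> set t \<Longrightarrow> (p, x p) \<in> orb t" by (auto simp: orb_def)
lemma orb_trans: "(p, q) \<in> orb t \<Longrightarrow> (q, r) \<in> orb t \<Longrightarrow> (p, r) \<in> orb t"
  by (auto simp: orb_def)
lemma orb_least:
  assumes "\<And>p x. x \<in> set t \<Longrightarrow> (p, x p) \<in> orb s" shows "orb t \<subseteq> orb s"
proof -
  have "{(p, x p) | p x. x \<in> set t} \<subseteq> orb s" using assms by auto
  then show ?thesis unfolding orb_def using rtrancl_subset_rtrancl by blast
qed
lemma orb_mono: "set t \<subseteq> set s \<Longrightarrow> orb t \<subseteq> orb s"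
  by (rule orb_least) (auto intro: orb_step)

lemma orb_induct [consumes 1, case_names base step]:
  assumes "(p, q) \<in> orb t" "Q p" "\<And>z x. (p, z) \<in> orb t \<Longrightarrow> Q z \<Longrightarrow> x \<in> set t \<Longrightarrow> Q (x z)"
  shows "Q q"
  using assms(1) unfolding orb_def
  by (induction rule: rtrancl_induct) (use assms(2,3) in \<open>auto simp: orb_def\<close>)

lemma orb_sym: assumes "set t \<subseteq> Refl" "(p, q) \<in> orb t" shows "(q, p) \<in> orb t"
  using assms(2)
proof (induction rule: orb_induct)
  case (step z x)
  have "x (x z) = z" using step assms by auto
  then show ?case using orb_step[of x t "x z"] step orb_trans by metis
qed auto

lemma orb_neg: assumes "set t \<subseteq> Refl" "(p, q) \<in> orb t" shows "(neg p, neg q) \<in> orb t"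
  using assms(2)
proof (induction rule: orb_induct)
  case (step z x)
  have "x (neg z) = neg (x z)" using step assms refl_neg by blast
  then show ?case using orb_step[of x t "neg z"] step orb_trans by metis
qed auto

lemma orb_composite: "(p, composite t p) \<in> orb t"
proof (induction t)
  case (Cons x t)
  have "(p, composite t p) \<in> orb (x # t)" using Cons orb_mono[of t "x # t"] by auto
  then show ?case using orb_step[of x "x # t" "composite t p"] orb_trans by fastforce
qed simp

abbreviation cnt :: "('b \<Rightarrow> bool) \<Rightarrow> 'b list \<Rightarrow> nat" where
  "cnt Q t \<equiv> length (filter Q t)"

lemma hurwitz_length: "hurwitz_equiv t s \<Longrightarrow> length t = length s"
  by (induction rule: hurwitz_equiv.induct) auto
lemma hurwitz_composite: "hurwitz_equiv t s \<Longrightarrow> composite t = composite s"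
  by (induction rule: hurwitz_equiv.induct) (auto simp: conj_by_def fun_eq_iff)
lemma hurwitz_refls_iff: "hurwitz_equiv t s \<Longrightarrow> set t \<subseteq> refls V \<longleftrightarrow> set s \<subseteq> refls V"
  by (induction rule: hurwitz_equiv.induct) (auto simp: conj_refls_iff)
lemma hurwitz_half: "hurwitz_equiv t s \<Longrightarrow> cnt half t = cnt half s"
  by (induction rule: hurwitz_equiv.induct) (auto simp: half_conj)
text \<open>The entries of either list are products of entries of the other one.\<close>

lemma hurwitz_orb: "hurwitz_equiv t s \<Longrightarrow> orb t = orb s"
proof (induction rule: hurwitz_equiv.induct)
  case (step a b xs ys)
  let ?t = "xs @ [a, b] @ ys" and ?s = "xs @ [b, conj_by b a] @ ys"
  have "orb ?t \<subseteq> orb ?s"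
  proof (rule orb_least)
    fix p x assume x: "x \<in> set ?t"
    show "(p, x p) \<in> orb ?s"
    proof (cases "x = a")
      case True
      have "(p, b p) \<in> orb ?s" "(b p, conj_by b a (b p)) \<in> orb ?s"
        "(conj_by b a (b p), b (conj_by b a (b p))) \<in> orb ?s" by (auto intro!: orb_step)
      then have "(p, b (conj_by b a (b p))) \<in> orb ?s" using orb_trans by metis
      then show ?thesis using True step by (simp add: conj_apply)
    qed (use x in \<open>auto intro!: orb_step\<close>)
  qed
  moreover have "orb ?s \<subseteq> orb ?t"
  proof (rule orb_least)
    fix p x assume x: "x \<in> set ?s"
    show "(p, x p) \<in> orb ?t"
    proof (cases "x = conj_by b a")
      case True
      have "(p, b p) \<in> orb ?t" "(b p, a (b p)) \<in> orb ?t"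
        "(a (b p), b (a (b p))) \<in> orb ?t" by (auto intro!: orb_step)
      then have "(p, b (a (b p))) \<in> orb ?t" using orb_trans by metis
      then show ?thesis using True by (simp add: conj_apply)
    qed (use x in \<open>auto intro!: orb_step\<close>)
  qed
  ultimately show ?case by blast
qed auto

lemma hurwitz_append: "hurwitz_equiv t s \<Longrightarrow> hurwitz_equiv (u @ t @ w) (u @ s @ w)"
proof (induction rule: hurwitz_equiv.induct)
  case (step a b xs ys)
  show ?case using hurwitz_equiv.step[OF step, of "u @ xs" "ys @ w"] by simp
qed (auto intro: hurwitz_equiv.intros)

lemma hurwitz_appendL: "hurwitz_equiv t s \<Longrightarrow> hurwitz_equiv (u @ t) (u @ s)" using hurwitz_append[of t s u "[]"] by simp
lemma hurwitz_appendR: "hurwitz_equiv t s \<Longrightarrow> hurwitz_equiv (t @ w) (s @ w)" using hurwitz_append[of t s "[]" w] by simp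
lemma hurwitz_Cons: "hurwitz_equiv t s \<Longrightarrow> hurwitz_equiv (x # t) (x # s)" using hurwitz_appendL[of t s "[x]"] by simp
lemma hurwitz_append2: "hurwitz_equiv t s \<Longrightarrow> hurwitz_equiv t' s' \<Longrightarrow> hurwitz_equiv (t @ t') (s @ s')"
  using hurwitz_appendL[of t' s' t] hurwitz_appendR[of t s s'] hurwitz_equiv.trans by blast

lemma swapR: "a \<in> Refl \<Longrightarrow> b \<in> Refl \<Longrightarrow> hurwitz_equiv [a, b] [b, conj_by b a]"
  using hurwitz_equiv.step[of a b "[]" "[]"] by simp
lemma swapL: assumes "a \<in> Refl" "b \<in> Refl" shows "hurwitz_equiv [a, b] [conj_by a b, a]"
  using swapR[of "conj_by a b" a] conj_refls[of b UNIV a] assms hurwitz_equiv.sym by auto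

lemma block_right:
  assumes "set X \<subseteq> Refl" "y \<in> Refl" shows "hurwitz_equiv (X @ [y]) (y # map (conj_by y) X)"
  using assms(1)
proof (induction X)
  case (Cons x X)
  have "hurwitz_equiv ((x # X) @ [y]) ([x, y] @ map (conj_by y) X)"
    using hurwitz_Cons[OF Cons.IH] Cons by auto
  also have "hurwitz_equiv \<dots> ([y, conj_by y x] @ map (conj_by y) X)"
    using Cons assms by (intro hurwitz_appendR swapR) auto
  finally show ?case by simp
qed (auto intro: hurwitz_equiv.refl)

lemma elem_right:
  assumes "set Y \<subseteq> Refl" "x \<in> Refl"
  shows "hurwitz_equiv (x # Y) (Y @ [fold conj_by Y x])"
  using assms
proof (induction Y arbitrary: x)
  case (Cons y Y)
  have "hurwitz_equiv ([x, y] @ Y) ([y, conj_by y x] @ Y)" using Cons by (intro hurwitz_appendR swapR) auto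
  moreover have "hurwitz_equiv ([y, conj_by y x] @ Y) (y # Y @ [fold conj_by Y (conj_by y x)])"
    using Cons conj_refls[of x UNIV y] by (auto intro!: hurwitz_Cons)
  ultimately show ?case using hurwitz_equiv.trans by auto
qed (auto intro: hurwitz_equiv.refl)

lemma foldr_conj_Refl: "set Z \<subseteq> Refl \<Longrightarrow> y \<in> Refl \<Longrightarrow> foldr conj_by Z y \<in> Refl"
  by (induction Z) (auto intro: conj_refls)

lemma elem_left:
  assumes "set Z \<subseteq> Refl" "y \<in> Refl"
  shows "hurwitz_equiv (Z @ [y]) (foldr conj_by Z y # Z)"
  using assms
proof (induction Z)
  case (Cons z Z)
  have 1: "hurwitz_equiv ((z # Z) @ [y]) ([z, foldr conj_by Z y] @ Z)"
    using hurwitz_Cons[OF Cons.IH] Cons.prems by simp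
  have "hurwitz_equiv ([z, foldr conj_by Z y] @ Z) ([conj_by z (foldr conj_by Z y), z] @ Z)"
    using Cons.prems by (intro hurwitz_appendR swapL foldr_conj_Refl) auto
  from hurwitz_equiv.trans[OF 1 this] show ?case by simp
qed (auto intro: hurwitz_equiv.refl)

text \<open>Carrying \<open>y\<close> leftwards over \<open>Z\<close> conjugates it by the composite of \<open>Z\<close>.\<close>

lemma foldr_conj: "set Z \<subseteq> Refl \<Longrightarrow> foldr conj_by Z y \<circ> composite Z = composite Z \<circ> y"
proof (induction Z)
  case (Cons z Z)
  then have "foldr conj_by Z y (composite Z a) = composite Z (y a)" for a by (simp add: fun_eq_iff)
  then show ?case using Cons.prems
    by (simp add: fun_eq_iff conj_apply[of z "foldr conj_by Z y"])
qed simp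

lemma composite_bij: "set Z \<subseteq> Refl \<Longrightarrow> bij (composite Z)"
proof (induction Z)
  case (Cons z Z)
  have "bij z" using Cons by (intro o_bij[of z]) (auto)
  moreover have "bij (composite Z)" using Cons by simp
  ultimately show ?case unfolding composite_Cons by (rule bij_comp[rotated])
qed simp

lemma bij_cancel_right: "bij (h::'x\<Rightarrow>'x) \<Longrightarrow> f \<circ> h = g \<circ> h \<longleftrightarrow> f = g"
  by (metis bij_is_surj comp_assoc comp_id surj_iff)
lemma bij_cancel_left: "bij (h::'x\<Rightarrow>'x) \<Longrightarrow> h \<circ> f = h \<circ> g \<longleftrightarrow> f = g"
  by (metis bij_is_inj comp_assoc id_comp inj_iff)

text \<open>The product of a pair is the identity, so the pair passes over other entries without changing them.\<close>

lemma pair_right: "x \<in> Refl \<Longrightarrow> set Y \<subseteq> Refl \<Longrightarrow> hurwitz_equiv ([x, x] @ Y) (Y @ [x, x])"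
proof (induction Y)
  case (Cons y Y)
  have "hurwitz_equiv ([x] @ [x, y] @ Y) ([x] @ [conj_by x y, x] @ Y)"
    using Cons by (intro hurwitz_append swapL) auto
  also have "hurwitz_equiv \<dots> ([conj_by x (conj_by x y), x] @ [x] @ Y)"
    using hurwitz_appendR[OF swapL[of x "conj_by x y"], of "x # Y"] Cons conj_refls[of y UNIV x] by simp
  also have "hurwitz_equiv \<dots> ([y] @ Y @ [x, x])"
    using Cons by (auto intro!: hurwitz_Cons)
  finally show ?case by simp
qed (auto intro: hurwitz_equiv.refl)

text \<open>The pair is brought next to the entry \<open>y\<close>, passes over it while being conjugated instead of leaving
  it unchanged, and then returns unchanged.\<close>

lemma pair_conj:
  assumes "x \<in> Refl" "set Y \<subseteq> Refl" "y \<in> set Y"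
  shows "hurwitz_equiv ([x, x] @ Y) ([conj_by y x, conj_by y x] @ Y)"
proof -
  obtain Y1 Y2 where Y: "Y = Y1 @ [y] @ Y2" using split_list[OF assms(3)] by auto
  have y: "y \<in> Refl" using assms by auto
  have c: "conj_by y x \<in> Refl" using y assms conj_refls by auto
  have "hurwitz_equiv (([x, x] @ Y1) @ [y] @ Y2) ((Y1 @ [x, x]) @ [y] @ Y2)"
    using Y assms by (intro hurwitz_appendR pair_right) auto
  also have "hurwitz_equiv \<dots> (Y1 @ (y # map (conj_by y) [x, x]) @ Y2)"
    using hurwitz_append[OF block_right[of "[x,x]" y], of Y1 Y2] y assms by auto
  also have "hurwitz_equiv \<dots> (([conj_by y x, conj_by y x] @ (Y1 @ [y])) @ Y2)"
    using hurwitz_appendR[OF hurwitz_equiv.sym[OF pair_right[OF c, of "Y1 @ [y]"]], of Y2] Y assms by auto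
  finally show ?thesis using Y by simp
qed

text \<open>Entries fixing \<open>v\<close> turn the pair around \<open>v\<close>, along the orbit of its other end.\<close>

lemma pair_reach:
  assumes "vert v \<noteq> vert p" "set Y \<subseteq> refls V" "vert v \<notin> V" "(p, q) \<in> orb Y"
  shows "hurwitz_equiv ([R v p, R v p] @ Y) ([R v q, R v q] @ Y) \<and> vert v \<noteq> vert q"
  using assms(4)
proof (induction rule: orb_induct)
  case (step z x)
  have x: "x \<in> refls V" using assms(2) step by auto
  then have x': "x \<in> Refl" by (rule refls_Refl)
  have xv: "x v = v" using x assms(3) by (rule refls_fix)
  have Y: "set Y \<subseteq> Refl" using assms(2) refls_Refl by auto
  have z: "vert v \<noteq> vert (x z)"
  proof (cases "vert z \<in> V")
    case True
    then show ?thesis using refls_into[OF x] assms(3) by metis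
  qed (use refls_fix[OF x] step.IH in simp)
  have "hurwitz_equiv ([R v z, R v z] @ Y) ([conj_by x (R v z), conj_by x (R v z)] @ Y)"
    using step Y by (intro pair_conj) (auto intro!: R_in_refls)
  moreover have "conj_by x (R v z) = R v (x z)" unfolding conj_R[OF x'] xv ..
  ultimately show ?case using step.IH z by (auto intro: hurwitz_equiv.trans)
qed (use assms in \<open>auto intro: hurwitz_equiv.refl\<close>)

lemma commuting_perm:
  assumes "set X \<subseteq> Refl" "\<And>a b. a \<in> set X \<Longrightarrow> b \<in> set X \<Longrightarrow> conj_by b a = a" "mset X = mset X'"
  shows "hurwitz_equiv X X'"
  using assms
proof (induction X' arbitrary: X)
  case (Cons x X')
  obtain X1 X2 where X: "X = X1 @ [x] @ X2" using split_list[of x X] Cons.prems(3)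
    by (metis append_Cons append_Nil list.set_intros(1) mset_eq_setD)
  have "map (conj_by x) X1 = X1" using Cons.prems(2) X by (intro map_idI) auto
  then have "hurwitz_equiv (X1 @ [x]) (x # X1)" using block_right[of X1 x] Cons X by auto
  then have 1: "hurwitz_equiv X (x # X1 @ X2)" using hurwitz_appendR[of "X1 @ [x]" "x # X1" X2] X by simp
  have "hurwitz_equiv (X1 @ X2) X'" using Cons X by (intro Cons.IH) auto
  then show ?case using hurwitz_equiv.trans[OF 1 hurwitz_Cons] by simp
qed (auto intro: hurwitz_equiv.refl)

text \<open>Move \<open>y\<close> to the front, then over all other entries, so that these get conjugated by \<open>y\<close>,
  and rotate it back to the front. The rotation conjugates \<open>y\<close> by the composite of the remaining
  entries, which does not change \<open>y\<close> when \<open>y\<close> commutes with the composite of the list.\<close>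

lemma conj_all:
  assumes "set t \<subseteq> Refl" "y \<in> set t" "composite t \<circ> y = y \<circ> composite t"
  shows "hurwitz_equiv t (map (conj_by y) t)"
proof -
  have y: "y \<in> Refl" using assms by auto
  obtain Y1 Y2 where t: "t = Y1 @ [y] @ Y2" using split_list[OF assms(2)] by auto
  let ?Z = "map (conj_by y) Y1 @ Y2"
  have Y: "set Y1 \<subseteq> Refl" "set Y2 \<subseteq> Refl" using assms t by auto
  have cc: "set (map (conj_by y) Y) \<subseteq> Refl" if "set Y \<subseteq> Refl" for Y
    using that conj_refls[of _ UNIV y] y by auto
  have Z: "set ?Z \<subseteq> Refl" using Y cc by auto
  have m: "map (conj_by y) (map (conj_by y) Y) = Y" for Y by (simp add: y comp_def)
  have 1: "hurwitz_equiv t (y # ?Z)" using hurwitz_appendR[OF block_right[of Y1 y], of Y2] Y t y by auto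
  have 2: "hurwitz_equiv (y # ?Z) (map (conj_by y) ?Z @ [y])"
    using hurwitz_equiv.sym[OF block_right[of "map (conj_by y) ?Z" y, OF cc[OF Z] y]] unfolding m .
  let ?Z' = "map (conj_by y) ?Z"
  have Z': "set ?Z' \<subseteq> Refl" using cc Z by blast
  have "composite (?Z' @ [y]) = composite t" using hurwitz_composite[OF hurwitz_equiv.trans[OF 1 2], symmetric] .
  then have p: "composite ?Z' \<circ> y = composite t" by (simp only: composite_append composite_Cons composite_Nil comp_id)
  \<comment> \<open>bringing \<open>y\<close> back to the front conjugates it by the rest, which leaves it unchanged\<close>
  have "foldr conj_by ?Z' y \<circ> composite ?Z' = y \<circ> composite ?Z'"
  proof -
    have "foldr conj_by ?Z' y \<circ> composite ?Z' = composite t" unfolding foldr_conj[OF Z'] by (rule p)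
    also have "\<dots> = y \<circ> (y \<circ> composite t)" using y by (simp add: fun_eq_iff)
    also have "\<dots> = y \<circ> composite ?Z'"
    proof
      fix z
      have "composite t (y z) = y (composite t z)" "composite ?Z' (y (y z)) = composite t (y z)"
        using fun_cong[OF assms(3), of z] fun_cong[OF p, of "y z"] by (simp_all only: o_apply)
      then show "(y \<circ> (y \<circ> composite t)) z = (y \<circ> composite ?Z') z" using y by simp
    qed
    finally show ?thesis .
  qed
  then have "foldr conj_by ?Z' y = y" unfolding bij_cancel_right[OF composite_bij[OF Z']] .
  then have 3: "hurwitz_equiv (?Z' @ [y]) (y # ?Z')" using elem_left[OF Z' y] by (simp only:)
  have "hurwitz_equiv (map (conj_by y) Y1 @ [y]) (y # map (conj_by y) (map (conj_by y) Y1))"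
    by (rule block_right[OF cc[OF Y(1)] y])
  from hurwitz_appendR[OF hurwitz_equiv.sym[OF this], of "map (conj_by y) Y2"]
  have "hurwitz_equiv (y # ?Z') (map (conj_by y) Y1 @ [y] @ map (conj_by y) Y2)" by simp
  moreover have "conj_by y y = y" by (auto simp: conj_by_def y)
  ultimately have 4: "hurwitz_equiv (y # ?Z') (map (conj_by y) t)" using t by simp
  show ?thesis by (rule hurwitz_equiv.trans[OF 1 hurwitz_equiv.trans[OF 2 hurwitz_equiv.trans[OF 3 4]]])
qed

section \<open>Separating one vertex\<close>

abbreviation moving :: "'v point \<Rightarrow> ('v point \<Rightarrow> 'v point) list \<Rightarrow> nat" where
  "moving v \<equiv> cnt (\<lambda>x. x v \<noteq> v)"

lemma fold_conj_moves:
  assumes "set Y \<subseteq> Refl" "\<forall>y\<in>set Y. y v = v" "x v \<noteq> v"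
  shows "fold conj_by Y x v \<noteq> v"
  using assms
proof (induction Y arbitrary: x)
  case (Cons y Y)
  have "conj_by y x v \<noteq> v" using Cons.prems by (metis conj_apply insertI1 list.simps(15) refl_invol subsetD)
  then show ?case using Cons by simp
qed simp

text \<open>An entry that moves \<open>v\<close> is carried to the right over entries that fix \<open>v\<close>; these stay as they
  are, and the entry still moves \<open>v\<close> afterwards.\<close>

lemma separate_moving:
  assumes "set t \<subseteq> Refl"
  shows "\<exists>Y X. hurwitz_equiv t (Y @ X) \<and> (\<forall>y\<in>set Y. y v = v) \<and> (\<forall>x\<in>set X. x v \<noteq> v) \<and> length X = moving v t"
  using assms
proof (induction t)
  case Nil
  show ?case by (intro exI[of _ "[]"]) (auto intro: hurwitz_equiv.refl)
next
  case (Cons x t)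
  then obtain Y X where YX: "hurwitz_equiv t (Y @ X)" "\<forall>y\<in>set Y. y v = v" "\<forall>x\<in>set X. x v \<noteq> v"
    "length X = moving v t" by auto
  have c: "hurwitz_equiv (x # t) (x # Y @ X)" using hurwitz_Cons[OF YX(1)] .
  show ?case
  proof (cases "x v = v")
    case True
    then show ?thesis using c YX by (intro exI[of _ "x # Y"] exI[of _ X]) auto
  next
    case False
    have Y: "set Y \<subseteq> Refl" using hurwitz_refls_iff[OF YX(1), of UNIV] Cons.prems by auto
    have "hurwitz_equiv (x # Y @ X) (Y @ fold conj_by Y x # X)"
      using hurwitz_appendR[OF elem_right[OF Y, of x], of X] Cons.prems by simp
    then have "hurwitz_equiv (x # t) (Y @ fold conj_by Y x # X)" by (rule hurwitz_equiv.trans[OF c])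
    then show ?thesis using YX False fold_conj_moves[OF Y, of v x] YX(2)
      by (intro exI[of _ Y] exI[of _ "fold conj_by Y x # X"]) auto
  qed
qed

text \<open>Conjugating one by the other gives an entry that fixes \<open>v\<close>: the edge between the two targets or, if one of the
  two is a half-edge at \<open>v\<close>, the half-edge at the other target. In the latter case it is the half-edge that has to be
  conjugated.\<close>

lemma reduce_two:
  assumes "x \<in> Refl" "x' \<in> Refl" "x v \<noteq> v" "x' v \<noteq> v" "vert (x v) \<noteq> vert (x' v)"
  shows "\<exists>y z. hurwitz_equiv [x, x'] [y, z] \<and> moving v [y, z] < 2"
proof -
  have *: "b (a (b v)) = v" if "a \<in> Refl" "b \<in> Refl" "a v \<noteq> v" "b v \<noteq> v"
    "vert (a v) \<noteq> vert (b v)" "vert (b v) \<noteq> vert v" for a b :: "'a point \<Rightarrow> 'a point"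
  proof -
    have "a (b v) = b v" using refl_eq_R[OF that(1,3)] that R_fix by metis
    then show ?thesis using that by simp
  qed
  show ?thesis
  proof (cases "vert (x v) = vert v")
    case False
    have "x (x' (x v)) = v" using *[of x' x] assms False by auto
    then show ?thesis using swapL[OF assms(1,2)]
      by (intro exI[of _ "conj_by x x'"] exI[of _ x]) (auto simp: conj_apply)
  next
    case True
    have "x' (x (x' v)) = v" using *[of x x'] assms True by auto
    then show ?thesis using swapR[OF assms(1,2)]
      by (intro exI[of _ x'] exI[of _ "conj_by x' x"]) (auto simp: conj_apply)
  qed
qed

lemma const_if_consecutive:
  assumes "\<And>X1 x x' X2. X = X1 @ [x, x'] @ X2 \<Longrightarrow> f x = f x'" "a \<in> set X" "b \<in> set X"
  shows "f a = f b"
proof -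
  have "\<forall>a\<in>set X. f a = f (hd X)"
    using assms(1)
  proof (induction X)
    case (Cons c X)
    have "\<forall>a\<in>set X. f a = f (hd X)"
    proof (rule Cons.IH)
      fix X1 x x' X2 assume "X = X1 @ [x, x'] @ X2"
      then show "f x = f x'" using Cons.prems[of "c # X1" x x' X2] by simp
    qed
    moreover have "X \<noteq> [] \<Longrightarrow> f c = f (hd X)"
      using Cons.prems[of "[]" c "hd X" "tl X"] by (cases X) auto
    ultimately show ?case by (cases X) auto
  qed simp
  then show ?thesis using assms by auto
qed

text \<open>Otherwise two consecutive entries with different targets could be reduced.\<close>

lemma minimal_same_target:
  assumes "set (Y @ X) \<subseteq> Refl" "\<forall>x\<in>set X. x v \<noteq> v"
    "\<And>s. hurwitz_equiv (Y @ X) s \<Longrightarrow> moving v (Y @ X) \<le> moving v s" "a \<in> set X" "b \<in> set X"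
  shows "vert (a v) = vert (b v)"
proof (rule const_if_consecutive[OF _ assms(4,5)])
  fix X1 x x' X2 assume X: "X = X1 @ [x, x'] @ X2"
  show "vert (x v) = vert (x' v)"
  proof (rule ccontr)
    assume "vert (x v) \<noteq> vert (x' v)"
    then obtain y z where "hurwitz_equiv [x, x'] [y, z]" "moving v [y, z] < 2"
      using reduce_two[of x x' v] assms(1,2) X by auto
    moreover from hurwitz_append[OF this(1), of "Y @ X1" X2]
    have "hurwitz_equiv (Y @ X) (Y @ X1 @ [y, z] @ X2)" using X by simp
    ultimately show False using assms(3)[of "Y @ X1 @ [y, z] @ X2"] assms(2) X
      by (auto split: if_splits)
  qed
qed

text \<open>Connectedness of the signed graph, ignoring signs.\<close>

definition connected_on :: "('v point \<Rightarrow> 'v point) list \<Rightarrow> 'v set \<Rightarrow> bool" where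
  "connected_on t V \<longleftrightarrow> (\<forall>p q. vert p \<in> V \<longrightarrow> vert q \<in> V \<longrightarrow> (p, q) \<in> orb t \<or> (p, neg q) \<in> orb t)"

lemma connD: "connected_on t V \<Longrightarrow> vert p \<in> V \<Longrightarrow> vert q \<in> V \<Longrightarrow> (p, q) \<in> orb t \<or> (p, neg q) \<in> orb t"
  by (simp add: connected_on_def)

text \<open>Contracts the edge from \<open>v\<close> to \<open>a\<close>.\<close>

definition retract :: "'v point \<Rightarrow> 'v point \<Rightarrow> 'v point \<Rightarrow> 'v point" where
  "retract v a z = (if z = v then a else if z = neg v then neg a else z)"

lemma retract_other: "vert z \<noteq> vert v \<Longrightarrow> retract v a z = z" by (auto simp: retract_def)

lemma orb_outside:
  assumes "set Y \<subseteq> refls V" "(p, q) \<in> orb Y" shows "p = q \<or> vert p \<in> V \<and> vert q \<in> V"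
  using assms(2)
proof (induction rule: orb_induct)
  case (step z x)
  have x: "x \<in> refls V" using step assms by auto
  show ?case
  proof (cases "vert z \<in> V")
    case True
    then show ?thesis using refls_into[OF x] step by auto
  next
    case False
    then show ?thesis using refls_fix[OF x] step by auto
  qed
qed simp

lemma retract_avoid:
  assumes "x \<in> refls (V - {vert v})" shows "retract v a (x z) = (if vert z = vert v then retract v a z else x z)"
proof (cases "vert z = vert v")
  case True
  then show ?thesis using refls_fix[OF assms] by simp
next
  case False
  then have "vert (x z) \<noteq> vert v" using refls_into[OF assms, of z] refls_fix[OF assms, of z]
    by (cases "vert z \<in> V") auto
  then show ?thesis using False by (simp add: retract_other)
qed

lemma retract_R: assumes "vert a \<noteq> vert v" shows "retract v a (R v a z) = retract v a z"
  using assms by (auto simp: retract_def R_def)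

lemma retract_R': assumes "vert a \<noteq> vert v"
  shows "retract v a (R v (neg a) z) = retract v a z \<or> retract v a (R v (neg a) z) = neg (retract v a z)"
  using assms by (auto simp: retract_def R_def)

text \<open>An edge from \<open>v\<close> to \<open>a\<close> at a vertex with no other neighbour does not help to connect
  points away from \<open>v\<close>: every step of a path becomes trivial or a step of \<open>Y\<close> after the contraction.\<close>

lemma collapse:
  assumes "set Y \<subseteq> refls (V - {vert v})" "set X \<subseteq> {R v a}" "vert a \<noteq> vert v" "(p, q) \<in> orb (Y @ X)"
  shows "(retract v a p, retract v a q) \<in> orb Y"
  using assms(4)
proof (induction rule: orb_induct)
  case (step z x)
  show ?case
  proof (cases "x \<in> set Y")
    case True
    then have *: "retract v a (x z) = (if vert z = vert v then retract v a z else x z)"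
      using assms(1) by (intro retract_avoid) auto
    have "vert z \<noteq> vert v \<Longrightarrow> retract v a z = z" by (simp add: retract_other)
    then show ?thesis using * step orb_step[OF True, of z] by (auto intro: orb_trans)
  next
    case False
    then have "x = R v a" using step assms by auto
    then show ?thesis using step retract_R[OF assms(3)] by simp
  qed
qed simp

text \<open>With both edges from \<open>v\<close> to \<open>a\<close> and \<open>-a\<close> a path through \<open>v\<close> may return with the
  opposite sign, so the contraction controls the path up to sign only.\<close>

lemma collapse_weak:
  assumes "set Y \<subseteq> refls (V - {vert v})" "set X \<subseteq> {R v a, R v (neg a)}" "vert a \<noteq> vert v"
    "(p, q) \<in> orb (Y @ X)"
  shows "(retract v a p, retract v a q) \<in> orb Y \<or> (retract v a p, neg (retract v a q)) \<in> orb Y"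
  using assms(4)
proof (induction rule: orb_induct)
  case (step z x)
  show ?case
  proof (cases "x \<in> set Y")
    case True
    then have x: "x \<in> refls (V - {vert v})" using assms(1) by auto
    have *: "retract v a (x z) = (if vert z = vert v then retract v a z else x z)"
      by (rule retract_avoid[OF x])
    have "vert z \<noteq> vert v \<Longrightarrow> retract v a z = z" by (simp add: retract_other)
    moreover have "(z, x z) \<in> orb Y" "(neg z, neg (x z)) \<in> orb Y"
      using orb_step[OF True, of z] orb_step[OF True, of "neg z"] refl_neg[OF refls_Refl[OF x]] by auto
    ultimately show ?thesis using * step by (auto intro: orb_trans)
  next
    case False
    then have "x = R v a \<or> x = R v (neg a)" using step assms by auto
    then show ?thesis using step retract_R[OF assms(3), of z] retract_R'[OF assms(3), of z] by auto
  qed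
qed simp

lemma two_equal:
  assumes "set X \<subseteq> {x, y}" "length X > 2"
  shows "\<exists>z X'. mset X = mset ([z, z] @ X') \<and> X' \<noteq> []"
proof -
  obtain a b c X3 where X: "X = a # b # c # X3"
    using assms(2) by (metis (no_types) Suc_less_eq length_Cons less_Suc_eq_0_disj less_zeroE list.exhaust list.size(3) numeral_2_eq_2)
  have "a = b \<or> a = c \<or> b = c" using assms(1) X by auto
  then show ?thesis
  proof (elim disjE)
    assume "a = b" then show ?thesis using X by (intro exI[of _ a] exI[of _ "c # X3"]) auto
  next
    assume "a = c" then show ?thesis using X by (intro exI[of _ a] exI[of _ "b # X3"]) auto
  next
    assume "b = c" then show ?thesis using X by (intro exI[of _ b] exI[of _ "a # X3"]) auto
  qed
qed

lemma R_neg_commute: "conj_by (R v a) (R v (neg a)) = R v (neg a)" "conj_by (R v (neg a)) (R v a) = R v a"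
  if "vert a \<noteq> vert v"
proof -
  have *: "conj_by (R v a) (R v (neg a)) = R v (neg a)" if "vert a \<noteq> vert v" for a :: "'a point"
  proof -
    have "R v a \<in> Refl" using that by (auto intro!: R_in_refls)
    then have "conj_by (R v a) (R v (neg a)) = R a (neg v)" by (simp add: conj_R)
    then show ?thesis using R_sym R_negs by (metis neg_neg)
  qed
  show "conj_by (R v a) (R v (neg a)) = R v (neg a)" "conj_by (R v (neg a)) (R v a) = R v a"
    using *[OF that] *[of "neg a"] that by auto
qed

lemma conj_self: "x \<in> Refl \<Longrightarrow> conj_by x x = x" by (auto simp: conj_by_def)

lemma edges_perm:
  assumes "set X \<subseteq> {R v a, R v (neg a)}" "vert a \<noteq> vert v" "mset X = mset X'"
  shows "hurwitz_equiv X X'"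
proof (rule commuting_perm[OF _ _ assms(3)])
  have r: "R v a \<in> Refl" "R v (neg a) \<in> Refl" using assms(2) by (auto intro!: R_in_refls)
  then show "set X \<subseteq> Refl" using assms(1) by auto
  show "conj_by y x = x" if "x \<in> set X" "y \<in> set X" for x y
    using subsetD[OF assms(1) that(1)] subsetD[OF assms(1) that(2)] R_neg_commute[OF assms(2)] r
    by (auto simp: conj_self)
qed

text \<open>In a representative with the fewest entries moving \<open>v\<close>, these all point to one vertex \<open>a\<close>. If
  there were three of them, two would be equal, and this pair could be turned to point to a third vertex.\<close>

lemma normal_form:
  assumes t: "set t \<subseteq> refls V" and v: "vert v \<in> V" and connected_on: "connected_on t V"
    and u: "u \<in> V" "u \<noteq> vert v"
  shows "\<exists>Y X a. hurwitz_equiv t (Y @ X) \<and> set Y \<subseteq> refls (V - {vert v}) \<and> X \<noteq> [] \<and>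
    set X \<subseteq> {R v a, R v (neg a)} \<and> vert a \<in> V - {vert v} \<and>
    ((\<exists>w\<in>V. w \<noteq> vert v \<and> w \<noteq> vert a) \<longrightarrow> length X \<le> 2)"
proof -
  obtain t' where t': "hurwitz_equiv t t'" "\<And>s. hurwitz_equiv t s \<Longrightarrow> moving v t' \<le> moving v s"
    using ex_has_least_nat[of "hurwitz_equiv t" t "moving v"] hurwitz_equiv.refl by blast
  have r: "set s \<subseteq> refls V" if "hurwitz_equiv t s" for s using hurwitz_refls_iff[OF that] t by blast
  have "set t' \<subseteq> Refl" using r[OF t'(1)] refls_Refl by blast
  then obtain Y X where YX: "hurwitz_equiv t' (Y @ X)" "\<forall>y\<in>set Y. y v = v" "\<forall>x\<in>set X. x v \<noteq> v"
    "length X = moving v t'" using separate_moving by blast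
  have h: "hurwitz_equiv t (Y @ X)" using t'(1) YX(1) by (rule hurwitz_equiv.trans)
  have minX: "vert (b v) = vert (c v)"
    if "hurwitz_equiv t (Y @ X')" "\<forall>x\<in>set X'. x v \<noteq> v" "length X' = length X" "b \<in> set X'" "c \<in> set X'" for X' b c
  proof (rule minimal_same_target[OF _ that(2) _ that(4,5)])
    show "set (Y @ X') \<subseteq> Refl" using r[OF that(1)] refls_Refl by blast
    fix s assume "hurwitz_equiv (Y @ X') s"
    then have "moving v t' \<le> moving v s" using t'(2) hurwitz_equiv.trans[OF that(1)] by blast
    moreover have "moving v (Y @ X') = moving v t'"
      using YX that by (simp add: filter_empty_conv filter_id_conv[THEN iffD2])
    ultimately show "moving v (Y @ X') \<le> moving v s" by simp
  qed
  have rr: "set Y \<subseteq> refls V" "set X \<subseteq> refls V" using r[OF h] by auto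
  have Y: "set Y \<subseteq> refls (V - {vert v})" using refls_remove rr YX(2) by blast
  have XR: "x = R v (x v)" if "x \<in> set X" for x
    using refl_eq_R[of x v] that rr refls_Refl YX(3) by blast
  have orb: "orb (Y @ X) = orb t" using hurwitz_orb[OF h] by simp
  \<comment> \<open>otherwise the points over the vertex of \<open>v\<close> would be closed under all entries\<close>
  have "\<exists>x\<in>set X. vert (x v) \<noteq> vert v"
  proof (rule ccontr)
    assume neg: "\<not> ?thesis"
    have "vert q = vert v" if "(v, q) \<in> orb (Y @ X)" for q
      using that
    proof (induction rule: orb_induct)
      case (step z x)
      then have z: "z = v \<or> z = neg v" by (simp add: vert_eq_iff)
      have "x \<in> Refl" using step rr refls_Refl by auto
      then have "vert (x (neg v)) = vert (x v)" by (simp add: refl_neg)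
      moreover have "vert (x v) = vert v" using step neg YX(2) by auto
      ultimately show ?case using z by auto
    qed simp
    moreover have "(v, Pt u True) \<in> orb t \<or> (v, neg (Pt u True)) \<in> orb t"
      using connected_on v u unfolding connected_on_def by auto
    ultimately show False using u orb by (metis point.sel(1) vert_neg)
  qed
  then obtain x where x: "x \<in> set X" "vert (x v) \<noteq> vert v" by auto
  define a where "a = x v"
  have XX: "set X \<subseteq> {R v a, R v (neg a)}"
  proof
    fix y assume y: "y \<in> set X"
    have "vert (y v) = vert a" unfolding a_def using minX[OF h YX(3) HOL.refl y x(1)] .
    then have "y v = a \<or> y v = neg a" by (simp add: vert_eq_iff)
    then show "y \<in> {R v a, R v (neg a)}" using XR[OF y] by auto
  qed
  have aV: "vert a \<in> V" unfolding a_def using refls_into x rr v by blast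
  have av: "vert a \<noteq> vert v" using x a_def by simp
  have "length X \<le> 2" if w: "w \<in> V" "w \<noteq> vert v" "w \<noteq> vert a" for w
  proof (rule ccontr)
    assume "\<not> length X \<le> 2"
    then obtain z X' where X': "mset X = mset ([z, z] @ X')" "X' \<noteq> []"
      using two_equal[OF XX] by auto
    have "set X = set ([z, z] @ X')" using X'(1) by (rule mset_eq_setD)
    then have z: "z \<in> set X" "set X' \<subseteq> set X" by auto
    define c where "c = z v"
    have zc: "z = R v c" unfolding c_def using XR[OF z(1)] .
    have ca: "c = a \<or> c = neg a" using z(1) XX by (auto simp: c_def)
    have Y': "set Y \<subseteq> Refl" using Y refls_Refl by blast
    have zR: "z \<in> Refl" using z rr refls_Refl by blast
    have "(c, Pt w True) \<in> orb t \<or> (c, neg (Pt w True)) \<in> orb t"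
      using connD[OF connected_on, of c "Pt w True"] ca aV w by auto
    then obtain d where d: "(c, d) \<in> orb (Y @ X)" "vert d = w" using orb by auto
    have "(retract v a c, retract v a d) \<in> orb Y \<or> (retract v a c, neg (retract v a d)) \<in> orb Y"
      by (rule collapse_weak[OF Y XX av d(1)])
    moreover have "retract v a c = c" using av ca by (intro retract_other) auto
    moreover have "retract v a d = d" using d w by (intro retract_other) auto
    ultimately obtain e where e: "(c, e) \<in> orb Y" "vert e = w" using d(2) by auto
    have "vert v \<noteq> vert c" using av ca by auto
    then have 1: "hurwitz_equiv ([R v c, R v c] @ Y) ([R v e, R v e] @ Y)"
      using pair_reach[OF _ Y _ e(1)] by auto
    have ev: "vert v \<noteq> vert e" using e w by auto
    then have eR: "R v e \<in> Refl" by (auto intro!: R_in_refls)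
    have "hurwitz_equiv (Y @ X) (Y @ [z, z] @ X')" using edges_perm[OF XX av X'(1)] by (rule hurwitz_appendL)
    also have "hurwitz_equiv \<dots> ([z, z] @ Y @ X')"
      using hurwitz_appendR[OF hurwitz_equiv.sym[OF pair_right[OF zR Y']], of X'] by simp
    also have "hurwitz_equiv \<dots> ([R v e, R v e] @ Y @ X')" using hurwitz_appendR[OF 1, of X'] zc by simp
    also have "hurwitz_equiv \<dots> (Y @ [R v e, R v e] @ X')" using hurwitz_appendR[OF pair_right[OF eR Y'], of X'] by simp
    finally have "hurwitz_equiv t (Y @ [R v e, R v e] @ X')" by (rule hurwitz_equiv.trans[OF h])
    then have "vert (R v e v) = vert (hd X' v)"
      by (rule minX) (use X' z YX(3) ev mset_eq_length[OF X'(1)] in auto)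
    moreover have "vert (hd X' v) = vert a"
      using z(2) X'(2) XX by (cases X') auto
    ultimately show False using e w by auto
  qed
  then show ?thesis using h Y XX aV av x by (intro exI[of _ Y] exI[of _ X] exI[of _ a]) auto
qed

section \<open>Few vertices\<close>

lemma pair_conj_end:
  assumes "set Z \<subseteq> Refl" "x \<in> Refl" "y \<in> set Z"
  shows "hurwitz_equiv (Z @ [x, x]) (Z @ [conj_by y x, conj_by y x])"
proof -
  have c: "conj_by y x \<in> Refl" using assms conj_refls by blast
  have "hurwitz_equiv (Z @ [x, x]) ([x, x] @ Z)" by (rule hurwitz_equiv.sym[OF pair_right[OF assms(2,1)]])
  also have "hurwitz_equiv \<dots> ([conj_by y x, conj_by y x] @ Z)" by (rule pair_conj[OF assms(2,1,3)])
  also have "hurwitz_equiv \<dots> (Z @ [conj_by y x, conj_by y x])" by (rule pair_right[OF c assms(1)])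
  finally show ?thesis .
qed

lemma sort_two:
  assumes "set X \<subseteq> {x, y}"
  shows "\<exists>p q. mset X = mset (replicate q y @ replicate p x)"
proof (cases "x = y")
  case False
  have "mset X = mset (replicate (count (mset X) y) y @ replicate (count (mset X) x) x)"
    by (rule multiset_eqI) (use assms False in auto)
  then show ?thesis by blast
next
  case True
  then have "X = replicate (length X) y" using assms by (intro replicate_eqI) auto
  then have "mset X = mset (replicate (length X) y @ replicate 0 x)" by simp
  then show ?thesis by blast
qed

lemma replicate_two: "replicate (Suc (Suc n)) x = [x, x] @ replicate n x"
  "replicate (Suc (Suc n)) x = replicate n x @ [x, x]"
  by (simp_all add: replicate_app_Cons_same)

text \<open>Otherwise one of the two words ends in \<open>y\<close> where the other one ends in \<open>x\<close>, and cancelling the common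
  beginning gives \<open>x = y\<close>.\<close>

lemma two_letter_unique:
  assumes "x \<in> Refl" "y \<in> Refl" "x \<noteq> y" "p \<le> 1" "p' \<le> 1" "q + p = q' + p'"
    "composite (replicate q y @ replicate p x) = composite (replicate q' y @ replicate p' x)"
  shows "p = p'"
proof -
  have *: False if "p = 0" "p' = 1" "q + p = q' + p'"
    "composite (replicate q y @ replicate p x) = composite (replicate q' y @ replicate p' x)" for p q p' q' :: nat
  proof -
    have "q = Suc q'" using that(1-3) by simp
    then have q: "replicate q y = replicate q' y @ [y]" by (simp add: replicate_append_same)
    have b: "bij (composite (replicate q' y))" using assms by (intro composite_bij) auto
    have "composite (replicate q' y) \<circ> y = composite (replicate q' y) \<circ> x"
      using that(4) unfolding that(1,2) q by (simp only: composite_append composite_Cons composite_Nil comp_id replicate_0 append_Nil2 One_nat_def replicate_Suc)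
    then show False unfolding bij_cancel_left[OF b] using assms(3) by simp
  qed
  consider "p = 0" "p' = 1" | "p = 1" "p' = 0" | "p = p'" using assms(4,5) by linarith
  then show ?thesis
  proof cases
    case 1
    then show ?thesis using *[OF 1 assms(6,7)] by blast
  next
    case 2
    then show ?thesis using *[OF 2(2,1) assms(6,7)[symmetric]] by blast
  qed
qed

lemma refls_two:
  assumes "x \<in> refls {vert a, vert b}" "\<not> half x" shows "x = R a b \<or> x = R a (neg b)"
proof -
  obtain p q where x: "x = R p q" "p \<noteq> q" "vert p \<in> {vert a, vert b}" "vert q \<in> {vert a, vert b}"
    using assms by (auto simp: refls_def)
  have "vert p \<noteq> vert q" using x(2) half_R[of p q] assms(2) x(1) vert_eq_iff[of q p] by auto
  then have "(p = a \<or> p = neg a) \<and> (q = b \<or> q = neg b) \<or> (q = a \<or> q = neg a) \<and> (p = b \<or> p = neg b)"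
    using x by (auto simp flip: vert_eq_iff)
  moreover have "R (neg a) b = R a (neg b)" using R_negs[of a "neg b"] by simp
  ultimately show ?thesis unfolding x(1) by (auto simp: R_sym[of _ a] R_sym[of _ "neg a"] R_negs)
qed

lemma refls_one: assumes "x \<in> refls {vert a}" shows "x = R a (neg a)"
proof -
  obtain p q where x: "x = R p q" "p \<noteq> q" "vert p = vert a" "vert q = vert a"
    using assms by (auto simp: refls_def)
  then have "(p = a \<and> q = neg a) \<or> (p = neg a \<and> q = a)" by (auto simp: vert_eq_iff)
  then show ?thesis unfolding x(1) using R_sym[of a "neg a"] by auto
qed

lemma edge_used:
  assumes "set Y \<subseteq> {R a b, R a (neg b)}" "vert a \<noteq> vert b" "(a, b) \<in> orb Y"
  shows "R a b \<in> set Y"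
proof (rule ccontr)
  assume "R a b \<notin> set Y"
  then have Y: "set Y \<subseteq> {R a (neg b)}" using assms(1) by auto
  have "b = a \<or> b = neg b" using assms(3)
  proof (induction rule: orb_induct[where Q="\<lambda>z. z = a \<or> z = neg b"])
    case (step z x)
    then show ?case using Y by auto
  qed (use assms in auto)
  then show False using assms(2) by auto
qed

text \<open>The reflections \<open>R a b\<close> and \<open>R a (neg b)\<close> generate type \<open>D\<^sub>2\<close>; an edge to a third vertex \<open>v\<close>
  joins them to type \<open>D\<^sub>3\<close>, where they are conjugate. As long as at least three copies of the first are
  present, a pair of them can be conjugated into a pair of the second, because the remaining entries
  still contain all three reflections. One copy is kept apart, so \<open>p \<le> 1\<close> counts the others.\<close>

lemma D2_normalise:
  assumes X: "set X \<subseteq> Refl" "R v a \<in> set X" and d: "vert a \<noteq> vert v" "vert b \<noteq> vert v" "vert a \<noteq> vert b"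
  defines "x \<equiv> R a b" and "y \<equiv> R a (neg b)"
  shows "n \<ge> 1 \<Longrightarrow> q \<ge> 1 \<Longrightarrow> \<exists>p q'. p \<le> 1 \<and>
    hurwitz_equiv (replicate q y @ replicate n x @ X) (replicate q' y @ replicate p x @ [x] @ X)"
proof (induction n arbitrary: q rule: less_induct)
  case (less n)
  have R: "x \<in> Refl" "y \<in> Refl" "R v a \<in> Refl" "R v b \<in> Refl" "R v (neg b) \<in> Refl" "R v (neg a) \<in> Refl"
    using d by (auto simp: x_def y_def intro!: R_in_refls)
  show ?case
  proof (cases "n \<le> 2")
    case True
    have "replicate n x = replicate (n - 1) x @ [x]" using less(2) by (cases n) (auto simp: replicate_append_same)
    then show ?thesis using True by (intro exI[of _ "n - 1"] exI[of _ q]) (auto intro: hurwitz_equiv.refl)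
  next
    case False
    define k where "k = n - 2"
    have k: "n = Suc (Suc k)" "k \<ge> 1" using False k_def by auto
    let ?Z = "replicate q y @ replicate k x @ X"
    have Z: "set ?Z \<subseteq> Refl" "R v a \<in> set ?Z" "x \<in> set ?Z" "y \<in> set ?Z"
      using X R less(3) k by auto
    have fx: "R v a b = b" "x v = v" "y v = v" "R v a (neg b) = neg b"
      using d by (auto simp: x_def y_def intro!: R_fix)
    \<comment> \<open>the pair at \<open>a, b\<close> travels over \<open>v, b\<close> and \<open>v, a\<close> to \<open>v, neg b\<close> and then to \<open>a, neg b\<close>\<close>
    have 1: "conj_by (R v a) x = R v b" using conj_R[OF R(3), of a b] fx by (simp add: x_def)
    have 2: "conj_by x (R v b) = R v a" using conj_R[OF R(1), of v b] fx by (simp add: x_def)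
    have 3: "conj_by y (R v a) = R v (neg b)" using conj_R[OF R(2), of v a] fx by (simp add: y_def)
    have 4: "conj_by (R v a) (R v (neg b)) = y" using conj_R[OF R(3), of v "neg b"] fx by (simp add: y_def)
    have A: "hurwitz_equiv ([x, x] @ replicate q y) (replicate q y @ [x, x])"
      using R by (intro pair_right) auto
    have "replicate q y @ replicate n x @ X = (replicate q y @ [x, x]) @ replicate k x @ X"
      by (simp add: k(1))
    also have "hurwitz_equiv \<dots> (([x, x] @ replicate q y) @ replicate k x @ X)"
      by (rule hurwitz_appendR[OF hurwitz_equiv.sym[OF A]])
    also have "([x, x] @ replicate q y) @ replicate k x @ X = [x, x] @ ?Z" by simp
    also have "hurwitz_equiv \<dots> ([R v b, R v b] @ ?Z)" using pair_conj[OF R(1) Z(1,2)] unfolding 1 .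
    also have "hurwitz_equiv \<dots> ([R v a, R v a] @ ?Z)" using pair_conj[OF R(4) Z(1,3)] unfolding 2 .
    also have "hurwitz_equiv \<dots> ([R v (neg b), R v (neg b)] @ ?Z)" using pair_conj[OF R(3) Z(1,4)] unfolding 3 .
    also have "hurwitz_equiv \<dots> ([y, y] @ ?Z)" using pair_conj[OF R(5) Z(1,2)] unfolding 4 .
    also have "[y, y] @ ?Z = replicate (Suc (Suc q)) y @ replicate k x @ X" by simp
    finally have B: "hurwitz_equiv (replicate q y @ replicate n x @ X) (replicate (Suc (Suc q)) y @ replicate k x @ X)" .
    obtain p q' where "p \<le> 1" "hurwitz_equiv (replicate (Suc (Suc q)) y @ replicate k x @ X) (replicate q' y @ replicate p x @ [x] @ X)"
      using less.IH[of k "Suc (Suc q)"] k by auto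
    then show ?thesis using hurwitz_equiv.trans[OF B] by blast
  qed
qed

text \<open>The orbit relation tells which of the two edges occur. If both do, the normal form of
  \<open>D2_normalise\<close> is determined by the length and the composite.\<close>

lemma D2_unique:
  assumes X: "set X \<subseteq> Refl" "R v a \<in> set X" and d: "vert a \<noteq> vert v" "vert b \<noteq> vert v" "vert a \<noteq> vert b"
    and Y: "set Y \<subseteq> {R a b, R a (neg b)}" "set Y' \<subseteq> {R a b, R a (neg b)}"
    and eq: "length Y = length Y'" "composite Y = composite Y'" "orb Y = orb Y'"
  shows "hurwitz_equiv (Y @ X) (Y' @ X)"
proof -
  let ?x = "R a b" and ?y = "R a (neg b)"
  have R: "?x \<in> Refl" "?y \<in> Refl" using d by (auto intro!: R_in_refls)
  have xy: "?x \<noteq> ?y" by (metis R_left neg_neq(1))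
  have same: "?x \<in> set Y \<longleftrightarrow> ?x \<in> set Y'" "?y \<in> set Y \<longleftrightarrow> ?y \<in> set Y'"
  proof -
    have *: "R a c \<in> set Y1 \<Longrightarrow> set Y2 \<subseteq> {R a c, R a (neg c)} \<Longrightarrow> vert a \<noteq> vert c \<Longrightarrow> orb Y1 = orb Y2 \<Longrightarrow> R a c \<in> set Y2"
      for c Y1 Y2 using edge_used orb_step R_left by metis
    show "?x \<in> set Y \<longleftrightarrow> ?x \<in> set Y'" using *[of b Y Y'] *[of b Y' Y] Y d eq by auto
    have "set Y \<subseteq> {R a (neg b), R a (neg (neg b))}" "set Y' \<subseteq> {R a (neg b), R a (neg (neg b))}"
      using Y by auto
    then show "?y \<in> set Y \<longleftrightarrow> ?y \<in> set Y'" using *[of "neg b" Y Y'] *[of "neg b" Y' Y] d eq by auto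
  qed
  show ?thesis
  proof (cases "?x \<in> set Y \<and> ?y \<in> set Y")
    case False
    then obtain c where "set Y \<subseteq> {c}" "set Y' \<subseteq> {c}" using Y same by blast
    then have "Y = replicate (length Y) c" "Y' = replicate (length Y) c"
      using eq(1) by (auto intro!: replicate_eqI)
    then have "Y = Y'" by simp
    then show ?thesis by (simp add: hurwitz_equiv.refl)
  next
    case True
    have nf: "\<exists>p q. p \<le> 1 \<and> hurwitz_equiv (Y @ X) (replicate q ?y @ replicate p ?x @ [?x] @ X)"
      if Y: "set Y \<subseteq> {R a b, R a (neg b)}" "?x \<in> set Y" "?y \<in> set Y" for Y
    proof -
      obtain n q where nq: "mset Y = mset (replicate q ?y @ replicate n ?x)"
        using sort_two[OF Y(1)] by auto
      then have "set Y = set (replicate q ?y @ replicate n ?x)" by (rule mset_eq_setD)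
      then have pos: "n \<ge> 1" "q \<ge> 1" using Y(2,3) xy by (auto split: if_splits simp: not_less_eq_eq)
      have "hurwitz_equiv Y (replicate q ?y @ replicate n ?x)" using edges_perm[OF Y(1) _ nq] d
        by auto
      then have 1: "hurwitz_equiv (Y @ X) (replicate q ?y @ replicate n ?x @ X)"
        using hurwitz_appendR by fastforce
      show ?thesis using D2_normalise[OF X d pos] hurwitz_equiv.trans[OF 1] by blast
    qed
    obtain p q where pq: "p \<le> 1" "hurwitz_equiv (Y @ X) (replicate q ?y @ replicate p ?x @ [?x] @ X)"
      using nf Y True by blast
    obtain p' q' where pq': "p' \<le> 1" "hurwitz_equiv (Y' @ X) (replicate q' ?y @ replicate p' ?x @ [?x] @ X)"
      using nf[of Y'] Y True same by blast
    have b: "bij (composite ([?x] @ X))" using R X by (intro composite_bij) auto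
    have l: "q + p = q' + p'" using hurwitz_length[OF pq(2)] hurwitz_length[OF pq'(2)] eq(1) by simp
    have "composite (Y @ X) = composite (Y' @ X)" using eq by simp
    then have "composite (replicate q ?y @ replicate p ?x @ [?x] @ X) = composite (replicate q' ?y @ replicate p' ?x @ [?x] @ X)"
      using hurwitz_composite[OF pq(2)] hurwitz_composite[OF pq'(2)] by (simp only:)
    then have "composite (replicate q ?y @ replicate p ?x) \<circ> composite ([?x] @ X) = composite (replicate q' ?y @ replicate p' ?x) \<circ> composite ([?x] @ X)"
      by (simp only: composite_append comp_assoc)
    then have "composite (replicate q ?y @ replicate p ?x) = composite (replicate q' ?y @ replicate p' ?x)"
      unfolding bij_cancel_right[OF b] .
    then have "p = p'" by (rule two_letter_unique[OF R xy pq(1) pq'(1) l])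
    then have "q = q'" using l by simp
    then show ?thesis using hurwitz_equiv.trans[OF pq(2) hurwitz_equiv.sym] pq'(2) \<open>p = p'\<close> by simp
  qed
qed

text \<open>After separating \<open>v\<close>, the half-edges all sit at \<open>a\<close>, and conjugation by them
  turns pairs of edges from \<open>v\<close> to \<open>a\<close> into pairs of edges from \<open>v\<close> to \<open>-a\<close>.\<close>

lemma two_vertices_half_edge:
  assumes V: "V = {vert v, vert a}" "vert v \<noteq> vert a"
    and t: "set t \<subseteq> refls V" "set r \<subseteq> refls V"
    and c: "connected_on t V" "connected_on r V" and eq: "composite t = composite r" "length t = length r" "cnt half t = cnt half r"
    and half: "cnt half t > 0"
  shows "hurwitz_equiv t r"
proof -
  let ?h = "R a (neg a)" and ?x = "R v a" and ?y = "R v (neg a)"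
  have R: "?x \<in> Refl" "?y \<in> Refl" "?h \<in> Refl" using V by (auto intro!: R_in_refls)
  have xy: "?x \<noteq> ?y" by (metis R_left neg_neq(1))
  have hx: "conj_by ?h ?x = ?y"
    using conj_R[OF R(3), of v a] V(2) R_fix[of v a "neg a"] by simp
  let ?k = "cnt half t"
  have nf: "\<exists>p q. p \<le> 1 \<and> hurwitz_equiv t (replicate ?k ?h @ replicate q ?y @ replicate p ?x)"
    if t: "set t \<subseteq> refls V" "connected_on t V" "cnt half t = ?k" for t
  proof -
    have "vert v \<in> V" "vert a \<in> V" "vert a \<noteq> vert v" using V by auto
    from normal_form[OF t(1) this(1) t(2) this(2,3)]
    obtain Y X b where b: "hurwitz_equiv t (Y @ X)" "set Y \<subseteq> refls (V - {vert v})"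
      "set X \<subseteq> {R v b, R v (neg b)}" "vert b \<in> V - {vert v}" by blast
    have Vv: "V - {vert v} = {vert a}" using V by auto
    then have "b = a \<or> b = neg a" using b(4) by (simp add: vert_eq_iff)
    then have X: "set X \<subseteq> {?x, ?y}" using b(3) by auto
    have yh: "y = ?h" if "y \<in> set Y" for y using refls_one b(2) that unfolding Vv by blast
    from yh have Yh: "Y = replicate (length Y) ?h" by (intro replicate_eqI) auto
    have "cnt half (Y @ X) = ?k" using hurwitz_half[OF b(1)] t(3) by simp
    moreover have "filter half X = []"
    proof -
      have "v \<noteq> a" "v \<noteq> neg a" "a \<noteq> neg v" using V(2) by auto
      then have "\<not> half ?x" "\<not> half ?y" by (simp_all add: half_R)
      then show ?thesis using X by (auto simp: filter_empty_conv)
    qed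
    moreover have "filter half Y = Y"
    proof (intro filter_True ballI)
      fix y assume "y \<in> set Y"
      then have "y = ?h" using yh by blast
      then show "half y" unfolding half_def by (intro exI[of _ a]) simp
    qed
    ultimately have "length Y = ?k" by simp
    then have Y: "Y = replicate ?k ?h" using Yh by metis
    obtain n q where "mset X = mset (replicate q ?y @ replicate n ?x)" using sort_two[OF X] by auto
    then have "hurwitz_equiv X (replicate q ?y @ replicate n ?x)" using edges_perm[OF X] V by auto
    then have 1: "hurwitz_equiv t (replicate ?k ?h @ replicate q ?y @ replicate n ?x)"
      using hurwitz_equiv.trans[OF b(1) hurwitz_appendL] Y by simp
    have "\<exists>p q'. p \<le> 1 \<and> hurwitz_equiv (replicate ?k ?h @ replicate q ?y @ replicate n ?x)
        (replicate ?k ?h @ replicate q' ?y @ replicate p ?x)" for n q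
    proof (induction n arbitrary: q rule: less_induct)
      case (less n)
      show ?case
      proof (cases "n \<le> 1")
        case False
        define m where "m = n - 2"
        have m: "n = Suc (Suc m)" using False m_def by auto
        let ?Z = "replicate ?k ?h @ replicate q ?y @ replicate m ?x"
        have Z: "set ?Z \<subseteq> Refl" "?h \<in> set ?Z" using R half by auto
        have "hurwitz_equiv (?Z @ [?x, ?x]) (?Z @ [?y, ?y])" using pair_conj_end[OF Z(1) R(1) Z(2)] hx by simp
        moreover have "?Z @ [?x, ?x] = replicate ?k ?h @ replicate q ?y @ replicate n ?x"
          unfolding m replicate_two(2) by simp
        moreover have "hurwitz_equiv (?Z @ [?y, ?y]) (replicate ?k ?h @ replicate (Suc (Suc q)) ?y @ replicate m ?x)"
          unfolding append_assoc using V
          by (intro hurwitz_appendL edges_perm[of _ v a]) auto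
        ultimately have *: "hurwitz_equiv (replicate ?k ?h @ replicate q ?y @ replicate n ?x)
            (replicate ?k ?h @ replicate (Suc (Suc q)) ?y @ replicate m ?x)"
          using hurwitz_equiv.trans by simp
        show ?thesis using less.IH[of m "Suc (Suc q)"] m hurwitz_equiv.trans[OF *] by auto
      qed (auto intro: hurwitz_equiv.refl)
    qed
    then show ?thesis using hurwitz_equiv.trans[OF 1] by blast
  qed
  obtain p q where pq: "p \<le> 1" "hurwitz_equiv t (replicate ?k ?h @ replicate q ?y @ replicate p ?x)"
    using nf[OF t(1) c(1)] by auto
  obtain p' q' where pq': "p' \<le> 1" "hurwitz_equiv r (replicate ?k ?h @ replicate q' ?y @ replicate p' ?x)"
    using nf[OF t(2) c(2)] eq by auto
  have l: "q + p = q' + p'" using hurwitz_length[OF pq(2)] hurwitz_length[OF pq'(2)] eq(2) by simp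
  have "composite (replicate ?k ?h @ replicate q ?y @ replicate p ?x) = composite (replicate ?k ?h @ replicate q' ?y @ replicate p' ?x)"
    using hurwitz_composite[OF pq(2)] hurwitz_composite[OF pq'(2)] eq(1) by (simp only:)
  then have "composite (replicate ?k ?h) \<circ> composite (replicate q ?y @ replicate p ?x) = composite (replicate ?k ?h) \<circ> composite (replicate q' ?y @ replicate p' ?x)"
    by (simp only: composite_append)
  moreover have "bij (composite (replicate ?k ?h))" using R by (intro composite_bij) auto
  ultimately have "composite (replicate q ?y @ replicate p ?x) = composite (replicate q' ?y @ replicate p' ?x)"
    using bij_cancel_left by blast
  then have "p = p'" by (rule two_letter_unique[OF R(1,2) xy pq(1) pq'(1) l])
  then have "q = q'" using l by simp
  then show ?thesis using hurwitz_equiv.trans[OF pq(2) hurwitz_equiv.sym] pq'(2) \<open>p = p'\<close> by simp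
qed

text \<open>Iterating \<open>conj_all\<close> along \<open>ws @ [y]\<close> uses the entry \<open>foldr conj_by ws y\<close> of the list
  that has already been conjugated by \<open>ws\<close>; this is why the word grows at its right end.\<close>

lemma conj_word:
  assumes "set t \<subseteq> Refl" "set ws \<subseteq> set t" "\<And>y. y \<in> set t \<Longrightarrow> composite t \<circ> y = y \<circ> composite t"
  shows "hurwitz_equiv t (map (foldr conj_by ws) t)"
  using assms(2)
proof (induction ws rule: rev_induct)
  case Nil
  then show ?case by (simp add: hurwitz_equiv.refl)
next
  case (snoc y ws)
  let ?c = "foldr conj_by ws" and ?t = "map (foldr conj_by ws) t"
  have IH: "hurwitz_equiv t ?t" using snoc by auto
  have y: "y \<in> set t" "y \<in> Refl" using snoc assms(1) by auto
  have ws: "set ws \<subseteq> Refl" using snoc assms(1) by auto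
  have t': "set ?t \<subseteq> Refl" using hurwitz_refls_iff[OF IH, of UNIV] assms(1) by blast
  have dist: "foldr conj_by ws (conj_by y x) = conj_by (foldr conj_by ws y) (foldr conj_by ws x)" if "x \<in> Refl" for x
    using ws
  proof (induction ws)
    case (Cons w ws)
    have "w (w z) = z" for z using Cons.prems by auto
    then have "conj_by w (conj_by p q) = conj_by (conj_by w p) (conj_by w q)" for p q by (simp add: conj_by_def fun_eq_iff)
    then show ?case using Cons by simp
  qed simp
  have m: "map (foldr conj_by (ws @ [y])) t = map (conj_by (?c y)) ?t"
    using dist assms(1) by (auto simp: subset_iff)
  have "composite t \<circ> ?c y = ?c y \<circ> composite t"
    using snoc(2)
  proof (induction ws)
    case Nil
    then show ?case using assms(3)[OF y(1)] by simp
  next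
    case (Cons w ws)
    have 1: "composite t (w z) = w (composite t z)" for z using fun_cong[OF assms(3)[of w], of z] Cons.prems by simp
    have 2: "composite t (foldr conj_by ws y z) = foldr conj_by ws y (composite t z)" for z
      using fun_cong[OF Cons.IH, of z] Cons.prems by simp
    show ?case using 1 2 by (auto simp: fun_eq_iff conj_apply[of w "foldr conj_by ws y"])
  qed
  then have comm: "composite ?t \<circ> ?c y = ?c y \<circ> composite ?t" using hurwitz_composite[OF IH] by (simp only:)
  have "hurwitz_equiv ?t (map (conj_by (?c y)) ?t)" using conj_all[OF t' _ comm] y by auto
  then show ?case unfolding m by (rule hurwitz_equiv.trans[OF IH])
qed

lemma foldr_conj_R:
  assumes "set ws \<subseteq> Refl" shows "foldr conj_by ws (R p q) = R (composite ws p) (composite ws q)"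
  using assms by (induction ws) (auto simp: conj_R)

lemma orb_word:
  assumes "(p, q) \<in> orb Y" shows "\<exists>ws. set ws \<subseteq> set Y \<and> q = composite ws p"
  using assms
proof (induction rule: orb_induct)
  case base
  show ?case by (intro exI[of _ "[]"]) auto
next
  case (step z x)
  then obtain ws where "set ws \<subseteq> set Y" "z = composite ws p" by auto
  then show ?case using step by (intro exI[of _ "x # ws"]) auto
qed

section \<open>Connected lists of reflections\<close>

lemma split_at_vertex:
  assumes t: "set t \<subseteq> refls V" "connected_on t V" and v: "vert v \<in> V" and fin: "finite V" and card: "card V \<ge> 3"
  shows "\<exists>Y X a. hurwitz_equiv t (Y @ X) \<and> set Y \<subseteq> refls (V - {vert v}) \<and> vert a \<in> V - {vert v} \<and>
    (X = [R v a] \<or> X = [R v a, R v a] \<or> X = [R v a, R v (neg a)])"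
proof -
  have "\<not> V \<subseteq> {vert v}" using card card_mono[of "{vert v}" V] by auto
  then obtain u where u: "u \<in> V" "u \<noteq> vert v" by auto
  obtain Y X a where YX: "hurwitz_equiv t (Y @ X)" "set Y \<subseteq> refls (V - {vert v})" "X \<noteq> []"
    "set X \<subseteq> {R v a, R v (neg a)}" "vert a \<in> V - {vert v}"
    "(\<exists>w\<in>V. w \<noteq> vert v \<and> w \<noteq> vert a) \<longrightarrow> length X \<le> 2"
    using normal_form[OF t(1) v t(2) u] by blast
  have "\<not> V \<subseteq> {vert v, vert a}"
  proof
    assume "V \<subseteq> {vert v, vert a}"
    then have "card V \<le> card {vert v, vert a}" by (intro card_mono) auto
    also have "\<dots> \<le> 2" by (simp add: card_insert_if)
    finally show False using card by simp
  qed
  then have l: "length X \<le> 2" using YX(6) by auto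
  have "\<exists>b. (b = a \<or> b = neg a) \<and> (X = [R v b] \<or> X = [R v b, R v b] \<or> X = [R v b, R v (neg b)])"
  proof -
    obtain x X' where x: "X = x # X'" using YX(3) by (cases X) auto
    obtain b where b: "b = a \<or> b = neg a" "x = R v b" using YX(4) x by auto
    have ab: "{R v a, R v (neg a)} = {R v b, R v (neg b)}" using b(1) by auto
    show ?thesis
    proof (cases X')
      case Nil
      then show ?thesis using x b by auto
    next
      case (Cons x' X'')
      then have "X = [R v b, x']" using x b l by (cases X'') auto
      moreover have "x' \<in> {R v b, R v (neg b)}" using YX(4) x Cons ab by auto
      ultimately show ?thesis using b by blast
    qed
  qed
  then obtain b where "b = a \<or> b = neg a" "X = [R v b] \<or> X = [R v b, R v b] \<or> X = [R v b, R v (neg b)]"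
    by blast
  moreover from this(1) have "vert b \<in> V - {vert v}" using YX(5) by auto
  ultimately show ?thesis using YX(1,2) by blast
qed

lemma composite_fix: assumes "\<And>x. x \<in> set t \<Longrightarrow> x z = z" shows "composite t z = z"
  using assms by (induction t) auto

lemma composite_neg: "set t \<subseteq> Refl \<Longrightarrow> composite t (neg z) = neg (composite t z)"
  by (induction t) (auto simp: refl_neg)

text \<open>The orbit relation of a group that acts transitively on the signed points over \<open>V\<close>.\<close>

definition full :: "'v set \<Rightarrow> ('v point \<times> 'v point) set" where
  "full V = Id \<union> {(p, q). vert p \<in> V \<and> vert q \<in> V}"

lemma orb_full:
  assumes "set Y \<subseteq> refls V" "connected_on Y V" "vert b \<in> V" "(b, neg b) \<in> orb Y"
  shows "orb Y = full V"
proof -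
  have Y: "set Y \<subseteq> Refl" using assms refls_Refl by blast
  have b: "(p, b) \<in> orb Y" if "vert p \<in> V" for p
  proof -
    have "(p, b) \<in> orb Y \<or> (p, neg b) \<in> orb Y" using connD[OF assms(2) that assms(3)] .
    moreover have "(neg b, b) \<in> orb Y" using orb_sym[OF Y assms(4)] .
    ultimately show ?thesis using orb_trans by metis
  qed
  have "(p, q) \<in> orb Y" if "vert p \<in> V" "vert q \<in> V" for p q
    using orb_trans[OF b[OF that(1)] orb_sym[OF Y b[OF that(2)]]] .
  then show ?thesis using orb_outside[OF assms(1)] by (auto simp: full_def)
qed

lemma conn_rest:
  assumes "set Y \<subseteq> refls (V - {vert v})" "set X \<subseteq> {R v a, R v (neg a)}" "vert a \<in> V - {vert v}"
    "connected_on (Y @ X) V"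
  shows "connected_on Y (V - {vert v})"
  unfolding connected_on_def
proof (intro allI impI)
  fix p q assume pq: "vert p \<in> V - {vert v}" "vert q \<in> V - {vert v}"
  have av: "vert a \<noteq> vert v" using assms(3) by auto
  have c: "retract v a p = p" "retract v a q = q" "retract v a (neg q) = neg q"
    using pq by (auto intro!: retract_other)
  have "(p, q) \<in> orb (Y @ X) \<or> (p, neg q) \<in> orb (Y @ X)"
    using connD[OF assms(4)] pq by auto
  then show "(p, q) \<in> orb Y \<or> (p, neg q) \<in> orb Y"
    using collapse_weak[OF assms(1,2) av, of p q] collapse_weak[OF assms(1,2) av, of p "neg q"] c by auto
qed

text \<open>Removing a leaf \<open>v\<close> does not lose information on the orbits of the other points.\<close>

lemma orb_rest:
  assumes "set Y \<subseteq> refls (V - {vert v})" "set X \<subseteq> {R v a}" "vert a \<noteq> vert v"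
    and "set Y' \<subseteq> refls (V - {vert v})" "set X' \<subseteq> {R v a'}" "vert a' \<noteq> vert v"
    and "orb (Y @ X) = orb (Y' @ X')"
  shows "orb Y = orb Y'"
proof -
  have *: "orb Y \<subseteq> orb Y'" if "set Y \<subseteq> refls (V - {vert v})"
    "set Y' \<subseteq> refls (V - {vert v})" "set X' \<subseteq> {R v a'}" "vert a' \<noteq> vert v"
    "orb (Y @ X) = orb (Y' @ X')" for Y X Y' X' :: "('a point \<Rightarrow> 'a point) list" and a'
  proof clarify
    fix p q assume pq: "(p, q) \<in> orb Y"
    show "(p, q) \<in> orb Y'"
    proof (cases "p = q")
      case False
      then have "vert p \<noteq> vert v" "vert q \<noteq> vert v" using orb_outside[OF that(1) pq] by auto
      then have c: "retract v a' p = p" "retract v a' q = q" by (simp_all add: retract_other)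
      have "(p, q) \<in> orb (Y' @ X')" using pq orb_mono[of Y "Y @ X"] that(5) by auto
      then show ?thesis using collapse[OF that(2-4)] c by metis
    qed simp
  qed
  show ?thesis using *[of Y Y' X' a' X] *[of Y' Y X a X'] assms by auto
qed

text \<open>The statement of the induction. The last condition concerns type \<open>D\<^sub>2\<close>, whose two
  reflections are not distinguished by the other invariants.\<close>

definition determined :: "'v set \<Rightarrow> bool" where
  "determined V \<longleftrightarrow> (\<forall>t r. set t \<subseteq> refls V \<longrightarrow> set r \<subseteq> refls V \<longrightarrow> connected_on t V \<longrightarrow> orb t = orb r \<longrightarrow>
     composite t = composite r \<longrightarrow> length t = length r \<longrightarrow> cnt half t = cnt half r \<longrightarrow>
     (card V = 2 \<longrightarrow> cnt half t = 0 \<longrightarrow> mset t = mset r) \<longrightarrow> hurwitz_equiv t r)"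

lemma determinedD:
  assumes "determined V" "set t \<subseteq> refls V" "set r \<subseteq> refls V" "connected_on t V" "orb t = orb r"
    "composite t = composite r" "length t = length r" "cnt half t = cnt half r"
    "card V = 2 \<Longrightarrow> cnt half t = 0 \<Longrightarrow> mset t = mset r"
  shows "hurwitz_equiv t r"
  using assms(1)[unfolded determined_def, rule_format, OF assms(2-8)] assms(9) by blast

text \<open>The two lists agree at \<open>v\<close>, so the rest is compared by induction, unless the rest lies in
  type \<open>D\<^sub>2\<close>, where the edge at \<open>v\<close> is needed.\<close>

lemma determined_from_rest:
  fixes V :: "'v set"
  assumes IH: "determined (V - {vert v})"
    and V: "finite V" "vert v \<in> V"
    and Y: "set Y \<subseteq> refls (V - {vert v})" "set Y' \<subseteq> refls (V - {vert v})"
    and X: "set X \<subseteq> Refl" "R v a \<in> set X" and a: "vert a \<in> V - {vert v}"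
    and c: "connected_on Y (V - {vert v})" "orb Y = orb Y'"
    and h: "hurwitz_equiv t (Y @ X)" "hurwitz_equiv r (Y' @ X)"
    and eq: "composite t = composite r" "length t = length r" "cnt half t = cnt half r"
  shows "hurwitz_equiv t r"
proof -
  let ?V = "V - {vert v}"
  have l: "length Y = length Y'" using eq(2) hurwitz_length[OF h(1)] hurwitz_length[OF h(2)] by simp
  have hf: "cnt half Y = cnt half Y'" using eq(3) hurwitz_half[OF h(1)] hurwitz_half[OF h(2)] by simp
  have "composite Y \<circ> composite X = composite Y' \<circ> composite X" using eq(1) hurwitz_composite[OF h(1)] hurwitz_composite[OF h(2)] by simp
  then have p: "composite Y = composite Y'" using bij_cancel_right[OF composite_bij[OF X(1)]] by blast
  have "hurwitz_equiv (Y @ X) (Y' @ X)"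
  proof (cases "card ?V = 2 \<and> cnt half Y = 0")
    case False
    have "hurwitz_equiv Y Y'"
      by (rule determinedD[OF IH Y c p l hf]) (use False in auto)
    then show ?thesis by (rule hurwitz_appendR)
  next
    case True
    have "card (?V - {vert a}) = 1" using True a V by (simp add: card_Diff_singleton)
    then obtain w where w: "?V - {vert a} = {w}" using card_1_singletonE by blast
    let ?b = "Pt w True"
    have Vw: "?V = {vert a, vert ?b}" using w a by auto
    have d: "vert a \<noteq> vert v" "vert ?b \<noteq> vert v" "vert a \<noteq> vert ?b" using a w by auto
    have "set Y \<subseteq> {R a ?b, R a (neg ?b)}"
    proof
      fix x assume "x \<in> set Y"
      then have "x \<in> refls {vert a, vert ?b}" "\<not> half x" using Y True Vw by (auto simp: filter_empty_conv)
      from refls_two[OF this] show "x \<in> {R a ?b, R a (neg ?b)}" by auto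
    qed
    moreover have "set Y' \<subseteq> {R a ?b, R a (neg ?b)}"
    proof
      fix x assume "x \<in> set Y'"
      then have "x \<in> refls {vert a, vert ?b}" "\<not> half x" using Y True Vw hf by (auto simp: filter_empty_conv)
      from refls_two[OF this] show "x \<in> {R a ?b, R a (neg ?b)}" by auto
    qed
    ultimately show ?thesis using D2_unique[OF X d _ _ l p c(2)] by blast
  qed
  then show ?thesis using hurwitz_equiv.trans[OF h(1)] hurwitz_equiv.sym[OF h(2)] hurwitz_equiv.trans by blast
qed

text \<open>The composite \<open>g\<close> decides which of the three shapes occurs at \<open>v\<close>. In the shape with
  \<open>g v = neg v\<close> the choice of \<open>v\<close> makes \<open>g\<close> the map \<open>-1\<close>; at least three vertices leave a vertex away
  from \<open>v\<close> and \<open>a\<close> that the remaining entries reverse.\<close>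

lemma determined_step:
  fixes V :: "'v set"
  assumes IH: "\<And>u. u \<in> V \<Longrightarrow> determined (V - {u})"
    and V: "finite V" "card V \<ge> 3"
    and t: "set t \<subseteq> refls V" "set r \<subseteq> refls V" "connected_on t V" "orb t = orb r"
    and eq: "composite t = composite r" "length t = length r" "cnt half t = cnt half r"
  shows "hurwitz_equiv t r"
proof -
  have cr: "connected_on r V" using t(3,4) by (simp add: connected_on_def)
  \<comment> \<open>the shape with both edges at \<open>v\<close> then occurs for \<open>-1\<close> only\<close>
  obtain v where v: "vert v \<in> V" "composite t v \<noteq> neg v \<or> (\<forall>z. vert z \<in> V \<longrightarrow> composite t z = neg z)"
  proof (cases "\<exists>v. vert v \<in> V \<and> composite t v \<noteq> neg v")
    case False
    obtain u where "u \<in> V" using V(2) by fastforce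
    then show ?thesis using that[of "Pt u True"] False by auto
  qed (use that in blast)
  let ?V = "V - {vert v}"
  obtain Y X a where A: "hurwitz_equiv t (Y @ X)" "set Y \<subseteq> refls ?V" "vert a \<in> ?V"
    "X = [R v a] \<or> X = [R v a, R v a] \<or> X = [R v a, R v (neg a)]"
    using split_at_vertex[OF t(1,3) v(1) V] by blast
  obtain Y' X' a' where A': "hurwitz_equiv r (Y' @ X')" "set Y' \<subseteq> refls ?V" "vert a' \<in> ?V"
    "X' = [R v a'] \<or> X' = [R v a', R v a'] \<or> X' = [R v a', R v (neg a')]"
    using split_at_vertex[OF t(2) cr v(1) V] by blast
  have Yv: "composite Y v = v" "composite Y' v = v" using A(2) A'(2) by (auto intro!: composite_fix refls_fix)
  have YR: "set Y \<subseteq> Refl" "set Y' \<subseteq> Refl" using A A' refls_Refl by blast+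
  have XR: "set X \<subseteq> Refl" "set X' \<subseteq> Refl" using A A' by (auto intro!: R_in_refls)
  have tR: "set t \<subseteq> Refl" using t refls_Refl by blast
  have pt: "composite t = composite Y \<circ> composite X" "composite t = composite Y' \<circ> composite X'"
    using hurwitz_composite[OF A(1)] hurwitz_composite[OF A'(1)] eq by simp_all
  have Xs: "set X \<subseteq> {R v a, R v (neg a)}" "set X' \<subseteq> {R v a', R v (neg a')}" using A(4) A'(4) by auto
  have orbYX: "orb (Y @ X) = orb t" "orb (Y' @ X') = orb t"
    using hurwitz_orb[OF A(1)] hurwitz_orb[OF A'(1)] t by simp_all
  have cY: "connected_on Y ?V" "connected_on Y' ?V"
    using conn_rest[OF A(2) Xs(1) A(3)] conn_rest[OF A'(2) Xs(2) A'(3)] t(3) orbYX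
    by (simp_all add: connected_on_def)
  have ainj: "composite t z = composite t z' \<longleftrightarrow> z = z'" for z z' using composite_bij[OF tR] by (simp add: bij_is_inj inj_eq)
  have va: "v \<noteq> a" "v \<noteq> a'" "v \<noteq> neg a" "v \<noteq> neg a'" "vert v \<noteq> vert a" "vert v \<noteq> vert a'"
    using A(3) A'(3) by auto
  have c11: "X = [R v a] \<Longrightarrow> composite t a = v" using Yv by (simp add: pt(1))
  have c12: "X' = [R v a'] \<Longrightarrow> composite t a' = v" using Yv by (simp add: pt(2))
  note c1 = c11 c12
  have c21: "X = [R v a, R v a] \<Longrightarrow> composite t v = v" using Yv by (simp add: pt(1))
  have c22: "X' = [R v a', R v a'] \<Longrightarrow> composite t v = v" using Yv by (simp add: pt(2))
  note c2 = c21 c22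
  have c31: "X = [R v a, R v (neg a)] \<Longrightarrow> composite t v = neg v"
    using Yv composite_neg[OF YR(1), of v] by (simp add: pt(1))
  have c32: "X' = [R v a', R v (neg a')] \<Longrightarrow> composite t v = neg v"
    using Yv composite_neg[OF YR(2), of v] by (simp add: pt(2))
  note c3 = c31 c32
  have n1: "composite t v \<noteq> v" "composite t v \<noteq> neg v" if "composite t b = v" "vert b \<noteq> vert v" for b
  proof -
    show "composite t v \<noteq> v" using that ainj by metis
    show "composite t v \<noteq> neg v" using that ainj composite_neg[OF tR, of b] by (metis vert_neg)
  qed
  have k1: "X = [R v a] \<Longrightarrow> composite t v \<noteq> v \<and> composite t v \<noteq> neg v"
    and k2: "X' = [R v a'] \<Longrightarrow> composite t v \<noteq> v \<and> composite t v \<noteq> neg v"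
    using n1[of a] n1[of a'] c1 va(5,6) by auto
  have "\<not> (composite t v = v \<and> composite t v = neg v)" using neg_neq[of v] by auto
  then consider (1) "X = [R v a]" "X' = [R v a']" | (2) "X = [R v a, R v a]" "X' = [R v a', R v a']"
    | (3) "X = [R v a, R v (neg a)]" "X' = [R v a', R v (neg a')]"
    using A(4) A'(4) k1 k2 c2 c3 by blast
  then show ?thesis
  proof cases
    case 1
    have "a' = a" using c1(1)[OF 1(1)] c1(2)[OF 1(2)] ainj by metis
    then have X: "X = X'" using 1 by simp
    have "orb Y = orb Y'"
      by (rule orb_rest[OF A(2) _ _ A'(2), of X a X' a']) (use 1 va orbYX in auto)
    then have h: "hurwitz_equiv r (Y' @ X)" "orb Y = orb Y'" using A'(1) X by simp_all
    show ?thesis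
      by (rule determined_from_rest[OF IH[OF v(1)] V(1) v(1) A(2) A'(2) XR(1) _ A(3) cY(1) h(2) A(1) h(1) eq])
        (simp add: 1(1))
  next
    case 2
    have o: "orb Y = orb Y'"
      by (rule orb_rest[OF A(2) _ _ A'(2), of X a X' a']) (use 2 va orbYX in auto)
    \<comment> \<open>both double edges join \<open>v\<close> to points of one orbit\<close>
    have "(v, a) \<in> orb t" "(v, a') \<in> orb t"
      using orb_step[of "R v a" "Y @ X" v] orb_step[of "R v a'" "Y' @ X'" v] 2 orbYX by auto
    then have "(a', a) \<in> orb (Y' @ X')" using orb_sym[OF tR] orb_trans orbYX by metis
    then have "(retract v a' a', retract v a' a) \<in> orb Y'" using 2 va
      by (intro collapse[OF A'(2), of X']) auto
    then have "(a', a) \<in> orb Y'" using va by (simp add: retract_other)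
    then have 3: "hurwitz_equiv ([R v a', R v a'] @ Y') ([R v a, R v a] @ Y')"
      using pair_reach[OF va(6) A'(2)] by auto
    have "R v a \<in> Refl" "R v a' \<in> Refl" using va by (auto intro!: R_in_refls)
    then have "hurwitz_equiv (Y' @ X') (Y' @ X)"
      using 2 hurwitz_equiv.trans[OF hurwitz_equiv.sym[OF pair_right] hurwitz_equiv.trans[OF 3 pair_right]] YR by simp
    then have h: "hurwitz_equiv r (Y' @ X)" by (rule hurwitz_equiv.trans[OF A'(1)])
    show ?thesis
      by (rule determined_from_rest[OF IH[OF v(1)] V(1) v(1) A(2) A'(2) XR(1) _ A(3) cY(1) o A(1) h eq]) (simp add: 2)
  next
    case 3
    then have "composite t v = neg v" using c3 by blast
    then have g: "composite t z = neg z" if "vert z \<in> V" for z using v(2) that by blast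
    \<comment> \<open>the entries at \<open>v\<close> fix a third point, so it is the remaining ones that reverse it\<close>
    have full: "orb Y = full ?V" if Y: "set Y \<subseteq> refls ?V" "connected_on Y ?V" "composite t = composite Y \<circ> composite X"
      and a: "X = [R v a, R v (neg a)]" for Y X a
    proof -
      have "\<not> V \<subseteq> {vert v, vert a}"
      proof
        assume "V \<subseteq> {vert v, vert a}"
        then have "card V \<le> card {vert v, vert a}" by (intro card_mono) auto
        also have "\<dots> \<le> 2" by (simp add: card_insert_if)
        finally show False using V by simp
      qed
      then obtain w where w: "w \<in> V" "w \<noteq> vert v" "w \<noteq> vert a" by auto
      let ?b = "Pt w True"
      have "composite X ?b = ?b" using w by (simp add: a R_fix)
      then have "composite Y ?b = neg ?b" using g[of ?b] w(1) unfolding Y(3) by simp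
      with orb_composite[of ?b Y] have b: "(?b, neg ?b) \<in> orb Y" by (simp only:)
      show ?thesis by (rule orb_full[OF Y(1,2) _ b]) (use w in simp)
    qed
    have o: "orb Y = full ?V" using full[OF A(2) cY(1) pt(1) 3(1)] .
    have o': "orb Y' = full ?V" using full[OF A'(2) cY(2) pt(2) 3(2)] .
    have "(a', a) \<in> orb Y'" unfolding o' full_def using A(3) A'(3) by simp
    from orb_word[OF this] obtain ws where ws: "set ws \<subseteq> set Y'" "a = composite ws a'" by blast
    have wsR: "set ws \<subseteq> Refl" using ws(1) YR(2) by blast
    have wsv: "composite ws v = v"
    proof (rule composite_fix)
      fix x assume "x \<in> set ws"
      then have "x \<in> refls ?V" using ws(1) A'(2) by blast
      then show "x v = v" by (rule refls_fix) simp
    qed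
    have rV: "set (Y' @ X') \<subseteq> refls V" using hurwitz_refls_iff[OF A'(1)] t by blast
    \<comment> \<open>the composite is central, so the whole second list may be conjugated to move \<open>a'\<close> to \<open>a\<close>\<close>
    have comm: "composite (Y' @ X') \<circ> y = y \<circ> composite (Y' @ X')" if "y \<in> set (Y' @ X')" for y
    proof
      fix z
      have y: "y \<in> refls V" using that rV by blast
      have p: "composite (Y' @ X') = composite t" using pt by simp
      show "(composite (Y' @ X') \<circ> y) z = (y \<circ> composite (Y' @ X')) z"
      proof (cases "vert z \<in> V")
        case True
        then show ?thesis unfolding p using g refls_into[OF y] refl_neg[OF refls_Refl[OF y]] by simp
      next
        case False
        then have "composite t z = z" using t(1) by (auto intro!: composite_fix refls_fix)
        then show ?thesis unfolding p using refls_fix[OF y False] by simp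
      qed
    qed
    let ?Y = "map (foldr conj_by ws) Y'"
    have "hurwitz_equiv (Y' @ X') (map (foldr conj_by ws) (Y' @ X'))"
      by (rule conj_word) (use YR XR ws comm in auto)
    moreover have "map (foldr conj_by ws) X' = X"
      using 3 wsv ws(2) by (simp add: foldr_conj_R[OF wsR] composite_neg[OF wsR])
    ultimately have h: "hurwitz_equiv r (?Y @ X)" using hurwitz_equiv.trans[OF A'(1)] by simp
    have Y2: "set ?Y \<subseteq> refls ?V"
    proof -
      have "foldr conj_by ws x \<in> refls ?V" if "x \<in> refls ?V" for x
        using ws(1) by (induction ws) (use that A'(2) in \<open>auto intro!: conj_refls\<close>)
      then show ?thesis using A'(2) by auto
    qed
    have oY: "orb (?Y @ X) = orb t" using hurwitz_orb[OF h] t by simp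
    then have "connected_on (?Y @ X) V" using t(3) by (simp add: connected_on_def)
    then have c: "connected_on ?Y ?V" by (rule conn_rest[OF Y2 Xs(1) A(3)])
    have "composite t = composite ?Y \<circ> composite X" using hurwitz_composite[OF h] eq by simp
    then have "orb ?Y = full ?V" by (rule full[OF Y2 c _ 3(1)])
    then have "orb Y = orb ?Y" using o by simp
    then show ?thesis
      by (rule determined_from_rest[OF IH[OF v(1)] V(1) v(1) A(2) Y2 XR(1) _ A(3) cY(1) _ A(1) h eq, rotated])
        (simp add: 3)
  qed
qed

theorem all_determined:
  assumes "finite V" shows "determined V"
  using assms
proof (induction "card V" arbitrary: V rule: less_induct)
  case less
  have "hurwitz_equiv t r" if t: "set t \<subseteq> refls V" "set r \<subseteq> refls V" "connected_on t V" "orb t = orb r"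
    "composite t = composite r" "length t = length r" "cnt half t = cnt half r"
    and m: "card V = 2 \<longrightarrow> cnt half t = 0 \<longrightarrow> mset t = mset r" for t r
  proof -
  have cr: "connected_on r V" using t by (simp add: connected_on_def)
  consider "card V = 0" | "card V = 1" | "card V = 2" | "card V \<ge> 3" by linarith
  then show ?thesis
  proof cases
    case 1
    then have "V = {}" using less.prems by simp
    then have "refls V = {}" by (simp add: refls_def)
    then have "t = []" "r = []" using t by auto
    then show ?thesis by (simp add: hurwitz_equiv.refl)
  next
    case 2
    then obtain u where u: "V = {vert (Pt u True)}" using card_1_singletonE by (metis point.sel(1))
    let ?h = "R (Pt u True) (neg (Pt u True))"
    have "x = ?h" if "x \<in> refls V" for x using refls_one that u by blast
    then have "t = replicate (length t) ?h" "r = replicate (length t) ?h"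
      using t by (auto intro!: replicate_eqI)
    then have "t = r" by simp
    then show ?thesis by (simp add: hurwitz_equiv.refl)
  next
    case 3
    then obtain u w where uw: "V = {u, w}" "u \<noteq> w" by (meson card_2_iff)
    let ?a = "Pt u True" and ?b = "Pt w True"
    have V: "V = {vert ?a, vert ?b}" "vert ?a \<noteq> vert ?b" using uw by auto
    show ?thesis
    proof (cases "cnt half t = 0")
      case True
      then have m: "mset t = mset r" using m 3 by blast
      have "set t \<subseteq> {R ?a ?b, R ?a (neg ?b)}"
      proof
        fix x assume "x \<in> set t"
        then have "x \<in> refls {vert ?a, vert ?b}" "\<not> half x"
          using t True V by (auto simp: filter_empty_conv)
        from refls_two[OF this] show "x \<in> {R ?a ?b, R ?a (neg ?b)}" by auto
      qed
      then show ?thesis by (rule edges_perm[OF _ _ m]) (use V in auto)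
    next
      case False
      then show ?thesis using two_vertices_half_edge[OF V t(1,2,3) cr t(5,6,7)] by simp
    qed
  next
    case 4
    have "determined (V - {u})" if "u \<in> V" for u
      using less card_Diff1_less[OF less.prems that] by simp
    then show ?thesis by (rule determined_step[OF _ less.prems 4 t])
  qed
  qed
  then show ?case unfolding determined_def by blast
qed

section \<open>Arbitrary lists of reflections\<close>

text \<open>Unions of conjugacy classes under the group generated by \<open>t\<close>, as predicates.\<close>

definition conj_inv :: "('v point \<Rightarrow> 'v point) list \<Rightarrow> (('v point \<Rightarrow> 'v point) \<Rightarrow> bool) \<Rightarrow> bool" where
  "conj_inv t Q \<longleftrightarrow> (\<forall>y\<in>set t. \<forall>x\<in>Refl. Q (conj_by y x) = Q x)"

lemma refls_disjoint: assumes "C \<inter> D = {}" shows "refls C \<inter> refls D = {}"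
proof -
  have False if x: "x \<in> refls C" "x \<in> refls D" for x
  proof -
    obtain p q where "x = R p q" "p \<noteq> q" "vert p \<in> C" using x(1) by (auto simp: refls_def)
    then have "x p \<noteq> p" "vert p \<in> C" by auto
    then show False using refls_moved[OF x(2)] assms by auto
  qed
  then show ?thesis by auto
qed

lemma refls_commute:
  assumes "x \<in> refls C" "y \<in> refls D" "C \<inter> D = {}" shows "conj_by y x = x"
proof -
  obtain p q where x: "x = R p q" "vert p \<in> C" "vert q \<in> C" using assms(1) by (auto simp: refls_def)
  have "y p = p" "y q = q" using x assms(3) by (auto intro!: refls_fix[OF assms(2)])
  then show ?thesis using conj_R[OF refls_Refl[OF assms(2)], of p q] x(1) by simp
qed

abbreviation part :: "'v set \<Rightarrow> ('v point \<Rightarrow> 'v point) list \<Rightarrow> ('v point \<Rightarrow> 'v point) list" where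
  "part C \<equiv> filter (\<lambda>x. x \<in> refls C)"

lemma split_parts:
  assumes "set t \<subseteq> refls C \<union> refls D" "C \<inter> D = {}"
  shows "hurwitz_equiv t (part C t @ part D t)"
  using assms(1)
proof (induction t)
  case (Cons x t)
  have x: "x \<in> refls C \<or> x \<in> refls D" using Cons.prems by auto
  have IH: "hurwitz_equiv (x # t) (x # part C t @ part D t)" using Cons by (intro hurwitz_Cons) auto
  show ?case
  proof (cases "x \<in> refls C")
    case True
    then have "x \<notin> refls D" using refls_disjoint[OF assms(2)] by auto
    then show ?thesis using IH True by simp
  next
    case False
    then have xD: "x \<in> refls D" using x by auto
    have m: "map (conj_by x) (part C t) = part C t"
      using refls_commute[OF _ xD assms(2)] by (intro map_idI) auto
    have "set (part C t) \<subseteq> Refl" using refls_Refl by auto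
    from block_right[OF this refls_Refl[OF xD]]
    have "hurwitz_equiv (x # part C t) (part C t @ [x])" unfolding m by (rule hurwitz_equiv.sym)
    from hurwitz_appendR[OF this, of "part D t"]
    show ?thesis using hurwitz_equiv.trans[OF IH] False xD by simp
  qed
qed (simp add: hurwitz_equiv.refl)

lemma orb_part:
  assumes "set t \<subseteq> refls C \<union> refls D" "C \<inter> D = {}"
  shows "orb (part C t) = {(p, q) \<in> orb t. p = q \<or> vert p \<in> C}"
proof (intro equalityI subsetI, clarify)
  fix p q assume pq: "(p, q) \<in> orb (part C t)"
  have "(p, q) \<in> orb t" using orb_mono[of "part C t" t] pq by auto
  moreover have "p = q \<or> vert p \<in> C" using orb_outside[of "part C t" C, OF _ pq] by auto
  ultimately show "(p, q) \<in> orb t \<and> (p = q \<or> vert p \<in> C)" by blast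
next
  fix z assume "z \<in> {(p, q) \<in> orb t. p = q \<or> vert p \<in> C}"
  then obtain p q where z: "z = (p, q)" "(p, q) \<in> orb t" "p = q \<or> vert p \<in> C" by auto
  have "(p, q) \<in> orb (part C t) \<and> vert q \<in> C" if C: "vert p \<in> C"
    using z(2)
  proof (induction rule: orb_induct)
    case (step z x)
    show ?case
    proof (cases "x \<in> refls C")
      case True
      then have "(z, x z) \<in> orb (part C t)" using step by (intro orb_step) auto
      then show ?thesis using step refls_into[OF True] orb_trans by metis
    next
      case False
      then have "x \<in> refls D" using step assms by auto
      then have "x z = z" using step assms(2) by (intro refls_fix) auto
      then show ?thesis using step by simp
    qed
  qed (use C in simp)
  then show "z \<in> orb (part C t)" using z by auto
qed

lemma composite_parts:
  assumes "set t1 \<subseteq> refls C" "set r1 \<subseteq> refls C" "set t2 \<subseteq> refls D" "set r2 \<subseteq> refls D"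
    "C \<inter> D = {}" "composite (t1 @ t2) = composite (r1 @ r2)"
  shows "composite t1 = composite r1" "composite t2 = composite r2"
proof -
  show 1: "composite t1 = composite r1"
  proof
    fix z
    show "composite t1 z = composite r1 z"
    proof (cases "vert z \<in> C")
      case True
      have "composite t2 z = z" "composite r2 z = z" using assms True by (auto intro!: composite_fix refls_fix)
      then show ?thesis using fun_cong[OF assms(6), of z] by simp
    next
      case False
      then have "composite t1 z = z" "composite r1 z = z" using assms by (auto intro!: composite_fix refls_fix)
      then show ?thesis by simp
    qed
  qed
  have "bij (composite r1)" using assms(2) refls_Refl by (intro composite_bij) auto
  moreover have "composite r1 \<circ> composite t2 = composite r1 \<circ> composite r2" using assms(6) 1 by (simp only: composite_append)
  ultimately show "composite t2 = composite r2" using bij_cancel_left by blast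
qed

text \<open>Reflections in \<open>D\<close> commute with those in \<open>C\<close>, so belonging to the part in \<open>C\<close> is itself
  a conjugation invariant.\<close>

lemma part_conj_inv:
  assumes "set t \<subseteq> refls C \<union> refls D" "C \<inter> D = {}" "conj_inv (part C t) Q"
  shows "conj_inv t (\<lambda>x. x \<in> refls C \<and> Q x)"
  unfolding conj_inv_def
proof (intro ballI)
  fix y x :: "'a point \<Rightarrow> 'a point" assume y: "y \<in> set t" and x: "x \<in> Refl"
  show "(conj_by y x \<in> refls C \<and> Q (conj_by y x)) = (x \<in> refls C \<and> Q x)"
  proof (cases "y \<in> refls C")
    case True
    then show ?thesis using assms(3) x y conj_refls_iff[OF True] by (auto simp: conj_inv_def)
  next
    case False
    then have D: "y \<in> refls D" using y assms by auto
    have "conj_by y x = x" if "x \<in> refls C \<or> conj_by y x \<in> refls C"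
      using that refls_commute[OF _ D assms(2), of x] refls_commute[OF _ D assms(2), of "conj_by y x"]
        conj_conj[OF refls_Refl[OF D], of x] by auto
    then show ?thesis by auto
  qed
qed

lemma part_counts:
  assumes "set t \<subseteq> refls C \<union> refls D" "C \<inter> D = {}" "conj_inv (part C t) Q"
    "\<And>Q. conj_inv t Q \<Longrightarrow> cnt Q t = cnt Q r"
  shows "cnt Q (part C t) = cnt Q (part C r)"
  using assms(4)[OF part_conj_inv[OF assms(1-3)]] by simp

text \<open>The length, the number of half-edges and, in type \<open>D\<^sub>2\<close>, the multiplicity of each entry
  are counts of conjugation invariant predicates.\<close>

lemma component_determined:
  assumes V: "finite V" and t: "set t \<subseteq> refls V" "set r \<subseteq> refls V" and c: "connected_on t V"
    and eq: "composite t = composite r" "orb t = orb r" and Q: "\<And>Q. conj_inv t Q \<Longrightarrow> cnt Q t = cnt Q r"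
  shows "hurwitz_equiv t r"
proof (rule determinedD[OF all_determined[OF V] t c eq(2,1)])
  show "length t = length r" using Q[of "\<lambda>_. True"] by (simp add: conj_inv_def)
  have tR: "set t \<subseteq> Refl" using t refls_Refl by blast
  show h: "cnt half t = cnt half r" 
  proof (rule Q)
    show "conj_inv t half" unfolding conj_inv_def using tR half_conj by blast
  qed
  assume "card V = 2" and h0: "cnt half t = 0"
  then obtain u w where uw: "V = {u, w}" "u \<noteq> w" by (meson card_2_iff)
  let ?a = "Pt u True" and ?b = "Pt w True"
  have V: "V = {vert ?a, vert ?b}" "vert ?a \<noteq> vert ?b" using uw by auto
  let ?E = "{R ?a ?b, R ?a (neg ?b)}"
  have E: "x \<in> ?E" if "x \<in> set t \<union> set r" for x
  proof -
    have "x \<in> refls {vert ?a, vert ?b}" "\<not> half x"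
      using that t V h h0 by (auto simp: filter_empty_conv)
    from refls_two[OF this] show ?thesis by auto
  qed
  show "mset t = mset r"
  proof (rule multiset_eqI)
    fix x
    show "count (mset t) x = count (mset r) x"
    proof (cases "x \<in> ?E")
      case True
      have "conj_inv t ((=) x)"
        unfolding conj_inv_def
      proof (intro ballI)
        fix y z :: "'a point \<Rightarrow> 'a point" assume y: "y \<in> set t" and z: "z \<in> Refl"
        have "y \<in> ?E" using E y by auto
        moreover have "R ?a ?b \<in> Refl" "R ?a (neg ?b) \<in> Refl"
          using uw(2) by (auto simp: neg_def intro!: R_in_refls)
        ultimately have "conj_by y x = x"
          using True R_neg_commute[of ?b ?a] V by (auto simp: conj_self)
        then show "(x = conj_by y z) = (x = z)" using conj_conj y tR by (metis subsetD)
      qed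
      then have "cnt ((=) x) t = cnt ((=) x) r" by (rule Q)
      then show ?thesis by (simp add: count_mset count_list_eq_length_filter)
    next
      case False
      then have "x \<notin> set t" "x \<notin> set r" using E by auto
      then show ?thesis by (metis count_eq_zero_iff set_mset_mset)
    qed
  qed
qed

text \<open>The component of a vertex is a union of orbits, hence the same for both lists; it is
  split off, and the rest has fewer vertices.\<close>

theorem hurwitz_equiv_if_same_invariants:
  assumes "finite V" "set t \<subseteq> refls V" "set r \<subseteq> refls V" "composite t = composite r" "orb t = orb r"
    "\<And>Q. conj_inv t Q \<Longrightarrow> cnt Q t = cnt Q r"
  shows "hurwitz_equiv t r"
  using assms
proof (induction "card V" arbitrary: V t r rule: less_induct)
  case less
  show ?case
  proof (cases "V = {}")
    case True
    then have "refls V = {}" by (simp add: refls_def)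
    then have "t = []" "r = []" using less.prems by auto
    then show ?thesis by (simp add: hurwitz_equiv.refl)
  next
    case False
    then obtain u where u: "u \<in> V" by auto
    let ?v = "Pt u True"
    define C where "C = {w \<in> V. (?v, Pt w True) \<in> orb t \<or> (?v, neg (Pt w True)) \<in> orb t}"
    define D where "D = V - C"
    have CD: "C \<inter> D = {}" "C \<subseteq> V" "D \<subseteq> V" "D \<inter> C = {}" by (auto simp: C_def D_def)
    have fin: "finite C" "finite D" using CD less.prems(1) finite_subset by blast+
    have tR: "set t \<subseteq> Refl" "set r \<subseteq> Refl" using less.prems refls_Refl by blast+
    have inC: "vert p \<in> C \<longleftrightarrow> vert p \<in> V \<and> ((?v, p) \<in> orb t \<or> (?v, neg p) \<in> orb t)" for p
      unfolding C_def by (cases p; cases "sgn p") (auto simp: neg_def)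
    have closed: "x \<in> refls C \<union> refls D" if x: "x \<in> set t \<union> set r" for x
    proof -
      obtain p q where pq: "x = R p q" "p \<noteq> q" "vert p \<in> V" "vert q \<in> V"
        using x less.prems by (auto simp: refls_def)
      have "(p, q) \<in> orb t"
        using x less.prems(5) orb_step[of x t p] orb_step[of x r p] pq by auto
      then have "(p, q) \<in> orb t" "(q, p) \<in> orb t" "(neg p, neg q) \<in> orb t" "(neg q, neg p) \<in> orb t"
        by (auto intro: orb_sym[OF tR(1)] orb_neg[OF tR(1)])
      then have "vert p \<in> C \<longleftrightarrow> vert q \<in> C"
        unfolding inC using pq(3,4) orb_trans[of ?v] by blast
      then show ?thesis using pq by (auto simp: D_def intro!: R_in_refls)
    qed
    then have tc: "set t \<subseteq> refls C \<union> refls D" "set r \<subseteq> refls C \<union> refls D" by auto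
    then have tc': "set t \<subseteq> refls D \<union> refls C" "set r \<subseteq> refls D \<union> refls C" by auto
    have st: "hurwitz_equiv t (part C t @ part D t)" "hurwitz_equiv r (part C r @ part D r)"
      using split_parts[OF _ CD(1)] tc by auto
    have "composite (part C t @ part D t) = composite (part C r @ part D r)"
      using hurwitz_composite[OF st(1)] hurwitz_composite[OF st(2)] less.prems(4) by (simp only:)
    then have p: "composite (part C t) = composite (part C r)" "composite (part D t) = composite (part D r)"
      by (rule composite_parts[OF _ _ _ _ CD(1), rotated 4]; auto)+
    have o: "orb (part C t) = orb (part C r)" "orb (part D t) = orb (part D r)"
      using orb_part[OF tc(1) CD(1)] orb_part[OF tc(2) CD(1)]
        orb_part[OF tc'(1) CD(4)] orb_part[OF tc'(2) CD(4)] less.prems(5) by simp_all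
    have cn: "connected_on (part C t) C"
      unfolding connected_on_def
    proof (intro allI impI)
      fix p q assume pq: "vert p \<in> C" "vert q \<in> C"
      have pv: "(p, ?v) \<in> orb t \<or> (p, neg ?v) \<in> orb t"
        using pq(1)[unfolded inC] orb_sym[OF tR(1), of ?v p] orb_sym[OF tR(1), of ?v "neg p"]
          orb_neg[OF tR(1), of "neg p" ?v] by auto
      have vq: "(?v, q) \<in> orb t \<and> (neg ?v, neg q) \<in> orb t \<or> (?v, neg q) \<in> orb t \<and> (neg ?v, q) \<in> orb t"
        using pq(2)[unfolded inC] orb_neg[OF tR(1), of ?v q] orb_neg[OF tR(1), of ?v "neg q"] by auto
      have "(p, q) \<in> orb t \<or> (p, neg q) \<in> orb t"
        using pv vq orb_trans[of p ?v t q] orb_trans[of p ?v t "neg q"]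
          orb_trans[of p "neg ?v" t q] orb_trans[of p "neg ?v" t "neg q"] by argo
      then show "(p, q) \<in> orb (part C t) \<or> (p, neg q) \<in> orb (part C t)"
        using orb_part[OF tc(1) CD(1)] pq by auto
    qed
    have 1: "hurwitz_equiv (part C t) (part C r)"
    proof (rule component_determined[OF fin(1) _ _ cn p(1) o(1)])
      fix Q assume "conj_inv (part C t) Q"
      then show "cnt Q (part C t) = cnt Q (part C r)" by (rule part_counts[OF tc(1) CD(1) _ less.prems(6)])
    qed auto
    have "u \<in> C" using u by (simp add: C_def)
    then have "D \<subset> V" using u by (auto simp: D_def)
    then have "card D < card V" by (rule psubset_card_mono[OF less.prems(1)])
    then have 2: "hurwitz_equiv (part D t) (part D r)"
    proof (rule less.hyps[OF _ fin(2) _ _ p(2) o(2)])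
      fix Q assume "conj_inv (part D t) Q"
      then show "cnt Q (part D t) = cnt Q (part D r)" by (rule part_counts[OF tc'(1) CD(4) _ less.prems(6)])
    qed auto
    show ?thesis
      using hurwitz_equiv.trans[OF st(1) hurwitz_equiv.trans[OF hurwitz_append2[OF 1 2] hurwitz_equiv.sym[OF st(2)]]] .
  qed
qed

section \<open>Faithfulness of signed representations of Coxeter systems\<close>

text \<open>The pair \<open>(p, q)\<close> stands for the vector \<open>e\<^sub>p - e\<^sub>q\<close>, where \<open>e\<close> is odd.\<close>

type_synonym 'v root = "'v point \<times> 'v point"

text \<open>The value of the linear form \<open>f\<close> at a root; linear forms are odd functions on signed points.\<close>

definition rval :: "('v point \<Rightarrow> int) \<Rightarrow> 'v root \<Rightarrow> int" where
  "rval f \<alpha> = f (fst \<alpha>) - f (snd \<alpha>)"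

definition odd_fun :: "('v point \<Rightarrow> int) \<Rightarrow> bool" where
  "odd_fun f \<longleftrightarrow> (\<forall>z. f (neg z) = - f z)"

abbreviation root_refl :: "'v root \<Rightarrow> 'v point \<Rightarrow> 'v point" where
  "root_refl \<alpha> \<equiv> R (fst \<alpha>) (snd \<alpha>)"

text \<open>In the second case the roots are \<open>e\<^sub>p - e\<^sub>q\<close> and \<open>e\<^sub>p + e\<^sub>q\<close>, on the same two vertices.\<close>

definition orth :: "'v root \<Rightarrow> 'v root \<Rightarrow> bool" where
  "orth \<alpha> \<beta> \<longleftrightarrow> {vert (fst \<alpha>), vert (snd \<alpha>)} \<inter> {vert (fst \<beta>), vert (snd \<beta>)} = {} \<or>
     (\<exists>p q. \<alpha> = (p, q) \<and> \<beta> = (p, neg q) \<and> vert p \<noteq> vert q)"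

definition chain :: "'v root \<Rightarrow> 'v root \<Rightarrow> bool" where
  "chain \<alpha> \<beta> \<longleftrightarrow> (\<exists>p q r. \<alpha> = (p, q) \<and> \<beta> = (q, r) \<and> distinct [vert p, vert q, vert r])"

text \<open>The edge labelled 4 of type \<open>B\<close>, in the scaling where the roots are \<open>2 e\<^sub>p\<close> and \<open>e\<^sub>q - e\<^sub>p\<close>.\<close>

definition bchain :: "'v root \<Rightarrow> 'v root \<Rightarrow> bool" where
  "bchain \<alpha> \<beta> \<longleftrightarrow> (\<exists>p q. \<alpha> = (p, neg p) \<and> \<beta> = (q, p) \<and> vert p \<noteq> vert q)"

definition admissible :: "nat \<Rightarrow> 'v root \<Rightarrow> 'v root \<Rightarrow> bool" where
  "admissible m \<alpha> \<beta> \<longleftrightarrow> m = 2 \<and> orth \<alpha> \<beta> \<or> m = 3 \<and> (chain \<alpha> \<beta> \<or> chain \<beta> \<alpha>) \<or>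
     m = 4 \<and> (bchain \<alpha> \<beta> \<or> bchain \<beta> \<alpha>)"

lemma orth_sym: "orth \<alpha> \<beta> \<Longrightarrow> orth \<beta> \<alpha>" unfolding orth_def by force

lemma admissible_sym: "admissible m \<alpha> \<beta> \<Longrightarrow> admissible m \<beta> \<alpha>"
  using orth_sym unfolding admissible_def by blast

text \<open>The reflection in \<open>\<alpha>\<close> maps \<open>\<beta>\<close> to \<open>\<beta> + k \<alpha>\<close>, tested by linear forms; \<open>k\<close> is the
  negative of a Cartan integer.\<close>

definition cartan :: "int \<Rightarrow> 'v root \<Rightarrow> 'v root \<Rightarrow> bool" where
  "cartan k \<alpha> \<beta> \<longleftrightarrow> (\<forall>f. odd_fun f \<longrightarrow> rval (f \<circ> root_refl \<alpha>) \<beta> = rval f \<beta> + k * rval f \<alpha>)"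

lemma cartan_self: "odd_fun f \<Longrightarrow> rval (f \<circ> root_refl \<alpha>) \<alpha> = - rval f \<alpha>"
  by (simp add: rval_def)

lemma cartan_orth: assumes "orth \<alpha> \<beta>" shows "cartan 0 \<alpha> \<beta>"
  using assms unfolding orth_def
proof
  assume "{vert (fst \<alpha>), vert (snd \<alpha>)} \<inter> {vert (fst \<beta>), vert (snd \<beta>)} = {}"
  then show ?thesis by (auto simp: cartan_def rval_def R_fix)
next
  assume "\<exists>p q. \<alpha> = (p, q) \<and> \<beta> = (p, neg q) \<and> vert p \<noteq> vert q"
  then show ?thesis by (auto simp: cartan_def rval_def odd_fun_def)
qed

lemma cartan_chain: assumes "chain \<alpha> \<beta>" shows "cartan 1 \<alpha> \<beta>" "cartan 1 \<beta> \<alpha>"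
  using assms by (auto simp: cartan_def rval_def odd_fun_def chain_def R_fix)

lemma cartan_bchain: assumes "bchain \<alpha> \<beta>" shows "cartan 1 \<alpha> \<beta>" "cartan 2 \<beta> \<alpha>"
  using assms by (auto simp: cartan_def rval_def odd_fun_def bchain_def R_fix)

lemma conj_orth:
  assumes "orth \<alpha> \<beta>" "fst \<alpha> \<noteq> snd \<alpha>" shows "conj_by (root_refl \<alpha>) (root_refl \<beta>) = root_refl \<beta>"
proof -
  have a: "root_refl \<alpha> \<in> Refl" using assms(2) by (auto intro!: R_in_refls)
  show ?thesis
    using assms(1) unfolding orth_def
  proof
    assume "{vert (fst \<alpha>), vert (snd \<alpha>)} \<inter> {vert (fst \<beta>), vert (snd \<beta>)} = {}"
    then have "root_refl \<alpha> (fst \<beta>) = fst \<beta>" "root_refl \<alpha> (snd \<beta>) = snd \<beta>" by (auto intro!: R_fix)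
    then show ?thesis using conj_R[OF a, of "fst \<beta>" "snd \<beta>"] by simp
  next
    assume "\<exists>p q. \<alpha> = (p, q) \<and> \<beta> = (p, neg q) \<and> vert p \<noteq> vert q"
    then obtain p q where pq: "\<alpha> = (p, q)" "\<beta> = (p, neg q)" by blast
    then have "conj_by (root_refl \<alpha>) (root_refl \<beta>) = R q (neg p)" using conj_R[OF a, of "fst \<beta>" "snd \<beta>"] by simp
    also have "\<dots> = R p (neg q)" using R_sym[of q "neg p"] R_negs[of p "neg q"] by simp
    finally show ?thesis using pq by simp
  qed
qed

lemma conj_chain:
  assumes "chain \<alpha> \<beta>" shows "conj_by (root_refl \<alpha>) (root_refl \<beta>) = conj_by (root_refl \<beta>) (root_refl \<alpha>)"
proof -
  obtain p q r where pq: "\<alpha> = (p, q)" "\<beta> = (q, r)" "distinct [vert p, vert q, vert r]"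
    using assms unfolding chain_def by blast
  then have "p \<noteq> q" "q \<noteq> r" by auto
  then have "R p q \<in> Refl" "R q r \<in> Refl" by (auto intro!: R_in_refls)
  moreover have "R p q r = r" "R q r p = p" using pq by (auto intro!: R_fix)
  ultimately show ?thesis using pq by (simp add: conj_R)
qed

lemma conj_bchain:
  assumes "bchain \<alpha> \<beta>"
  shows "conj_by (root_refl \<alpha>) (conj_by (root_refl \<beta>) (root_refl \<alpha>)) = conj_by (root_refl \<beta>) (root_refl \<alpha>)"
proof -
  obtain p q where pq: "\<alpha> = (p, neg p)" "\<beta> = (q, p)" "vert p \<noteq> vert q"
    using assms unfolding bchain_def by blast
  then have "p \<noteq> q" by auto
  then have "R p (neg p) \<in> Refl" "R q p \<in> Refl" by (auto intro!: R_in_refls)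
  then show ?thesis using pq by (simp add: conj_R R_fix)
qed

lemma admissible_order:
  assumes "admissible m \<alpha> \<beta>" "fst \<alpha> \<noteq> snd \<alpha>"
  shows "((root_refl \<alpha> \<circ> root_refl \<beta>) ^^ m) = id"
proof -
  let ?a = "root_refl \<alpha>" and ?b = "root_refl \<beta>"
  consider (2) "m = 2" "orth \<alpha> \<beta>" | (3) "m = 3" "chain \<alpha> \<beta> \<or> chain \<beta> \<alpha>" | (4) "m = 4" "bchain \<alpha> \<beta> \<or> bchain \<beta> \<alpha>"
    using assms unfolding admissible_def by blast
  then show ?thesis
  proof cases
    case 2
    have "?a (?b (?a z)) = ?b z" for z
      using fun_cong[OF conj_orth[OF 2(2) assms(2)], of z] by (simp add: conj_apply)
    then show ?thesis using 2 by (simp add: fun_eq_iff numeral_eq_Suc)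
  next
    case 3
    have "conj_by ?a ?b = conj_by ?b ?a" using conj_chain[of \<alpha> \<beta>] conj_chain[of \<beta> \<alpha>] 3 by auto
    then have "?a (?b (?a z)) = ?b (?a (?b z))" for z by (metis conj_apply)
    then show ?thesis using 3 by (simp add: fun_eq_iff numeral_eq_Suc)
  next
    case 4
    have *: "?a (?b (?a (?b z))) = ?b (?a (?b (?a z)))" for z
      using 4(2)
    proof
      assume "bchain \<alpha> \<beta>"
      from fun_cong[OF conj_bchain[OF this], of "?a z"]
      show ?thesis by (simp add: conj_apply)
    next
      assume "bchain \<beta> \<alpha>"
      from fun_cong[OF conj_bchain[OF this], of "?b z"]
      show ?thesis by (simp add: conj_apply)
    qed
    have "?a (?b (?a (?b (?a (?b (?a (?b z))))))) = z" for z
      by (subst *) simp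
    then show ?thesis using 4 by (simp add: fun_eq_iff numeral_eq_Suc)
  qed
qed

text \<open>The product \<open>k * k'\<close> of the two Cartan integers is \<open>4 cos\<^sup>2 (\<pi> / m)\<close>.\<close>

lemma admissible_cartan:
  assumes "admissible m \<alpha> \<beta>"
  shows "\<exists>k k'. cartan k \<alpha> \<beta> \<and> cartan k' \<beta> \<alpha> \<and> 0 \<le> k \<and> 0 \<le> k' \<and> (m = 2 \<or> m = 3 \<or> m = 4) \<and>
    (m \<ge> 3 \<longrightarrow> k * k' \<ge> 1 \<and> k' \<ge> 1) \<and> (m = 4 \<longrightarrow> k * k' = 2)"
proof -
  consider (2) "m = 2" "orth \<alpha> \<beta>" | (3) "m = 3" "cartan 1 \<alpha> \<beta>" "cartan 1 \<beta> \<alpha>"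
    | (4) "m = 4" "bchain \<alpha> \<beta>" | (5) "m = 4" "bchain \<beta> \<alpha>"
    using assms cartan_chain unfolding admissible_def by blast
  then show ?thesis
  proof cases
    case 2
    then show ?thesis using cartan_orth[OF 2(2)] cartan_orth[OF orth_sym[OF 2(2)]]
      by (intro exI[of _ 0]) simp
  next
    case 3
    then show ?thesis by (intro exI[of _ 1]) simp
  next
    case 4
    then show ?thesis using cartan_bchain[OF 4(2)] by (intro exI[of _ 1] exI[of _ 2]) simp
  next
    case 5
    then show ?thesis using cartan_bchain[OF 5(2)] by (intro exI[of _ 2] exI[of _ 1]) simp
  qed
qed

lemma coxeter_equiv_lists: "coxeter_equiv S M u v \<Longrightarrow> u \<in> lists S \<and> v \<in> lists S"
  by (induction rule: coxeter_equiv.induct) (auto simp: in_lists_conv_set)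

text \<open>The linear form \<open>\<Lambda>\<close> is positive on simple roots; a root is called positive if \<open>\<Lambda>\<close> is.
  Only orders up to 4 occur.\<close>

locale signed_root_system =
  fixes S :: "'a set" and M :: "'a \<Rightarrow> 'a \<Rightarrow> nat" and root :: "'a \<Rightarrow> 'v root" and \<Lambda> :: "'v point \<Rightarrow> int"
  assumes cox: "coxeter_matrix S M"
    and odd: "odd_fun \<Lambda>"
    and pos: "s \<in> S \<Longrightarrow> rval \<Lambda> (root s) > 0"
    and adm: "s \<in> S \<Longrightarrow> t \<in> S \<Longrightarrow> s \<noteq> t \<Longrightarrow> admissible (M s t) (root s) (root t)"
begin

abbreviation eqv (infix "\<approx>" 50) where "u \<approx> v \<equiv> coxeter_equiv S M u v"

definition rep :: "'a list \<Rightarrow> 'v point \<Rightarrow> 'v point" where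
  "rep u = composite (map (\<lambda>s. root_refl (root s)) u)"

lemma rep_simps [simp]: "rep [] = id" "rep (s # u) = root_refl (root s) \<circ> rep u" "rep (u @ v) = rep u \<circ> rep v"
  by (simp_all add: rep_def)

lemma root_neq: "s \<in> S \<Longrightarrow> fst (root s) \<noteq> snd (root s)"
  using pos by (force simp: rval_def)

lemma M_self: "s \<in> S \<Longrightarrow> M s s = 1" and M_sym: "s \<in> S \<Longrightarrow> t \<in> S \<Longrightarrow> M s t = M t s"
  using cox by (auto simp: coxeter_matrix_def)

lemma rep_power: "rep (concat (replicate m [s, t])) = (root_refl (root s) \<circ> root_refl (root t)) ^^ m"
  by (induction m) (auto simp: comp_assoc)

lemma rep_eqv: "u \<approx> v \<Longrightarrow> rep u = rep v"
proof (induction rule: coxeter_equiv.induct)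
  case (relator s t)
  show ?case
  proof (cases "s = t")
    case True
    then show ?thesis using relator M_self by (auto simp: fun_eq_iff)
  next
    case False
    then show ?thesis using admissible_order[OF adm root_neq] relator by (simp add: rep_power)
  qed
qed auto

lemma eqv_lists: "u \<approx> v \<Longrightarrow> v \<in> lists S"
  using coxeter_equiv_lists by blast

text \<open>All relators have even length; this makes every appended generator either raise or lower the length.\<close>

lemma eqv_parity: "u \<approx> v \<Longrightarrow> even (length u) = even (length v)"
proof (induction rule: coxeter_equiv.induct)
  case (relator s t)
  have "length (concat (replicate n [s, t])) = 2 * n" for n by (induction n) auto
  then show ?case by simp
qed auto

lemma eqv_cancel:
  assumes "s \<in> S" "u \<in> lists S" "v \<in> lists S" shows "u @ s # s # v \<approx> u @ v"
proof -
  have "[s, s] \<approx> []" using coxeter_equiv.relator[OF assms(1,1), of M] M_self assms by simp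
  then have "u @ [s, s] @ v \<approx> u @ [] @ v"
    using assms by (intro coxeter_equiv.append coxeter_equiv.refl)
  then show ?thesis by simp
qed

declare coxeter_equiv.trans [trans]

lemma eqv_cong: "a \<approx> b \<Longrightarrow> u \<in> lists S \<Longrightarrow> v \<in> lists S \<Longrightarrow> u @ a @ v \<approx> u @ b @ v"
  by (intro coxeter_equiv.append coxeter_equiv.refl)

lemma eqv_right: "a \<approx> b \<Longrightarrow> v \<in> lists S \<Longrightarrow> a @ v \<approx> b @ v"
  by (intro coxeter_equiv.append coxeter_equiv.refl)

lemma braid_relations:
  assumes "s \<in> S" "t \<in> S"
  shows "M s t = 2 \<Longrightarrow> [s, t] \<approx> [t, s]" "M s t = 3 \<Longrightarrow> [s, t, s] \<approx> [t, s, t]"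
    "M s t = 4 \<Longrightarrow> [s, t, s, t] \<approx> [t, s, t, s]"
proof -
  note st = assms
  have rel: "[] @ w \<approx> concat (replicate (M s t) [s, t]) @ w" if "w \<in> lists S" for w
    using st that by (intro coxeter_equiv.append coxeter_equiv.refl coxeter_equiv.sym[OF coxeter_equiv.relator])
  show "[s, t] \<approx> [t, s]" if m: "M s t = 2"
  proof -
    have "[t, s] \<approx> [s, t, s] @ t # t # [s]" using rel[of "[t, s]"] st by (simp add: m numeral_eq_Suc)
    also have "\<dots> \<approx> [s, t, s] @ [s]" using st by (intro eqv_cancel) auto
    also have "[s, t, s] @ [s] = [s, t] @ s # s # []" by simp
    also have "\<dots> \<approx> [s, t] @ []" using st by (intro eqv_cancel) auto
    finally show ?thesis by (simp add: coxeter_equiv.sym)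
  qed
  show "[s, t, s] \<approx> [t, s, t]" if m: "M s t = 3"
  proof -
    have "[t, s, t] \<approx> [s, t, s, t, s] @ t # t # [s, t]" using rel[of "[t, s, t]"] st by (simp add: m numeral_eq_Suc)
    also have "\<dots> \<approx> [s, t, s, t, s] @ [s, t]" using st by (intro eqv_cancel) auto
    also have "\<dots> = [s, t, s, t] @ s # s # [t]" by simp
    also have "\<dots> \<approx> [s, t, s, t] @ [t]" using st by (intro eqv_cancel) auto
    also have "\<dots> = [s, t, s] @ t # t # []" by simp
    also have "\<dots> \<approx> [s, t, s] @ []" using st by (intro eqv_cancel) auto
    finally show ?thesis by (simp add: coxeter_equiv.sym)
  qed
  show "[s, t, s, t] \<approx> [t, s, t, s]" if m: "M s t = 4"
  proof -
    have "[t, s, t, s] \<approx> [s, t, s, t, s, t, s] @ t # t # [s, t, s]"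
      using rel[of "[t, s, t, s]"] st by (simp add: m numeral_eq_Suc)
    also have "\<dots> \<approx> [s, t, s, t, s, t, s] @ [s, t, s]" using st by (intro eqv_cancel) auto
    also have "\<dots> = [s, t, s, t, s, t] @ s # s # [t, s]" by simp
    also have "\<dots> \<approx> [s, t, s, t, s, t] @ [t, s]" using st by (intro eqv_cancel) auto
    also have "\<dots> = [s, t, s, t, s] @ t # t # [s]" by simp
    also have "\<dots> \<approx> [s, t, s, t, s] @ [s]" using st by (intro eqv_cancel) auto
    also have "\<dots> = [s, t, s, t] @ s # s # []" by simp
    also have "\<dots> \<approx> [s, t, s, t] @ []" using st by (intro eqv_cancel) auto
    finally show ?thesis by (simp add: coxeter_equiv.sym)
  qed
qed

definition len :: "'a list \<Rightarrow> nat" where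
  "len u = (LEAST n. \<exists>v. u \<approx> v \<and> length v = n)"

lemma len_le: "u \<approx> v \<Longrightarrow> len u \<le> length v"
  unfolding len_def by (rule Least_le) auto

lemma len_ex: assumes "u \<in> lists S" obtains v where "u \<approx> v" "length v = len u"
proof -
  have "\<exists>n v. u \<approx> v \<and> length v = n" using coxeter_equiv.refl[OF assms] by auto
  from LeastI_ex[OF this] show ?thesis using that unfolding len_def by blast
qed

lemma len_cong: assumes "u \<approx> v" shows "len u = len v"
proof -
  have "u \<approx> w \<longleftrightarrow> v \<approx> w" for w using assms coxeter_equiv.trans coxeter_equiv.sym by metis
  then show ?thesis unfolding len_def by simp
qed

lemma len_append:
  assumes "u \<in> lists S" "w \<in> lists S" shows "len (u @ w) \<le> len u + length w"
proof -
  obtain v where v: "u \<approx> v" "length v = len u" using len_ex[OF assms(1)] .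
  have "u @ w \<approx> v @ w" using v(1) assms by (intro coxeter_equiv.append coxeter_equiv.refl)
  then show ?thesis using len_le v by fastforce
qed

lemma snoc_cancel: "s \<in> S \<Longrightarrow> u \<in> lists S \<Longrightarrow> (u @ [s]) @ [s] \<approx> u"
  using eqv_cancel[of s u "[]"] by simp

lemma len_snoc:
  assumes "u \<in> lists S" "s \<in> S" shows "len (u @ [s]) = Suc (len u) \<or> len u = Suc (len (u @ [s]))"
proof -
  have par: "even (len w) = even (length w)" if w: "w \<in> lists S" for w
    using len_ex[OF w] eqv_parity by metis
  have "len (u @ [s]) \<le> len u + 1" using len_append[of u "[s]"] assms by simp
  moreover have "len u \<le> len (u @ [s]) + 1"
    using len_append[of "u @ [s]" "[s]"] assms len_cong[OF snoc_cancel[OF assms(2,1)]] by simp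
  moreover have "even (len (u @ [s])) \<noteq> even (len u)" using par assms by simp
  ultimately show ?thesis by (metis Suc_eq_plus1 le_Suc_eq le_antisym)
qed

lemma descent:
  assumes "u \<in> lists S" "len u > 0"
  obtains v t where "v \<in> lists S" "t \<in> S" "u \<approx> v @ [t]" "len u = Suc (len v)"
proof -
  obtain w where w: "u \<approx> w" "length w = len u" using len_ex[OF assms(1)] .
  then obtain v t where vt: "w = v @ [t]" using assms(2) by (cases w rule: rev_exhaust) auto
  have l: "v \<in> lists S" "t \<in> S" using eqv_lists[OF w(1)] vt by auto
  have "len v \<le> length v" by (rule len_le[OF coxeter_equiv.refl[OF l(1)]])
  moreover have "len u \<le> Suc (len v)" using len_cong[OF w(1)] len_append[of v "[t]"] l vt by simp
  ultimately show ?thesis using that[OF l] w vt by simp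
qed

text \<open>The linear form \<open>\<Lambda>\<close> pulled back along \<open>u\<close>; its value at a root tells whether \<open>u\<close> maps
  that root to a positive one.\<close>

definition fun_of :: "'a list \<Rightarrow> 'v point \<Rightarrow> int" where "fun_of u = \<Lambda> \<circ> rep u"

lemma fun_of_odd: "odd_fun (fun_of u)"
proof -
  have "rep u (neg z) = neg (rep u z)" for z by (induction u) auto
  then show ?thesis using odd by (simp add: odd_fun_def fun_of_def)
qed

lemma fun_of_snoc: "fun_of (u @ [s]) = fun_of u \<circ> root_refl (root s)"
  by (simp add: fun_of_def comp_assoc)

lemma fun_of_cong: "u \<approx> v \<Longrightarrow> fun_of u = fun_of v"
  using rep_eqv by (simp add: fun_of_def)

lemma fun_of_cartan:
  "cartan k (root s) \<beta> \<Longrightarrow> rval (fun_of (u @ [s])) \<beta> = rval (fun_of u) \<beta> + k * rval (fun_of u) (root s)"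
  using fun_of_odd[of u] by (simp add: cartan_def fun_of_snoc)

lemma fun_of_self: "rval (fun_of (u @ [s])) (root s) = - rval (fun_of u) (root s)"
  using cartan_self[OF fun_of_odd] by (simp add: fun_of_snoc)

text \<open>Let \<open>t\<close> be a descent of \<open>u\<close>. Removing letters \<open>t\<close>, \<open>s\<close>, \<open>t\<close>, ... from the right as long as the length
  drops reaches a word \<open>v\<close> with neither \<open>s\<close> nor \<open>t\<close> as descent, where the induction hypothesis makes
  both values positive. The removed part has fewer than \<open>M s t\<close> letters, for otherwise the braid
  relation would make \<open>s\<close> a descent of \<open>u\<close>; for such a part the value for \<open>u\<close> is a nonnegative combination of
  the values for \<open>v\<close>. Since \<open>M s t \<le> 4\<close>, the possible parts are \<open>t\<close>, \<open>st\<close> and \<open>tst\<close>.\<close>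

theorem ascent_positive:
  assumes "u \<in> lists S" "s \<in> S" "len (u @ [s]) > len u"
  shows "rval (fun_of u) (root s) > 0"
  using assms
proof (induction "len u" arbitrary: u s rule: less_induct)
  case less
  note s = less.prems(2)
  show ?case
  proof (cases "len u = 0")
    case True
    then obtain v where "u \<approx> v" "v = []" using len_ex[OF less.prems(1)] by auto
    then have "fun_of u = \<Lambda>" using fun_of_cong by (fastforce simp: fun_of_def)
    then show ?thesis using pos[OF s] by simp
  next
    case False
    then obtain v t where v: "v \<in> lists S" and t: "t \<in> S" and uv: "u \<approx> v @ [t]" and lu: "len u = Suc (len v)"
      using descent less.prems(1) by blast
    have us: "len (u @ [s]) = len ((v @ w) @ [s])" if "v @ [t] \<approx> v @ w" for w
      using eqv_cong[OF coxeter_equiv.trans[OF uv that], of "[]" "[s]"] s len_cong by simp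
    have st: "s \<noteq> t"
    proof
      assume "s = t"
      then have "len (u @ [s]) = len v"
        using us[OF coxeter_equiv.refl] len_cong[OF snoc_cancel[OF s v]] v t by simp
      then show False using less.prems(3) lu by simp
    qed
    note A = adm[OF s t st]
    obtain k k' where k: "cartan k (root s) (root t)" "cartan k' (root t) (root s)" "0 \<le> k" "0 \<le> k'"
      and m: "M s t = 2 \<or> M s t = 3 \<or> M s t = 4"
      and k3: "M s t \<ge> 3 \<Longrightarrow> k * k' \<ge> 1 \<and> k' \<ge> 1" and k4: "M s t = 4 \<Longrightarrow> k * k' = 2"
      using admissible_cartan[OF A] by blast
    \<comment> \<open>too short an expression for \<open>u @ [s]\<close> contradicts the ascent\<close>
    have short: False if "u @ [s] \<approx> w @ x" "w \<in> lists S" "x \<in> lists S" "len w + length x \<le> len u" for w x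
      using len_append[OF that(2,3)] len_cong[OF that(1)] that(4) less.prems(3) by simp
    have IH: "rval (fun_of w) (root r) > 0" if "w \<in> lists S" "r \<in> S" "len w < len u" "len (w @ [r]) > len w" for w r
      using less.hyps[OF that(3,1,2,4)] .
    have Fu: "fun_of u = fun_of (v @ [t])" using fun_of_cong[OF uv] .
    have ext: "u @ [s] \<approx> w @ x @ [s]" if "u \<approx> w @ x" for w x
      using eqv_cong[OF that, of "[]" "[s]"] s by simp
    have st_lists: "[s] \<in> lists S" "[t] \<in> lists S" "[s, t] \<in> lists S" "[t, s, t] \<in> lists S" using s t by auto
    show ?thesis
    proof (cases "len (v @ [s]) > len v")
      case True
      have "len (v @ [t]) > len v" using lu len_cong[OF uv] by simp
      then have "rval (fun_of v) (root s) > 0" "rval (fun_of v) (root t) > 0"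
        using IH[OF v s] IH[OF v t] True lu by auto
      then show ?thesis unfolding Fu using fun_of_cartan[OF k(2), of v] k(4) by (simp add: add_pos_nonneg)
    next
      case False
      \<comment> \<open>\<open>s\<close> is an involution, so \<open>w @ [s]\<close> represents the same element as \<open>v\<close>\<close>
      define w where "w = v @ [s]"
      have w: "w \<in> lists S" using v s w_def by simp
      have lw: "len v = Suc (len w)" using False len_snoc[OF v s] w_def by auto
      have vw: "w @ [s] \<approx> v" using snoc_cancel[OF s v] w_def by simp
      have u_w: "u \<approx> w @ [s, t]"
        using coxeter_equiv.trans[OF uv eqv_right[OF coxeter_equiv.sym[OF vw] st_lists(2)]] by simp
      have ls: "len (w @ [s]) > len w" using len_cong[OF vw] lw by simp
      have m2: "M s t \<noteq> 2"
      proof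
        assume 2: "M s t = 2"
        have "u @ [s] \<approx> w @ [s, t] @ [s]" by (rule ext[OF u_w])
        also have "\<dots> \<approx> w @ [t, s] @ [s]"
          using w s braid_relations(1)[OF s t 2] by (intro eqv_cong) auto
        also have "\<dots> = (w @ [t]) @ s # s # []" by simp
        also have "\<dots> \<approx> (w @ [t]) @ []" using w s t by (intro eqv_cancel) auto
        finally have "u @ [s] \<approx> w @ [t]" by simp
        from short[OF this w] show False using t lw lu by simp
      qed
      then have m3: "M s t \<ge> 3" using m by auto
      show ?thesis
      proof (cases "len (w @ [t]) > len w")
        case True
        have AB: "rval (fun_of w) (root s) > 0" "rval (fun_of w) (root t) > 0"
          using IH[OF w s] IH[OF w t] True ls lu lw by auto
        have "fun_of u = fun_of ((w @ [s]) @ [t])" using fun_of_cong[OF u_w] by simp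
        then have "rval (fun_of u) (root s) =
            (k * k' - 1) * rval (fun_of w) (root s) + k' * rval (fun_of w) (root t)"
          using fun_of_cartan[OF k(2), of "w @ [s]"] fun_of_cartan[OF k(1), of w] fun_of_self[of w s]
          by (simp add: algebra_simps)
        then show ?thesis using AB k3[OF m3] by (simp add: add_nonneg_pos)
      next
        case False
        define x where "x = w @ [t]"
        have x: "x \<in> lists S" using w t x_def by simp
        have lx: "len w = Suc (len x)" using False len_snoc[OF w t] x_def by auto
        have wx: "x @ [t] \<approx> w" using snoc_cancel[OF t w] x_def by simp
        have u_x: "u \<approx> x @ [t, s, t]"
          using coxeter_equiv.trans[OF u_w eqv_right[OF coxeter_equiv.sym[OF wx] st_lists(3)]] by simp
        have lt: "len (x @ [t]) > len x" using len_cong[OF wx] lx by simp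
        have m3': "M s t \<noteq> 3"
        proof
          assume 3: "M s t = 3"
          have "u @ [s] \<approx> x @ [t, s, t] @ [s]" by (rule ext[OF u_x])
          also have "\<dots> \<approx> x @ [s, t, s] @ [s]"
            using x s coxeter_equiv.sym[OF braid_relations(2)[OF s t 3]] by (intro eqv_cong) auto
          also have "\<dots> = (x @ [s, t]) @ s # s # []" by simp
          also have "\<dots> \<approx> (x @ [s, t]) @ []" using x s t by (intro eqv_cancel) auto
          finally have "u @ [s] \<approx> x @ [s, t]" by simp
          from short[OF this x] show False using s t lx lw lu by simp
        qed
        then have 4: "M s t = 4" using m m2 by auto
        show ?thesis
        proof (cases "len (x @ [s]) > len x")
          case True
          have AB: "rval (fun_of x) (root s) > 0"
            using IH[OF x s] True lu lw lx by auto
          have F: "fun_of u = fun_of (((x @ [t]) @ [s]) @ [t])" using fun_of_cong[OF u_x] by simp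
          have "rval (fun_of u) (root s) = rval (fun_of ((x @ [t]) @ [s])) (root s) + k' * rval (fun_of ((x @ [t]) @ [s])) (root t)"
            unfolding F by (rule fun_of_cartan[OF k(2)])
          also have "\<dots> = - rval (fun_of (x @ [t])) (root s)
              + k' * (rval (fun_of (x @ [t])) (root t) + k * rval (fun_of (x @ [t])) (root s))"
            unfolding fun_of_self fun_of_cartan[OF k(1)] ..
          also have "\<dots> = (k * k' - 1) * rval (fun_of (x @ [t])) (root s) + k' * rval (fun_of (x @ [t])) (root t)"
            by (simp add: algebra_simps)
          also have "\<dots> = rval (fun_of x) (root s)"
            unfolding fun_of_self fun_of_cartan[OF k(2)] using k4[OF 4] by simp
          finally show ?thesis using AB by simp
        next
          case False
          define y where "y = x @ [s]"
          have y: "y \<in> lists S" using x s y_def by simp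
          have ly: "len x = Suc (len y)" using False len_snoc[OF x s] y_def by auto
          have xy: "y @ [s] \<approx> x" using snoc_cancel[OF s x] y_def by simp
          have u_y: "u \<approx> y @ [s, t, s, t]"
            using coxeter_equiv.trans[OF u_x eqv_right[OF coxeter_equiv.sym[OF xy] st_lists(4)]] by simp
          have "u @ [s] \<approx> y @ [s, t, s, t] @ [s]" by (rule ext[OF u_y])
          also have "\<dots> \<approx> y @ [t, s, t, s] @ [s]"
            using y s braid_relations(3)[OF s t 4] by (intro eqv_cong) auto
          also have "\<dots> = (y @ [t, s, t]) @ s # s # []" by simp
          also have "\<dots> \<approx> (y @ [t, s, t]) @ []" using y s t by (intro eqv_cancel) auto
          finally have "u @ [s] \<approx> y @ [t, s, t]" by simp
          from short[OF this y] have False using s t ly lx lw lu by simp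
          then show ?thesis ..
        qed
      qed
    qed
  qed
qed

text \<open>A nontrivial element has a descent, whose simple root it maps to a negative one.\<close>

theorem rep_faithful:
  assumes "u \<in> lists S" "rep u = id" shows "u \<approx> []"
proof (cases "len u = 0")
  case True
  then show ?thesis using len_ex[OF assms(1)] by auto
next
  case False
  then obtain v t where v: "v \<in> lists S" "t \<in> S" "u \<approx> v @ [t]" "len u = Suc (len v)"
    using descent assms(1) by blast
  then have "rval (fun_of v) (root t) > 0" using ascent_positive len_cong[OF v(3)] by simp
  then have "rval (fun_of u) (root t) < 0" using fun_of_cong[OF v(3)] fun_of_self by simp
  moreover have "fun_of u = \<Lambda>" using assms(2) by (simp add: fun_of_def)
  ultimately show ?thesis using pos[OF v(2)] by simp
qed

end

section \<open>Roots for the classical types\<close>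

text \<open>The vector \<open>e\<^sub>i - e\<^sub>j\<close>. The component \<open>C\<close> is part of the vertex, so that roots of different components
  are orthogonal.\<close>

definition coord_root :: "'c \<Rightarrow> nat \<Rightarrow> nat \<Rightarrow> ('c \<times> nat) root" where
  "coord_root C i j = (Pt (C, i) True, Pt (C, j) True)"

definition root_A :: "'c \<Rightarrow> nat \<Rightarrow> ('c \<times> nat) root" where
  "root_A C i = coord_root C (Suc i) i"

definition root_B :: "'c \<Rightarrow> nat \<Rightarrow> ('c \<times> nat) root" where
  "root_B C i = (if i = 0 then (Pt (C, 0) True, Pt (C, 0) False) else coord_root C i (i - 1))"

text \<open>The root of the vertex \<open>0\<close> is \<open>e\<^sub>1 + e\<^sub>0\<close>.\<close>

definition root_D :: "'c \<Rightarrow> nat \<Rightarrow> ('c \<times> nat) root" where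
  "root_D C i = (if i = 0 then (Pt (C, 1) True, Pt (C, 0) False) else coord_root C i (i - 1))"

text \<open>The form with value \<open>j + 1\<close> at \<open>e\<^sub>j\<close>; the shift makes it positive at the roots \<open>2 e\<^sub>0\<close> and
  at \<open>e\<^sub>1 + e\<^sub>0\<close> alike.\<close>

definition height :: "('c \<times> nat) point \<Rightarrow> int" where
  "height z = (if sgn z then 1 else - 1) * (int (snd (vert z)) + 1)"

lemma height_odd: "odd_fun height" by (auto simp: odd_fun_def height_def neg_def)

lemma root_height: "rval height (root_A C i) > 0" "rval height (root_B C i) > 0" "rval height (root_D C i) > 0"
  by (auto simp: rval_def height_def root_A_def root_B_def root_D_def coord_root_def)

lemma chain_coord: "distinct [i, j, k] \<Longrightarrow> chain (coord_root C i j) (coord_root C j k)"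
  by (auto simp: chain_def coord_root_def)

lemma orth_coord: "{i, j} \<inter> {k, l} = {} \<Longrightarrow> orth (coord_root C i j) (coord_root C k l)"
  by (auto simp: orth_def coord_root_def)

lemma admissible_coord:
  assumes "i < j"
  shows "admissible (matrix_A i j) (coord_root C (Suc i) i) (coord_root C (Suc j) j)"
  using assms chain_coord[of "Suc j" j i C] orth_coord[of "Suc i" i "Suc j" j C]
  by (auto simp: admissible_def matrix_A_def)

lemma admissible_coord':
  assumes "0 < i" "i < j"
  shows "admissible (matrix_A i j) (coord_root C i (i - 1)) (coord_root C j (j - 1))"
proof -
  have "matrix_A i j = matrix_A (i - 1) (j - 1)" using assms by (auto simp: matrix_A_def)
  then show ?thesis using admissible_coord[of "i - 1" "j - 1" C] assms by simp
qed

lemma admissible_by_order: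
  fixes i j :: nat
  assumes "\<And>i j. i < j \<Longrightarrow> admissible (N i j) (\<rho> i) (\<rho> j)" "\<And>i j. N i j = N j i"
    "i \<noteq> j"
  shows "admissible (N i j) (\<rho> i) (\<rho> j)"
proof (cases "i < j")
  case False
  then have "admissible (N j i) (\<rho> j) (\<rho> i)" using assms(1)[of j i] assms(3) by simp
  then show ?thesis using admissible_sym assms(2)[of i j] by simp
qed (rule assms(1))

lemma matrix_A_sym: "matrix_A i j = matrix_A j i" by (auto simp: matrix_A_def)
lemma matrix_B_sym: "matrix_B i j = matrix_B j i" by (auto simp: matrix_B_def matrix_A_sym insert_commute)
lemma matrix_D_sym: "matrix_D i j = matrix_D j i" by (auto simp: matrix_D_def matrix_A_sym insert_commute)

lemma admissible_A: "i \<noteq> j \<Longrightarrow> admissible (matrix_A i j) (root_A C i) (root_A C j)"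
  by (rule admissible_by_order[OF _ matrix_A_sym]) (auto simp: root_A_def intro: admissible_coord)

lemma admissible_B: "i \<noteq> j \<Longrightarrow> admissible (matrix_B i j) (root_B C i) (root_B C j)"
proof (rule admissible_by_order[OF _ matrix_B_sym])
  fix i j :: nat assume ij: "i < j"
  consider "i > 0" | "i = 0" "j = 1" | "i = 0" "j > 1" using ij by linarith
  then show "admissible (matrix_B i j) (root_B C i) (root_B C j)"
  proof cases
    case 1
    then have "matrix_B i j = matrix_A i j" using ij by (auto simp: matrix_B_def doubleton_eq_iff)
    then show ?thesis using 1 ij admissible_coord'[of i j C] by (simp add: root_B_def)
  next
    case 2
    have "bchain (root_B C 0) (root_B C 1)"
      by (auto simp: bchain_def root_B_def coord_root_def neg_def)
    then show ?thesis using 2 by (simp add: admissible_def matrix_B_def)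
  next
    case 3
    have "orth (root_B C 0) (root_B C j)" using 3 by (auto simp: orth_def root_B_def coord_root_def)
    then show ?thesis using 3 by (auto simp: admissible_def matrix_B_def matrix_A_def doubleton_eq_iff)
  qed
qed

lemma admissible_D: "i \<noteq> j \<Longrightarrow> admissible (matrix_D i j) (root_D C i) (root_D C j)"
proof (rule admissible_by_order[OF _ matrix_D_sym])
  fix i j :: nat assume ij: "i < j"
  consider "i > 0" | "i = 0" "j = 1" | "i = 0" "j = 2" | "i = 0" "j > 2" using ij by linarith
  then show "admissible (matrix_D i j) (root_D C i) (root_D C j)"
  proof cases
    case 1
    then have "matrix_D i j = matrix_A i j" using ij by (auto simp: matrix_D_def doubleton_eq_iff)
    then show ?thesis using 1 ij admissible_coord'[of i j C] by (simp add: root_D_def)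
  next
    case 2
    have "orth (root_D C 0) (root_D C 1)"
      by (auto simp: orth_def root_D_def coord_root_def neg_def)
    then show ?thesis using 2 by (simp add: admissible_def matrix_D_def)
  next
    case 3
    have "chain (root_D C 2) (root_D C 0)"
      by (auto simp: chain_def root_D_def coord_root_def)
    then show ?thesis using 3 by (simp add: admissible_def matrix_D_def doubleton_eq_iff)
  next
    case 4
    have "orth (root_D C 0) (root_D C j)" using 4 by (auto simp: orth_def root_D_def coord_root_def)
    then show ?thesis using 4 by (auto simp: admissible_def matrix_D_def matrix_A_def doubleton_eq_iff)
  qed
qed

definition realises :: "('a \<Rightarrow> 'a \<Rightarrow> nat) \<Rightarrow> 'a set \<Rightarrow> ('a \<Rightarrow> ('a set \<times> nat) root) \<Rightarrow> bool" where
  "realises M C \<rho> \<longleftrightarrow> (\<forall>s\<in>C. rval height (\<rho> s) > 0 \<and> fst (vert (fst (\<rho> s))) = C \<and> fst (vert (snd (\<rho> s))) = C) \<and>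
     (\<forall>s\<in>C. \<forall>t\<in>C. s \<noteq> t \<longrightarrow> admissible (M s t) (\<rho> s) (\<rho> t))"

lemma realises_iso:
  assumes "matrix_iso M C N n" "\<And>i j. i \<noteq> j \<Longrightarrow> admissible (N i j) (\<rho> i) (\<rho> j)"
    "\<And>i. rval height (\<rho> i) > 0" "\<And>i. fst (vert (fst (\<rho> i))) = C" "\<And>i. fst (vert (snd (\<rho> i))) = C"
  shows "\<exists>\<rho>. realises M C \<rho>"
proof -
  obtain f where f: "bij_betw f {..<n} C" "\<forall>i<n. \<forall>j<n. M (f i) (f j) = N i j"
    using assms(1) unfolding matrix_iso_def by blast
  define g where "g = inv_into {..<n} f"
  have g: "g s < n" "f (g s) = s" if "s \<in> C" for s
  proof -
    have s: "s \<in> f ` {..<n}" using f(1) that by (simp add: bij_betw_def)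
    show "g s < n" using inv_into_into[OF s] by (simp add: g_def)
    show "f (g s) = s" using f_inv_into_f[OF s] by (simp add: g_def)
  qed
  have "admissible (M s t) (\<rho> (g s)) (\<rho> (g t))" if "s \<in> C" "t \<in> C" "s \<noteq> t" for s t
  proof -
    have "g s \<noteq> g t" using g(2)[OF that(1)] g(2)[OF that(2)] that(3) by metis
    moreover have "M s t = N (g s) (g t)" using f(2) g that by metis
    ultimately show ?thesis using assms(2) by simp
  qed
  then have "realises M C (\<rho> \<circ> g)" using assms(3-5) by (simp add: realises_def)
  then show ?thesis by blast
qed

lemma component_realised:
  assumes "type_A M C \<or> type_B M C \<or> type_D M C" shows "\<exists>\<rho>. realises M C \<rho>"
  using assms
proof (elim disjE)
  assume "type_A M C"
  then obtain n where "matrix_iso M C matrix_A n" unfolding type_A_def by blast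
  then show ?thesis
    by (rule realises_iso[OF _ admissible_A[of _ _ C]])
      (simp, simp add: root_height, simp_all add: root_A_def coord_root_def)
next
  assume "type_B M C"
  then obtain n where "matrix_iso M C matrix_B n" unfolding type_B_def by blast
  then show ?thesis
    by (rule realises_iso[OF _ admissible_B[of _ _ C]])
      (simp, simp add: root_height, simp_all add: root_B_def coord_root_def)
next
  assume "type_D M C"
  then obtain n where "matrix_iso M C matrix_D n" unfolding type_D_def by blast
  then show ?thesis
    by (rule realises_iso[OF _ admissible_D[of _ _ C]])
      (simp, simp add: root_height, simp_all add: root_D_def coord_root_def)
qed

text \<open>Simple reflections in different components commute and get roots on disjoint sets of vertices.\<close>

lemma signed_root_system_exists:
  assumes cox: "coxeter_matrix S M"
    and types: "\<forall>C\<in>irreducible_components S M. type_A M C \<or> type_B M C \<or> type_D M C"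
  shows "\<exists>root :: 'a \<Rightarrow> ('a set \<times> nat) root. signed_root_system S M root height"
proof -
  define E where "E = coxeter_edges S M"
  define comp where "comp s = E\<^sup>* `` {s}" for s
  have comp: "comp s \<in> irreducible_components S M" if "s \<in> S" for s
    using that by (simp add: irreducible_components_def comp_def E_def quotientI)
  have "\<forall>C\<in>irreducible_components S M. \<exists>\<rho>. realises M C \<rho>"
    using component_realised types by blast
  then obtain \<rho> where "\<forall>C\<in>irreducible_components S M. realises M C (\<rho> C)"
    using bchoice[of "irreducible_components S M" "realises M"] by blast
  then have \<rho>: "realises M C (\<rho> C)" if "C \<in> irreducible_components S M" for C using that by blast
  define root where "root s = \<rho> (comp s) s" for s
  have self: "s \<in> comp s" for s by (simp add: comp_def)
  have "sym E" using cox by (auto simp: E_def coxeter_edges_def coxeter_matrix_def sym_def)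
  then have symE: "sym (E\<^sup>*)" by (rule sym_rtrancl)
  have comp_eq: "comp t = comp s" if "t \<in> comp s" for s t
  proof -
    have st: "(s, t) \<in> E\<^sup>*" "(t, s) \<in> E\<^sup>*" using that symE by (auto simp: comp_def dest: symD)
    then show ?thesis unfolding comp_def by (auto intro: rtrancl_trans)
  qed
  have "signed_root_system S M root height"
  proof
    show "coxeter_matrix S M" by (rule cox)
    show "odd_fun height" by (rule height_odd)
    show "rval height (root s) > 0" if "s \<in> S" for s
      using \<rho>[OF comp[OF that]] self[of s] by (auto simp: realises_def root_def)
    show "admissible (M s t) (root s) (root t)" if st: "s \<in> S" "t \<in> S" "s \<noteq> t" for s t
    proof (cases "t \<in> comp s")
      case True
      then show ?thesis using \<rho>[OF comp[OF st(1)]] self[of s] st comp_eq[OF True]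
        by (auto simp: realises_def root_def)
    next
      case False
      then have "(s, t) \<notin> E" by (auto simp: comp_def)
      then have "M s t = 2" using st by (auto simp: E_def coxeter_edges_def)
      moreover have "comp s \<noteq> comp t" using False self[of t] by auto
      then have "orth (root s) (root t)"
        using \<rho>[OF comp[OF st(1)]] \<rho>[OF comp[OF st(2)]] self[of s] self[of t]
        by (auto simp: realises_def root_def orth_def)
      ultimately show ?thesis by (simp add: admissible_def)
    qed
  qed
  then show ?thesis by (rule exI[of _ root])
qed

section \<open>Transfer to a group represented by signed permutations\<close>

lemma group_prod_simps [simp]: "group_prod G [] = \<one>\<^bsub>G\<^esub>" "group_prod G (x # xs) = x \<otimes>\<^bsub>G\<^esub> group_prod G xs"
  by (simp_all add: group_prod_def)

lemma finite_support: "set xs \<subseteq> Refl \<Longrightarrow> \<exists>V. finite V \<and> set xs \<subseteq> refls V"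
proof (induction xs)
  case (Cons x xs)
  then obtain V where V: "finite V" "set xs \<subseteq> refls V" by auto
  obtain p q where x: "x = R p q" "p \<noteq> q" using Cons.prems by (auto simp: refls_def)
  let ?V = "V \<union> {vert p, vert q}"
  have "x \<in> refls ?V" using x by (auto intro: R_in_refls)
  moreover have "set xs \<subseteq> refls ?V" using V(2) refls_mono[of V ?V] by blast
  ultimately show ?case using V(1) by (intro exI[of _ ?V]) simp
qed (auto intro: exI[of _ "{}"])

text \<open>A group with a faithful action by signed permutations in which the elements of a
  conjugation invariant set \<open>T\<close> act as reflections.\<close>

locale reflection_representation = group G for G (structure) +
  fixes T :: "'a set" and \<phi> :: "'a \<Rightarrow> 'v point \<Rightarrow> 'v point"
  assumes T_carrier: "T \<subseteq> carrier G"
    and T_conj: "g \<in> carrier G \<Longrightarrow> t \<in> T \<Longrightarrow> g \<otimes> t \<otimes> inv g \<in> T"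
    and phi_one: "\<phi> \<one> = id"
    and phi_mult: "g \<in> carrier G \<Longrightarrow> h \<in> carrier G \<Longrightarrow> \<phi> (g \<otimes> h) = \<phi> g \<circ> \<phi> h"
    and phi_inj: "inj_on \<phi> (carrier G)"
    and phi_T: "t \<in> T \<Longrightarrow> \<phi> t \<in> Refl"
begin

lemma T_in [intro, simp]: "t \<in> T \<Longrightarrow> t \<in> carrier G" using T_carrier by auto

lemma T_invol: assumes "t \<in> T" shows "t \<otimes> t = \<one>" "inv t = t"
proof -
  have "\<phi> (t \<otimes> t) = \<phi> \<one>" using assms by (simp add: phi_mult refl_comp phi_T phi_one)
  then show "t \<otimes> t = \<one>" using assms by (intro inj_onD[OF phi_inj]) auto
  then show "inv t = t" using assms by (intro inv_equality) auto
qed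

lemma phi_conj: assumes "a \<in> T" "b \<in> T"
  shows "\<phi> (inv b \<otimes> a \<otimes> b) = conj_by (\<phi> b) (\<phi> a)" "\<phi> (b \<otimes> a \<otimes> inv b) = conj_by (\<phi> b) (\<phi> a)"
  using assms T_invol(2)[OF assms(2)] by (simp_all add: phi_mult conj_by_def comp_assoc)

lemma phi_prod: "ts \<in> lists T \<Longrightarrow> group_prod G ts \<in> carrier G \<and> \<phi> (group_prod G ts) = composite (map \<phi> ts)"
proof (induction ts)
  case (Cons t ts)
  then show ?case by (simp add: phi_mult)
qed (simp add: phi_one)


lemma hurwitz_letter_split:
  "hurwitz_letter G (Sigma (length xs)) (xs @ [a, b] @ ys) = xs @ [b, inv b \<otimes> a \<otimes> b] @ ys"
  "hurwitz_letter G (Sigma_inv (length xs)) (xs @ [a, b] @ ys) = xs @ [a \<otimes> b \<otimes> inv a, a] @ ys"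
  by (simp_all add: nth_append list_update_append)

lemma split_two: assumes "Suc i < length ts"
  obtains xs a b ys where "ts = xs @ [a, b] @ ys" "length xs = i"
proof -
  have "ts = take i ts @ [ts ! i, ts ! Suc i] @ drop (Suc (Suc i)) ts"
    using assms by (metis Cons_nth_drop_Suc Suc_lessD append_Cons append_Nil append_take_drop_id)
  then show ?thesis using that assms by (metis Suc_lessD length_take less_imp_le_nat min.absorb2)
qed

lemma letter_cases:
  assumes "l \<in> braid_letters (length ts)"
  obtains xs a b ys where "ts = xs @ [a, b] @ ys" "hurwitz_letter G l ts = xs @ [b, inv b \<otimes> a \<otimes> b] @ ys"
  | xs a b ys where "ts = xs @ [a, b] @ ys" "hurwitz_letter G l ts = xs @ [a \<otimes> b \<otimes> inv a, a] @ ys"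
proof -
  obtain i where i: "Suc i < length ts" "l = Sigma i \<or> l = Sigma_inv i"
    using assms by (auto simp: braid_letters_def)
  obtain xs a b ys where "ts = xs @ [a, b] @ ys" "length xs = i" using split_two[OF i(1)] .
  then show ?thesis using i(2) hurwitz_letter_split that by metis
qed

lemma conj_class_conj:
  assumes H: "subgroup H G" and x: "x \<in> carrier G" and k: "k \<in> H"
  shows "conj_class G H (k \<otimes> x \<otimes> inv k) = conj_class G H x"
proof -
  have kc: "k \<in> carrier G" using subgroup.mem_carrier[OF H k] .
  have *: "h \<otimes> (k \<otimes> x \<otimes> inv k) \<otimes> inv h = (h \<otimes> k) \<otimes> x \<otimes> inv (h \<otimes> k)" if "h \<in> H" for h
    using subgroup.mem_carrier[OF H that] kc x by (simp add: m_assoc inv_mult_group)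
  show ?thesis
  proof (intro equalityI subsetI)
    fix y assume "y \<in> conj_class G H (k \<otimes> x \<otimes> inv k)"
    then show "y \<in> conj_class G H x"
      using * subgroup.m_closed[OF H _ k] unfolding conj_class_def by blast
  next
    fix y assume "y \<in> conj_class G H x"
    then obtain h where h: "h \<in> H" "y = h \<otimes> x \<otimes> inv h" unfolding conj_class_def by blast
    have hk: "h \<otimes> inv k \<in> H" using h k H by (simp add: subgroup.m_closed subgroup.m_inv_closed)
    have "(h \<otimes> inv k) \<otimes> k = h" using subgroup.mem_carrier[OF H h(1)] kc by (simp add: m_assoc)
    then have "y = (h \<otimes> inv k) \<otimes> (k \<otimes> x \<otimes> inv k) \<otimes> inv (h \<otimes> inv k)" using *[OF hk] h(2) by simp
    then show "y \<in> conj_class G H (k \<otimes> x \<otimes> inv k)" unfolding conj_class_def using hk by blast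
  qed
qed

lemma generate_eqI:
  assumes "A \<subseteq> carrier G" "B \<subseteq> carrier G" "A \<subseteq> generate G B" "B \<subseteq> generate G A"
  shows "generate G A = generate G B"
  using generate_subgroup_incl[OF assms(3) generate_is_subgroup[OF assms(2)]]
    generate_subgroup_incl[OF assms(4) generate_is_subgroup[OF assms(1)]] by blast

lemma generate_conj:
  assumes "a \<in> carrier G" "b \<in> carrier G" "Z \<subseteq> carrier G"
  shows "generate G (insert (b \<otimes> a \<otimes> inv b) (insert b Z)) = generate G (insert a (insert b Z))"
proof (rule generate_eqI)
  have "b \<otimes> a \<otimes> inv b \<in> generate G (insert a (insert b Z))"
    by (intro generate.eng generate.inv generate.incl) simp_all
  then show "insert (b \<otimes> a \<otimes> inv b) (insert b Z) \<subseteq> generate G (insert a (insert b Z))"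
    by (auto intro: generate.incl)
  let ?B = "insert (b \<otimes> a \<otimes> inv b) (insert b Z)"
  have "inv b \<otimes> (b \<otimes> a \<otimes> inv b) \<otimes> b \<in> generate G ?B"
    by (rule generate.eng[OF generate.eng[OF generate.inv generate.incl] generate.incl]) simp_all
  moreover have "inv b \<otimes> (b \<otimes> a \<otimes> inv b) \<otimes> b = a"
    using assms by (simp add: m_assoc flip: m_assoc[of "inv b" b])
  ultimately show "insert a (insert b Z) \<subseteq> generate G ?B"
    by (auto intro: generate.incl)
qed (use assms in auto)

lemma letter_invariant:
  assumes ts: "ts \<in> lists T" and l: "l \<in> braid_letters (length ts)"
  defines "us \<equiv> hurwitz_letter G l ts"
  shows "us \<in> lists T" "length us = length ts" "generate G (set us) = generate G (set ts)"
    "image_mset (conj_class G (generate G (set ts))) (mset us) =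
     image_mset (conj_class G (generate G (set ts))) (mset ts)"
proof -
  let ?H = "generate G (set ts)"
  have H: "subgroup ?H G" using ts by (intro generate_is_subgroup) auto
  have "us \<in> lists T \<and> length us = length ts \<and> generate G (set us) = ?H \<and>
    image_mset (conj_class G ?H) (mset us) = image_mset (conj_class G ?H) (mset ts)"
    using l
  proof (cases rule: letter_cases)
    case (1 xs a b ys)
    have T: "a \<in> T" "b \<in> T" "set xs \<subseteq> T" "set ys \<subseteq> T" using ts 1 by auto
    have i: "inv b \<otimes> a \<otimes> b = b \<otimes> a \<otimes> inv b" using T_invol(2)[OF T(2)] by simp
    have "b \<in> ?H" using 1 by (auto intro: generate.incl)
    from conj_class_conj[OF H _ this, of a]
    have c: "conj_class G ?H (b \<otimes> a \<otimes> inv b) = conj_class G ?H a" using T by simp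
    have us: "us = xs @ [b, b \<otimes> a \<otimes> inv b] @ ys" using 1 i by (simp add: us_def)
    have "set us = insert (b \<otimes> a \<otimes> inv b) (insert b (set xs \<union> set ys))"
      "set ts = insert a (insert b (set xs \<union> set ys))" using us 1 by auto
    then have "generate G (set us) = ?H" using generate_conj[of a b "set xs \<union> set ys"] T T_carrier
      by (simp add: subset_trans[OF _ T_carrier])
    then show ?thesis using c 1 T us T_conj[of b a] by auto
  next
    case (2 xs a b ys)
    have T: "a \<in> T" "b \<in> T" "set xs \<subseteq> T" "set ys \<subseteq> T" using ts 2 by auto
    have "a \<in> ?H" using 2 by (auto intro: generate.incl)
    from conj_class_conj[OF H _ this, of b]
    have c: "conj_class G ?H (a \<otimes> b \<otimes> inv a) = conj_class G ?H b" using T by simp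
    have us: "us = xs @ [a \<otimes> b \<otimes> inv a, a] @ ys" using 2 by (simp add: us_def)
    have "set us = insert (a \<otimes> b \<otimes> inv a) (insert a (set xs \<union> set ys))"
      "set ts = insert b (insert a (set xs \<union> set ys))" using us 2 by auto
    then have "generate G (set us) = ?H" using generate_conj[of b a "set xs \<union> set ys"] T T_carrier
      by (simp add: subset_trans[OF _ T_carrier])
    then show ?thesis using c 2 T us T_conj[of a b] by auto
  qed
  then show "us \<in> lists T" "length us = length ts" "generate G (set us) = ?H"
    "image_mset (conj_class G ?H) (mset us) = image_mset (conj_class G ?H) (mset ts)" by auto
qed

lemma action_invariant:
  assumes "ts \<in> lists T" "w \<in> lists (braid_letters (length ts))"
  shows "hurwitz_action G w ts \<in> lists T \<and> length (hurwitz_action G w ts) = length ts \<and>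
    generate G (set (hurwitz_action G w ts)) = generate G (set ts) \<and>
    image_mset (conj_class G (generate G (set ts))) (mset (hurwitz_action G w ts)) =
     image_mset (conj_class G (generate G (set ts))) (mset ts)"
  using assms(2)
proof (induction w)
  case (Cons l w)
  let ?u = "hurwitz_action G w ts"
  have u: "?u \<in> lists T" "length ?u = length ts" "generate G (set ?u) = generate G (set ts)"
    "image_mset (conj_class G (generate G (set ts))) (mset ?u) =
     image_mset (conj_class G (generate G (set ts))) (mset ts)" using Cons by auto
  have l: "l \<in> braid_letters (length ?u)" unfolding u(2) using Cons.hyps by simp
  have "hurwitz_action G (l # w) ts = hurwitz_letter G l ?u" by (simp add: hurwitz_action_def)
  then show ?case using letter_invariant[OF u(1) l] u by simp
qed (use assms(1) in \<open>simp add: hurwitz_action_def\<close>)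

lemma orbit_refl: "ts \<in> hurwitz_orbit G ts"
  unfolding hurwitz_orbit_def by (auto intro!: exI[of _ "[]"] simp: hurwitz_action_def)

lemma orbit_trans:
  assumes "ts \<in> lists T" "us \<in> hurwitz_orbit G ts" "vs \<in> hurwitz_orbit G us"
  shows "vs \<in> hurwitz_orbit G ts"
proof -
  obtain w where w: "us = hurwitz_action G w ts" "w \<in> lists (braid_letters (length ts))"
    using assms(2) unfolding hurwitz_orbit_def by blast
  obtain w' where w': "vs = hurwitz_action G w' us" "w' \<in> lists (braid_letters (length us))"
    using assms(3) unfolding hurwitz_orbit_def by blast
  have "length us = length ts" using action_invariant[OF assms(1) w(2)] w(1) by simp
  moreover have "vs = hurwitz_action G (w' @ w) ts" using w w' by (simp add: hurwitz_action_def)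
  moreover have "w' @ w \<in> lists (braid_letters (length ts))" using w(2) w'(2) calculation(1) by simp
  ultimately show ?thesis unfolding hurwitz_orbit_def by blast
qed

lemma orbit_letter: "l \<in> braid_letters (length ts) \<Longrightarrow> hurwitz_letter G l ts \<in> hurwitz_orbit G ts"
  unfolding hurwitz_orbit_def by (intro CollectI exI[of _ "[l]"]) (auto simp: hurwitz_action_def)

text \<open>By faithfulness, a Hurwitz move between the images can be performed on the group elements. Both directions are
  carried along because the equivalence is closed under symmetry.\<close>

lemma lift_hurwitz_equiv:
  assumes "hurwitz_equiv x y" "ts \<in> lists T"
  shows "(map \<phi> ts = x \<longrightarrow> (\<exists>us\<in>lists T. map \<phi> us = y \<and> us \<in> hurwitz_orbit G ts)) \<and>
    (map \<phi> ts = y \<longrightarrow> (\<exists>us\<in>lists T. map \<phi> us = x \<and> us \<in> hurwitz_orbit G ts))"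
  using assms
proof (induction arbitrary: ts rule: hurwitz_equiv.induct)
  case (step a b xs ys)
  show ?case
  proof (intro conjI impI)
    assume "map \<phi> ts = xs @ [a, b] @ ys"
    then obtain xs' a' b' ys' where ts: "ts = xs' @ [a', b'] @ ys'"
      "map \<phi> xs' = xs" "\<phi> a' = a" "\<phi> b' = b" "map \<phi> ys' = ys"
      by (auto simp: map_eq_append_conv map_eq_Cons_conv)
    have l: "Sigma (length xs') \<in> braid_letters (length ts)" using ts by (auto simp: braid_letters_def)
    have T: "a' \<in> T" "b' \<in> T" using ts step.prems by auto
    have "map \<phi> (hurwitz_letter G (Sigma (length xs')) ts) = xs @ [b, conj_by b a] @ ys"
      unfolding ts(1) hurwitz_letter_split using ts phi_conj[OF T] by simp
    then show "\<exists>us\<in>lists T. map \<phi> us = xs @ [b, conj_by b a] @ ys \<and> us \<in> hurwitz_orbit G ts"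
      using orbit_letter[OF l] letter_invariant(1)[OF step.prems l] by blast
  next
    assume "map \<phi> ts = xs @ [b, conj_by b a] @ ys"
    then obtain xs' b' c' ys' where ts: "ts = xs' @ [b', c'] @ ys'"
      "map \<phi> xs' = xs" "\<phi> b' = b" "\<phi> c' = conj_by b a" "map \<phi> ys' = ys"
      by (auto simp: map_eq_append_conv map_eq_Cons_conv)
    have l: "Sigma_inv (length xs') \<in> braid_letters (length ts)" using ts by (auto simp: braid_letters_def)
    have T: "c' \<in> T" "b' \<in> T" using ts step.prems by auto
    have "map \<phi> (hurwitz_letter G (Sigma_inv (length xs')) ts) = xs @ [a, b] @ ys"
      unfolding ts(1) hurwitz_letter_split using ts phi_conj[OF T] step.hyps by simp
    then show "\<exists>us\<in>lists T. map \<phi> us = xs @ [a, b] @ ys \<and> us \<in> hurwitz_orbit G ts"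
      using orbit_letter[OF l] letter_invariant(1)[OF step.prems l] by blast
  qed
next
  case (refl t)
  then show ?case using orbit_refl by blast
next
  case (sym t s)
  then show ?case by blast
next
  case (trans t s u)
  show ?case
  proof (intro conjI impI)
    assume "map \<phi> ts = t"
    then obtain us where us: "us \<in> lists T" "map \<phi> us = s" "us \<in> hurwitz_orbit G ts"
      using trans.IH(1)[OF trans.prems] by blast
    obtain vs where "vs \<in> lists T" "map \<phi> vs = u" "vs \<in> hurwitz_orbit G us"
      using trans.IH(2)[OF us(1)] us(2) by blast
    then show "\<exists>us\<in>lists T. map \<phi> us = u \<and> us \<in> hurwitz_orbit G ts"
      using orbit_trans[OF trans.prems us(3)] by blast
  next
    assume "map \<phi> ts = u"
    then obtain us where us: "us \<in> lists T" "map \<phi> us = s" "us \<in> hurwitz_orbit G ts"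
      using trans.IH(2)[OF trans.prems] by blast
    obtain vs where "vs \<in> lists T" "map \<phi> vs = t" "vs \<in> hurwitz_orbit G us"
      using trans.IH(1)[OF us(1)] us(2) by blast
    then show "\<exists>us\<in>lists T. map \<phi> us = t \<and> us \<in> hurwitz_orbit G ts"
      using orbit_trans[OF trans.prems us(3)] by blast
  qed
qed

lemma orbit_if_hurwitz_equiv:
  assumes "ts \<in> lists T" "rs \<in> lists T" "hurwitz_equiv (map \<phi> ts) (map \<phi> rs)"
  shows "rs \<in> hurwitz_orbit G ts"
proof -
  obtain us where us: "us \<in> lists T" "map \<phi> us = map \<phi> rs" "us \<in> hurwitz_orbit G ts"
    using lift_hurwitz_equiv[OF assms(3,1)] by blast
  have "inj_on \<phi> (set us \<union> set rs)" using phi_inj assms us by (auto intro: inj_on_subset)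
  then have "us = rs" using us(2) by (simp add: inj_on_map_eq_map)
  then show ?thesis using us by simp
qed

lemma orb_generate:
  assumes "rs \<in> lists T" "h \<in> generate G (set rs)"
  shows "h \<in> carrier G \<and> (p, \<phi> h p) \<in> orb (map \<phi> rs)"
  using assms(2)
proof (induction arbitrary: p rule: generate.induct)
  case one
  show ?case by (simp add: phi_one)
next
  case (incl h)
  then show ?case using assms(1) by (auto intro!: orb_step)
next
  case (inv h)
  then have "h \<in> T" using assms(1) by auto
  then show ?case using inv T_invol(2) by (auto intro!: orb_step)
next
  case (eng h1 h2)
  then show ?case using orb_trans[of p "\<phi> h2 p" _ "\<phi> h1 (\<phi> h2 p)"] by (auto simp: phi_mult)
qed

lemma conj_inv_generate:
  assumes "ts \<in> lists T" "conj_inv (map \<phi> ts) Q" "h \<in> generate G (set ts)" "x \<in> T"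
  shows "Q (\<phi> (h \<otimes> x \<otimes> inv h)) = Q (\<phi> x)"
proof -
  have "h \<in> carrier G \<and> (\<forall>x\<in>T. Q (\<phi> (h \<otimes> x \<otimes> inv h)) = Q (\<phi> x))"
    using assms(3)
  proof (induction rule: generate.induct)
    case one
    then show ?case by simp
  next
    case (incl h)
    then have h: "h \<in> T" "h \<in> set ts" using assms(1) by auto
    have "Q (\<phi> (h \<otimes> x \<otimes> inv h)) = Q (\<phi> x)" if "x \<in> T" for x
      using assms(2) h phi_conj(2)[OF that h(1)] phi_T[OF that] by (auto simp: conj_inv_def)
    then show ?case using h by auto
  next
    case (inv h)
    then have h: "h \<in> T" "h \<in> set ts" using assms(1) by auto
    have "Q (\<phi> (h \<otimes> x \<otimes> inv h)) = Q (\<phi> x)" if "x \<in> T" for x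
      using assms(2) h phi_conj(2)[OF that h(1)] phi_T[OF that] by (auto simp: conj_inv_def)
    then show ?case using h T_invol(2)[OF h(1)] by auto
  next
    case (eng h k)
    have "(h \<otimes> k) \<otimes> x \<otimes> inv (h \<otimes> k) = h \<otimes> (k \<otimes> x \<otimes> inv k) \<otimes> inv h" if "x \<in> T" for x
      using eng that by (simp add: m_assoc inv_mult_group)
    moreover have "k \<otimes> x \<otimes> inv k \<in> T" if "x \<in> T" for x using T_conj eng that by blast
    ultimately show ?case using eng by auto
  qed
  then show ?thesis using assms(4) by blast
qed

text \<open>Reflections in the same class under \<open>H\<close> have the same value under every predicate on
  signed permutations that is invariant under conjugation by the entries, so equal multisets of classes give
  equal counts; equal subgroups give equal orbit relations.\<close>

theorem orbit_iff:
  assumes ts: "ts \<in> lists T" and rs: "rs \<in> lists T" and prod: "group_prod G ts = group_prod G rs"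
  shows "rs \<in> hurwitz_orbit G ts \<longleftrightarrow> generate G (set ts) = generate G (set rs) \<and>
    image_mset (conj_class G (generate G (set ts))) (mset ts) =
    image_mset (conj_class G (generate G (set ts))) (mset rs)"
proof
  assume "rs \<in> hurwitz_orbit G ts"
  then show "generate G (set ts) = generate G (set rs) \<and>
    image_mset (conj_class G (generate G (set ts))) (mset ts) =
    image_mset (conj_class G (generate G (set ts))) (mset rs)"
    using action_invariant[OF ts] unfolding hurwitz_orbit_def by force
next
  let ?H = "generate G (set ts)"
  assume "?H = generate G (set rs) \<and>
    image_mset (conj_class G ?H) (mset ts) = image_mset (conj_class G ?H) (mset rs)"
  then have gen: "?H = generate G (set rs)"
    and cls: "image_mset (conj_class G ?H) (mset ts) = image_mset (conj_class G ?H) (mset rs)" by auto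
  show "rs \<in> hurwitz_orbit G ts"
  proof -
    have "set (map \<phi> (ts @ rs)) \<subseteq> Refl" using ts rs phi_T by auto
    from finite_support[OF this] obtain V where V: "finite V" "set (map \<phi> (ts @ rs)) \<subseteq> refls V" by blast
    have "hurwitz_equiv (map \<phi> ts) (map \<phi> rs)"
    proof (rule hurwitz_equiv_if_same_invariants[OF V(1)])
      show "set (map \<phi> ts) \<subseteq> refls V" "set (map \<phi> rs) \<subseteq> refls V" using V(2) by auto
      show "composite (map \<phi> ts) = composite (map \<phi> rs)" using phi_prod[OF ts] phi_prod[OF rs] prod by simp
      have sub: "orb (map \<phi> us) \<subseteq> orb (map \<phi> vs)"
        if "us \<in> lists T" "vs \<in> lists T" "generate G (set us) = generate G (set vs)" for us vs
      proof (rule orb_least)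
        fix p x assume "x \<in> set (map \<phi> us)"
        then obtain u where u: "u \<in> set us" "x = \<phi> u" by auto
        have "u \<in> generate G (set vs)" using generate.incl[OF u(1), of G] that(3) by simp
        from orb_generate[OF that(2) this, of p] show "(p, x p) \<in> orb (map \<phi> vs)" using u(2) by simp
      qed
      show "orb (map \<phi> ts) = orb (map \<phi> rs)" using sub[OF ts rs gen] sub[OF rs ts gen[symmetric]] by (rule equalityI)
      fix Q :: "('v point \<Rightarrow> 'v point) \<Rightarrow> bool" assume Q: "conj_inv (map \<phi> ts) Q"
      let ?Q = "\<lambda>C. \<exists>y\<in>C. Q (\<phi> y)"
      have QQ: "?Q (conj_class G ?H x) \<longleftrightarrow> Q (\<phi> x)" if x: "x \<in> T" for x
      proof
        assume "?Q (conj_class G ?H x)"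
        then obtain h where "h \<in> ?H" "Q (\<phi> (h \<otimes> x \<otimes> inv h))" unfolding conj_class_def by blast
        then show "Q (\<phi> x)" using conj_inv_generate[OF ts Q _ x] by simp
      next
        assume "Q (\<phi> x)"
        moreover have "x = \<one> \<otimes> x \<otimes> inv \<one>" using x by simp
        then have "x \<in> conj_class G ?H x" unfolding conj_class_def using generate.one[of G "set ts"] by blast
        ultimately show "?Q (conj_class G ?H x)" by blast
      qed
      have count: "cnt Q (map \<phi> us) = size (filter_mset ?Q (image_mset (conj_class G ?H) (mset us)))"
        if "us \<in> lists T" for us
        using that by (induction us) (simp_all add: QQ)
      show "cnt Q (map \<phi> ts) = cnt Q (map \<phi> rs)" unfolding count[OF ts] count[OF rs] cls ..
    qed
    then show ?thesis by (rule orbit_if_hurwitz_equiv[OF ts rs])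
  qed
qed

end

section \<open>The classical Coxeter groups\<close>

lemma (in group) group_prod_closed: "u \<in> lists (carrier G) \<Longrightarrow> group_prod G u \<in> carrier G"
  by (induction u) auto

lemma (in group) group_prod_append:
  "u \<in> lists (carrier G) \<Longrightarrow> v \<in> lists (carrier G) \<Longrightarrow> group_prod G (u @ v) = group_prod G u \<otimes> group_prod G v"
  by (induction u) (auto simp: m_assoc group_prod_closed)

text \<open>An element acts through any word representing it, which is well defined by the relations
  and faithful by \<open>rep_faithful\<close>.\<close>

lemma coxeter_representation:
  fixes W :: "('a, 'b) monoid_scheme"
  assumes csys: "coxeter_system W S M" and rs: "signed_root_system S M (root :: 'a \<Rightarrow> 'v root) \<Lambda>"
  shows "\<exists>\<phi> :: 'a \<Rightarrow> 'v point \<Rightarrow> 'v point. reflection_representation W (reflections W S) \<phi>"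
proof -
  interpret W: group W using csys by (simp add: coxeter_system_def)
  interpret signed_root_system S M root \<Lambda> by (rule rs)
  have S: "S \<subseteq> carrier W" and gen: "generate W S = carrier W"
    and pres: "\<And>u v. u \<in> lists S \<Longrightarrow> v \<in> lists S \<Longrightarrow> group_prod W u = group_prod W v \<longleftrightarrow> u \<approx> v"
    using csys unfolding coxeter_system_def by blast+
  have lS: "u \<in> lists S \<Longrightarrow> u \<in> lists (carrier W)" for u using S lists_mono by blast
  have s_inv: "inv\<^bsub>W\<^esub> s = s" if "s \<in> S" for s
  proof -
    have "[s, s] \<approx> []" using eqv_cancel[of s "[]" "[]"] that by simp
    then have "group_prod W [s, s] = group_prod W []" using pres[of "[s, s]" "[]"] that by simp
    then have "s \<otimes>\<^bsub>W\<^esub> s = \<one>\<^bsub>W\<^esub>" using that S by (auto simp: subset_iff)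
    then show ?thesis using that S by (intro W.inv_equality) auto
  qed
  have word: "\<exists>u\<in>lists S. group_prod W u = g" if "g \<in> carrier W" for g
    using that unfolding gen[symmetric]
  proof (induction rule: generate.induct)
    case one
    show ?case by (intro bexI[of _ "[]"]) auto
  next
    case (incl h)
    then show ?case using S by (intro bexI[of _ "[h]"]) (auto simp: subset_iff)
  next
    case (inv h)
    then show ?case using S s_inv by (intro bexI[of _ "[h]"]) (auto simp: subset_iff)
  next
    case (eng g h)
    then obtain u v where "u \<in> lists S" "group_prod W u = g" "v \<in> lists S" "group_prod W v = h" by blast
    then show ?case using W.group_prod_append lS by (intro bexI[of _ "u @ v"]) auto
  qed
  define \<phi> where "\<phi> g = rep (SOME u. u \<in> lists S \<and> group_prod W u = g)" for g
  have phi: "\<phi> (group_prod W u) = rep u" if u: "u \<in> lists S" for u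
  proof -
    let ?v = "SOME v. v \<in> lists S \<and> group_prod W v = group_prod W u"
    have "?v \<in> lists S \<and> group_prod W ?v = group_prod W u" by (rule someI) (use u in blast)
    then have "?v \<approx> u" using pres u by blast
    then show ?thesis unfolding \<phi>_def by (rule rep_eqv)
  qed
  have mult: "\<phi> (g \<otimes>\<^bsub>W\<^esub> h) = \<phi> g \<circ> \<phi> h" if gh: "g \<in> carrier W" "h \<in> carrier W" for g h
  proof -
    obtain u where u: "u \<in> lists S" "group_prod W u = g" using word[OF gh(1)] by blast
    obtain v where v: "v \<in> lists S" "group_prod W v = h" using word[OF gh(2)] by blast
    note uv = u v
    have "g \<otimes>\<^bsub>W\<^esub> h = group_prod W (u @ v)" using W.group_prod_append lS uv by simp
    moreover have "u @ v \<in> lists S" using uv by simp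
    ultimately have "\<phi> (g \<otimes>\<^bsub>W\<^esub> h) = rep u \<circ> rep v" using phi by simp
    then show ?thesis using phi[OF u(1)] phi[OF v(1)] u(2) v(2) by simp
  qed
  have one: "\<phi> \<one>\<^bsub>W\<^esub> = id" using phi[of "[]"] by simp
  have kernel: "g = \<one>\<^bsub>W\<^esub>" if g: "g \<in> carrier W" "\<phi> g = id" for g
  proof -
    obtain u where u: "u \<in> lists S" "group_prod W u = g" using word g by blast
    then have "rep u = id" using phi[OF u(1)] g(2) by simp
    then have "u \<approx> []" by (rule rep_faithful[OF u(1)])
    then show ?thesis using pres[of u "[]"] u by simp
  qed
  have inj: "inj_on \<phi> (carrier W)"
  proof (rule inj_onI)
    fix g h assume gh: "g \<in> carrier W" "h \<in> carrier W" "\<phi> g = \<phi> h"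
    have "\<phi> (g \<otimes>\<^bsub>W\<^esub> inv\<^bsub>W\<^esub> h) = \<phi> (h \<otimes>\<^bsub>W\<^esub> inv\<^bsub>W\<^esub> h)" using gh by (simp only: mult W.inv_closed)
    then have "g \<otimes>\<^bsub>W\<^esub> inv\<^bsub>W\<^esub> h = \<one>\<^bsub>W\<^esub>" using kernel gh one by simp
    then show "g = h" using gh W.inv_equality[of g "inv\<^bsub>W\<^esub> h"] by simp
  qed
  have refl: "\<phi> t \<in> Refl" if t: "t \<in> reflections W S" for t
  proof -
    obtain g s where gs: "t = g \<otimes>\<^bsub>W\<^esub> s \<otimes>\<^bsub>W\<^esub> inv\<^bsub>W\<^esub> g" "g \<in> carrier W" "s \<in> S"
      using t unfolding reflections_def by blast
    obtain u where u: "u \<in> lists S" "group_prod W u = g" using word gs by blast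
    have sc: "s \<in> carrier W" using gs S by blast
    have "\<phi> s = root_refl (root s)" using phi[of "[s]"] gs(3) sc by simp
    moreover have gi: "\<phi> g \<circ> \<phi> (inv\<^bsub>W\<^esub> g) = id" "\<phi> (inv\<^bsub>W\<^esub> g) \<circ> \<phi> g = id"
      using mult[of g "inv\<^bsub>W\<^esub> g"] mult[of "inv\<^bsub>W\<^esub> g" g] gs(2) one by simp_all
    moreover have "\<phi> g (neg z) = neg (\<phi> g z)" for z
    proof -
      have "rep u (neg z) = neg (rep u z)" by (induction u) auto
      then show ?thesis using phi[OF u(1)] u(2) by simp
    qed
    moreover have ig: "inj (\<phi> g)" 
      using fun_cong[OF gi(2)] by (intro inj_on_inverseI[of _ "\<phi> (inv\<^bsub>W\<^esub> g)"]) simp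
    ultimately have "\<phi> g \<circ> \<phi> s = R (\<phi> g (fst (root s))) (\<phi> g (snd (root s))) \<circ> \<phi> g"
      using signed_R[of "\<phi> g"] by simp
    then have "\<phi> g (\<phi> s z) = R (\<phi> g (fst (root s))) (\<phi> g (snd (root s))) (\<phi> g z)" for z
      by (simp add: fun_eq_iff)
    moreover have "\<phi> g (\<phi> (inv\<^bsub>W\<^esub> g) z) = z" for z using fun_cong[OF gi(1), of z] by simp
    moreover have "\<phi> t = (\<phi> g \<circ> \<phi> s) \<circ> \<phi> (inv\<^bsub>W\<^esub> g)" using gs sc by (simp add: mult comp_assoc)
    ultimately have "\<phi> t = R (\<phi> g (fst (root s))) (\<phi> g (snd (root s)))" by (simp add: fun_eq_iff)
    moreover have "\<phi> g (fst (root s)) \<noteq> \<phi> g (snd (root s))" using ig root_neq[OF gs(3)] by (simp add: inj_eq)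
    ultimately show ?thesis by (auto intro!: R_in_refls)
  qed
  have "reflection_representation W (reflections W S) \<phi>"
  proof
    show "reflections W S \<subseteq> carrier W" using S by (auto simp: reflections_def)
    show "g \<otimes>\<^bsub>W\<^esub> t \<otimes>\<^bsub>W\<^esub> inv\<^bsub>W\<^esub> g \<in> reflections W S"
      if gt: "g \<in> carrier W" "t \<in> reflections W S" for g t
    proof -
      obtain h s where hs: "t = h \<otimes>\<^bsub>W\<^esub> s \<otimes>\<^bsub>W\<^esub> inv\<^bsub>W\<^esub> h" "h \<in> carrier W" "s \<in> S"
        using gt(2) unfolding reflections_def by blast
      then have "s \<in> carrier W" using S by blast
      then have "g \<otimes>\<^bsub>W\<^esub> t \<otimes>\<^bsub>W\<^esub> inv\<^bsub>W\<^esub> g = (g \<otimes>\<^bsub>W\<^esub> h) \<otimes>\<^bsub>W\<^esub> s \<otimes>\<^bsub>W\<^esub> inv\<^bsub>W\<^esub> (g \<otimes>\<^bsub>W\<^esub> h)"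
        using hs gt(1) by (simp add: W.m_assoc W.inv_mult_group)
      then show ?thesis using hs gt(1) unfolding reflections_def by blast
    qed
  qed (use mult inj refl one in auto)
  then show ?thesis by blast
qed

theorem theorem1p3:
  fixes W :: "('a, 'b) monoid_scheme"
    and S :: "'a set"
    and M :: "'a \<Rightarrow> 'a \<Rightarrow> nat"
    and g :: 'a
    and ts rs :: "'a list"
  assumes "coxeter_system W S M"
    and "finite (carrier W)"
    and "\<forall>C \<in> irreducible_components S M. type_A M C \<or> type_B M C \<or> type_D M C"
    and "g \<in> carrier W"
    and "reflection_factorization W S g ts"
    and "reflection_factorization W S g rs"
  shows "rs \<in> hurwitz_orbit W ts \<longleftrightarrow>
    generate W (set ts) = generate W (set rs) \<and>
    image_mset (conj_class W (generate W (set ts))) (mset ts) =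
      image_mset (conj_class W (generate W (set ts))) (mset rs)"
proof -
  have "coxeter_matrix S M" using assms(1) by (simp add: coxeter_system_def)
  then obtain root :: "'a \<Rightarrow> ('a set \<times> nat) root" where "signed_root_system S M root height"
    using signed_root_system_exists assms(3) by blast
  then obtain \<phi> :: "'a \<Rightarrow> ('a set \<times> nat) point \<Rightarrow> ('a set \<times> nat) point"
    where "reflection_representation W (reflections W S) \<phi>"
    using coxeter_representation[OF assms(1)] by blast
  then interpret reflection_representation W "reflections W S" \<phi> .
  show ?thesis
    using assms(5,6) by (intro orbit_iff) (auto simp: reflection_factorization_def)
qed

end
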